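(* Let $p$ be a prime, let $H$ be a non-abelian just-infinite pro-$p$ group, let $Z\cong\mathbb{Z}_p$, and let $G=H\times Z$. Then $G$ has precisely countably infinitely many solitary subgroups.
   Context: For a profinite group $G$, $\mathcal{S}(G)$ is the set of closed subgroups of $G$ with its natural profinite topology: a base of open neighbourhoods of $H\in\mathcal{S}(G)$ is given by the sets $B(H,N)=\{K \text{ closed subgroup of } G \mid KN=HN\}$, with $N$ ranging over the open normal subgroups of $G$. For a space $X$, $X'$ denotes $X$ minus its isolated points; a space is perfect if it has no isolated points. If $\mathcal{S}(G)$ is not perfect, a closed subgroup $H$ of $G$ is solitary in $G$ if $H\in\mathcal{S}(G)'$ and $H$ is isolated in the subspace $\mathcal{S}(G)'$. A profinite group is just-infinite if it is infinite and every non-trivial closed normal subgroup is open. $\mathbb{Z}_p$ is the additive group of $p$-adic integers. *)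

theory Defs
  imports
    "HOL-Analysis.Analysis"
    "HOL-Algebra.Product_Groups"
    "HOL-Computational_Algebra.Primes"
begin

section \<open>Profinite groups\<close>

locale topological_group = group G for G (structure) +
  fixes T :: "'a topology"
  assumes topspace_eq_carrier: "topspace T = carrier G"
    and continuous_mult: "continuous_map (prod_topology T T) T (\<lambda>(x, y). x \<otimes> y)"
    and continuous_inv: "continuous_map T T (\<lambda>x. inv x)"

locale profinite_group = topological_group +
  assumes compact: "compact_space T"
    and Hausdorff: "Hausdorff_space T"
    and totally_disconnected: "x \<in> topspace T \<Longrightarrow> connected_component_of_set T x = {x}"

text \<open>Since \<^const>\<open>card\<close> of an infinite set is 0, the condition on the quotient orders also
  expresses that the quotients are finite (as they are by compactness).\<close>

locale pro_p_group = profinite_group +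
  fixes p :: nat
  assumes order_quotient: "N \<lhd> G \<Longrightarrow> openin T N \<Longrightarrow> \<exists>k. order (G Mod N) = p ^ k"

definition just_infinite :: "('a, 'm) monoid_scheme \<Rightarrow> 'a topology \<Rightarrow> bool" where
  "just_infinite G T \<longleftrightarrow> profinite_group G T \<and> infinite (carrier G) \<and>
     (\<forall>N. N \<lhd> G \<and> closedin T N \<and> N \<noteq> {\<one>\<^bsub>G\<^esub>} \<longrightarrow> openin T N)"

definition topologically_isomorphic ::
    "('a, 'm) monoid_scheme \<Rightarrow> 'a topology \<Rightarrow> ('b, 'n) monoid_scheme \<Rightarrow> 'b topology \<Rightarrow> bool" where
  "topologically_isomorphic G T G' T' \<longleftrightarrow> (\<exists>f \<in> iso G G'. homeomorphic_map T T' f)"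


section \<open>The additive group of p-adic integers\<close>

text \<open>The inverse limit of the groups \<open>\<int>/p^n\<close> along the reduction maps, realised as the subgroup
  of compatible sequences in their product. It carries the subspace topology of the product of
  the discrete topologies.\<close>

definition padic_int_group :: "nat \<Rightarrow> (nat \<Rightarrow> int) monoid" where
  "padic_int_group p =
     (let P = product_group UNIV (\<lambda>n. integer_mod_group (p ^ n))
      in P\<lparr>carrier := {x \<in> carrier P. \<forall>n. x (Suc n) mod int (p ^ n) = x n}\<rparr>)"

definition padic_int_topology :: "nat \<Rightarrow> (nat \<Rightarrow> int) topology" where
  "padic_int_topology p =
     subtopology
       (product_topology (\<lambda>n. discrete_topology (carrier (integer_mod_group (p ^ n)))) UNIV)
       (carrier (padic_int_group p))"


section \<open>Isolated points\<close>

definition isolated_points :: "'a topology \<Rightarrow> 'a set" where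
  "isolated_points X = {x \<in> topspace X. openin X {x}}"

definition perfect_topology :: "'a topology \<Rightarrow> bool" where
  "perfect_topology X \<longleftrightarrow> isolated_points X = {}"

definition without_isolated_points :: "'a topology \<Rightarrow> 'a topology" where
  "without_isolated_points X = subtopology X (topspace X - isolated_points X)"


section \<open>The space of closed subgroups\<close>

definition closed_subgroups :: "('a, 'm) monoid_scheme \<Rightarrow> 'a topology \<Rightarrow> 'a set set" where
  "closed_subgroups G T = {K. subgroup K G \<and> closedin T K}"

definition subgroup_nbhd ::
    "('a, 'm) monoid_scheme \<Rightarrow> 'a topology \<Rightarrow> 'a set \<Rightarrow> 'a set \<Rightarrow> 'a set set" where
  "subgroup_nbhd G T H N = {K \<in> closed_subgroups G T. K <#>\<^bsub>G\<^esub> N = H <#>\<^bsub>G\<^esub> N}"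

text \<open>A priori the generating family is only a subbase; that the sets \<open>subgroup_nbhd G T H N\<close>
  form a base of neighbourhoods of \<open>H\<close> is shown in \<open>openin_subgroup_space_iff\<close> below.\<close>

definition subgroup_space :: "('a, 'm) monoid_scheme \<Rightarrow> 'a topology \<Rightarrow> 'a set topology" where
  "subgroup_space G T =
     topology_generated_by
       {subgroup_nbhd G T H N | H N. H \<in> closed_subgroups G T \<and> N \<lhd> G \<and> openin T N}"

definition solitary :: "('a, 'm) monoid_scheme \<Rightarrow> 'a topology \<Rightarrow> 'a set \<Rightarrow> bool" where
  "solitary G T H \<longleftrightarrow> \<not> perfect_topology (subgroup_space G T) \<and>
     H \<in> isolated_points (without_isolated_points (subgroup_space G T))"

context topological_group
begin

lemma subgroup_nbhd_mono:
  assumes N: "N \<lhd> G" and M: "M \<lhd> G" and "N \<subseteq> M" and H: "H \<in> closed_subgroups G T"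
  shows "subgroup_nbhd G T H N \<subseteq> subgroup_nbhd G T H M"
proof -
  have sN: "subgroup N G" and sM: "subgroup M G"
    using N M by (auto dest: normal_imp_subgroup)
  have "N <#> M \<subseteq> M"
    using \<open>N \<subseteq> M\<close> sM by (auto simp: set_mult_def subgroup.m_closed)
  moreover have "M \<subseteq> N <#> M"
  proof
    fix x assume "x \<in> M"
    then have "x = \<one> \<otimes> x" "x \<in> carrier G"
      using sM by (auto dest: subgroup.mem_carrier)
    then show "x \<in> N <#> M"
      using \<open>x \<in> M\<close> subgroup.one_closed[OF sN] unfolding set_mult_def by blast
  qed
  ultimately have NM: "N <#> M = M" by blast
  have "L <#> M = (L <#> N) <#> M" if "L \<in> closed_subgroups G T" for L
    using that sN sM set_mult_assoc[of L N M]
    by (simp add: NM closed_subgroups_def subgroup.subset)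
  then show ?thesis
    using H by (auto simp: subgroup_nbhd_def)
qed

lemma openin_subgroup_space_iff:
  "openin (subgroup_space G T) U \<longleftrightarrow>
     U \<subseteq> closed_subgroups G T \<and>
     (\<forall>H \<in> U. \<exists>N. N \<lhd> G \<and> openin T N \<and> subgroup_nbhd G T H N \<subseteq> U)"
    (is "?L \<longleftrightarrow> ?R U")
proof
  let ?B = "{subgroup_nbhd G T H N | H N. H \<in> closed_subgroups G T \<and> N \<lhd> G \<and> openin T N}"
  assume ?L
  then have "generate_topology_on ?B U"
    by (simp add: subgroup_space_def openin_topology_generated_by)
  then show "?R U"
  proof induction
    case Empty
    show ?case by simp
  next
    case (Int U V)
    note U = conjunct1[OF Int.IH(1)] bspec[OF conjunct2[OF Int.IH(1)]]
    note V = conjunct1[OF Int.IH(2)] bspec[OF conjunct2[OF Int.IH(2)]]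
    have "\<exists>N. N \<lhd> G \<and> openin T N \<and> subgroup_nbhd G T H N \<subseteq> U \<inter> V" if "H \<in> U \<inter> V" for H
    proof -
      from that have "H \<in> U" "H \<in> V" by auto
      obtain N where N: "N \<lhd> G" "openin T N" "subgroup_nbhd G T H N \<subseteq> U"
        using U(2)[OF \<open>H \<in> U\<close>] by (elim exE conjE)
      obtain M where M: "M \<lhd> G" "openin T M" "subgroup_nbhd G T H M \<subseteq> V"
        using V(2)[OF \<open>H \<in> V\<close>] by (elim exE conjE)
      have H: "H \<in> closed_subgroups G T"
        using U(1) \<open>H \<in> U\<close> by (rule subsetD)
      have "N \<inter> M \<lhd> G"
        using N(1) M(1) by (rule normal_subgroup_intersect)
      moreover have "openin T (N \<inter> M)"
        using N(2) M(2) by (rule openin_Int)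
      moreover have "subgroup_nbhd G T H (N \<inter> M) \<subseteq> U \<inter> V"
        using subgroup_nbhd_mono[OF calculation(1) N(1) Int_lower1 H] N(3)
          subgroup_nbhd_mono[OF calculation(1) M(1) Int_lower2 H] M(3)
        by (meson Int_greatest order_trans)
      ultimately show ?thesis by (intro exI conjI)
    qed
    with U(1) show ?case by (simp add: le_infI1)
  next
    case (UN K)
    show ?case
    proof (intro conjI ballI)
      show "\<Union> K \<subseteq> closed_subgroups G T"
        using conjunct1[OF UN.IH] by (rule Sup_least)
      fix H assume "H \<in> \<Union> K"
      then obtain k where "k \<in> K" "H \<in> k" by blast
      then obtain N where "N \<lhd> G" "openin T N" "subgroup_nbhd G T H N \<subseteq> k"
        using bspec[OF conjunct2[OF UN.IH[OF \<open>k \<in> K\<close>]] \<open>H \<in> k\<close>] by (elim exE conjE)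
      then show "\<exists>N. N \<lhd> G \<and> openin T N \<and> subgroup_nbhd G T H N \<subseteq> \<Union> K"
        using Union_upper[OF \<open>k \<in> K\<close>] by (meson order_trans)
    qed
  next
    case (Basis B)
    then obtain H N where B: "B = subgroup_nbhd G T H N" and N: "N \<lhd> G" "openin T N"
      by blast
    have "subgroup_nbhd G T L N = B" if "L \<in> B" for L
      using that by (simp add: B subgroup_nbhd_def)
    moreover have "B \<subseteq> closed_subgroups G T"
      by (simp add: B subgroup_nbhd_def)
    ultimately show ?case using N by (auto intro!: exI[of _ N])
  qed
next
  assume R: "?R U"
  show ?L
  proof (subst openin_subopen, intro ballI)
    fix H assume "H \<in> U"
    then obtain N where N: "N \<lhd> G" "openin T N" "subgroup_nbhd G T H N \<subseteq> U"
      using R by meson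
    have H: "H \<in> closed_subgroups G T"
      using R \<open>H \<in> U\<close> by (meson subsetD)
    have "openin (subgroup_space G T) (subgroup_nbhd G T H N)"
      unfolding subgroup_space_def by (rule topology_generated_by_Basis) (use N H in blast)
    then show "\<exists>V. openin (subgroup_space G T) V \<and> H \<in> V \<and> V \<subseteq> U"
      using N(3) H by (intro exI[of _ "subgroup_nbhd G T H N"]) (auto simp: subgroup_nbhd_def)
  qed
qed

lemma topspace_subgroup_space: "topspace (subgroup_space G T) = closed_subgroups G T"
proof -
  have "carrier G \<lhd> G"
    by (simp add: normal_self)
  moreover have "openin T (carrier G)"
    using topspace_eq_carrier by (metis openin_topspace)
  ultimately have "openin (subgroup_space G T) (closed_subgroups G T)"
    by (auto simp: openin_subgroup_space_iff subgroup_nbhd_def)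
  then show ?thesis
    by (metis openin_subgroup_space_iff openin_subset openin_topspace subset_antisym)
qed

end

end

theory Submission
  imports
    Defs
    "HOL-Algebra.Sylow"
    "HOL-Algebra.Group_Action"
    "HOL-Algebra.Zassenhaus"
    "HOL-Algebra.Multiplicative_Group"
begin

text \<open>
  Every open subgroup \<open>L\<close> of \<open>G = H \<times> Z\<close> has an open Frattini subgroup and is therefore isolated in
  the space of closed subgroups, so a solitary subgroup is a subgroup \<open>K\<close> of infinite index that is
  isolated among the subgroups of infinite index. Such a \<open>K\<close> is determined by some open normal \<open>N\<close>
  and the open subgroup \<open>KN\<close>, and \<open>G\<close> has only countably many open subgroups since an infinite set of
  open normal subgroups of the just-infinite group \<open>H\<close> has trivial intersection.

  For infinitely many examples take \<open>V \<times> 1\<close> with \<open>V\<close> open in \<open>H\<close> and \<open>[V, V]\<close> of finite index: a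
  subgroup \<open>L\<close> of infinite index close to \<open>V \<times> 1\<close> projects onto \<open>V\<close> by the Frattini argument and is the
  graph of a homomorphism from \<open>V\<close> to \<open>Z\<close>, which vanishes because \<open>V\<close> has finite abelianisation and
  \<open>Z\<close> is torsion-free. If no open normal subgroup of \<open>H\<close> is abelian, every open normal subgroup serves
  as \<open>V\<close>. Otherwise let \<open>A\<close> be open, normal and abelian, and let \<open>t\<close> be central modulo the centraliser
  of \<open>A\<close> without centralising \<open>A\<close>. Then \<open>t\<close> acts on \<open>A\<close> without non-trivial fixed points, hence has
  finite order, and the groups \<open>\<langle>t\<rangle>B\<close> with \<open>B \<le> A\<close> open and normal in \<open>H\<close> serve as \<open>V\<close>.
\<close>

section \<open>Finite groups of prime power order\<close>

text \<open>If \<open>V\<close> has a non-trivial homomorphism f to \<open>Z\<close>, then the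
  graphs of the multiples p^n f are subgroups of infinite index converging to
  \<open>V \<times> 1\<close>, which is then not solitary. Control of the homomorphisms to
  \<open>Z\<close> is therefore forced. It explains why \<open>H\<close> must not be abelian and
  why, in the virtually abelian case, open subgroups of \<open>A\<close> itself cannot serve as
  \<open>V\<close>: they need the twist by \<open>t\<close>.

  The recurring tool is that an open normal abelian subgroup of \<open>H\<close> is torsion-free. It
  prevents the p-th powers and commutators of an open normal \<open>U\<close> from all being
  trivial, which is what makes Frattini subgroups open. It also carries statements that hold for
  some power of each element of \<open>A\<close>, such as being fixed by \<open>t\<close>, over to
  the element itself.\<close>

lemma (in group_action) exists_other_fixed_point:
  assumes "prime p" "order G = p ^ k" "finite E" "p dvd card E"
    and x: "x \<in> E" and fixed: "\<And>g. g \<in> carrier G \<Longrightarrow> \<phi> g x = x"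
  shows "\<exists>y\<in>E. y \<noteq> x \<and> (\<forall>g\<in>carrier G. \<phi> g y = y)"
proof (rule ccontr)
  assume no: "\<not> ?thesis"
  interpret group G using group_hom group_hom.axioms(1) by blast
  have Ex: "orbit G \<phi> x = {x}"
    using fixed by (force simp: orbit_def)
  have fin: "finite (orbits G E \<phi>)"
    using \<open>finite E\<close> orbits_coverture by (metis finite_UnionD)
  have sub: "orbit G \<phi> y \<subseteq> E" if "y \<in> E" for y
    using that orbits_coverture unfolding orbits_def by blast
  have dvd: "p dvd card orb" if "orb \<in> orbits G E \<phi>" "orb \<noteq> {x}" for orb
  proof -
    obtain y where y: "y \<in> E" "orb = orbit G \<phi> y"
      using \<open>orb \<in> orbits G E \<phi>\<close> by (auto simp: orbits_def)
    have "y \<noteq> x" using y Ex \<open>orb \<noteq> {x}\<close> by auto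
    then obtain g where g: "g \<in> carrier G" "\<phi> g y \<noteq> y"
      using no y by blast
    then have "{y, \<phi> g y} \<subseteq> orb"
      using y orbit_refl by (auto simp: orbit_def)
    moreover have "finite orb"
      using y sub \<open>finite E\<close> finite_subset by blast
    ultimately have "card orb \<noteq> 1"
      using g by (metis card_1_singletonE insert_subset singletonD)
    moreover have "card orb dvd p ^ k"
      using orbit_stabilizer_theorem[OF y(1)] y(2) assms(2) by (metis dvd_triv_left)
    ultimately show ?thesis
      using \<open>prime p\<close> by (metis divides_primepow_nat dvd_power gr0I power_0)
  qed
  \<comment> \<open>Class equation: \<open>{x}\<close> contributes 1 and, in the absence of a second
    fixed point, every other orbit has size divisible by \<open>p\<close>, so \<open>card E\<close>
    would be 1 modulo \<open>p\<close>.\<close>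
  have "card E = (\<Sum>orb\<in>orbits G E \<phi>. card orb)"
    using disjoint_sum[OF \<open>finite E\<close>, of "\<lambda>_. 1::nat"] by simp
  also have "\<dots> = 1 + (\<Sum>orb\<in>orbits G E \<phi> - {{x}}. card orb)"
  proof -
    have "{x} \<in> orbits G E \<phi>"
      using Ex x by (auto simp: orbits_def)
    then show ?thesis
      using fin by (simp add: sum.remove)
  qed
  finally have "p dvd 1 + (\<Sum>orb\<in>orbits G E \<phi> - {{x}}. card orb)"
    using \<open>p dvd card E\<close> by simp
  moreover have "p dvd (\<Sum>orb\<in>orbits G E \<phi> - {{x}}. card orb)"
    by (rule dvd_sum) (use dvd in auto)
  ultimately show False
    using \<open>prime p\<close> by (metis dvd_add_left_iff not_prime_unit)
qed

text \<open>Conjugation fixes \<open>\<one>\<close> and acts on a set of size divisible by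
  \<open>p\<close>, so it has a second fixed point; fixed points of conjugation are central.\<close>

lemma (in group) p_group_center_nontrivial:
  assumes "prime p" "order G = p ^ k" "carrier G \<noteq> {\<one>}"
  shows "\<exists>z\<in>carrier G. z \<noteq> \<one> \<and> (\<forall>x\<in>carrier G. x \<otimes> z = z \<otimes> x)"
proof -
  let ?c = "\<lambda>g. \<lambda>h\<in>carrier G. g \<otimes> h \<otimes> inv g"
  interpret group_action G "carrier G" ?c
    using action_by_conjugation by simp
  have "finite (carrier G)"
    using assms by (metis order_gt_0_iff_finite prime_gt_0_nat zero_less_power)
  moreover have "k \<noteq> 0"
    using assms(2,3) order_one_triv_iff by (metis power_0)
  ultimately obtain z where "z \<in> carrier G" "z \<noteq> \<one>" and z: "\<And>g. g \<in> carrier G \<Longrightarrow> ?c g z = z"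
    using exists_other_fixed_point[of p k "\<one>"] assms(1,2) by (auto simp: order_def)
  moreover have "x \<otimes> z = z \<otimes> x" if "x \<in> carrier G" for x
    using z[OF that] that \<open>z \<in> carrier G\<close> by (simp add: inv_solve_right')
  ultimately show ?thesis by blast
qed

text \<open>\<open>M\<close> acts on its right cosets, whose number is divisible by
  \<open>p\<close>, and fixes the coset \<open>M\<close>. A second fixed coset \<open>M #> g\<close>
  means that \<open>g\<close> conjugates \<open>M\<close> into itself.\<close>

lemma (in group) p_group_normalizer_grows:
  assumes "prime p" "order G = p ^ k" and M: "subgroup M G" and "M \<noteq> carrier G"
  shows "\<exists>g\<in>carrier G. g \<notin> M \<and> (\<forall>m\<in>M. g \<otimes> m \<otimes> inv g \<in> M)"
proof -
  let ?H = "G\<lparr>carrier := M\<rparr>"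
  \<comment> \<open>The inverse turns right translation into a left action; the restricted lambda
    makes the maps elements of \<open>BijGroup\<close>.\<close>
  let ?a = "\<lambda>m. \<lambda>X\<in>rcosets M. X #> inv m"
  interpret M: group ?H using M by (rule subgroup_imp_group)
  have MG: "M \<subseteq> carrier G" using M by (rule subgroup.subset)
  have Xsub: "X \<subseteq> carrier G" if "X \<in> rcosets M" for X
    using M subgroup.rcosets_carrier that by blast
  have cl: "X #> g \<in> rcosets M" if X: "X \<in> rcosets M" and g: "g \<in> carrier G" for X g
  proof -
    obtain h where h: "h \<in> carrier G" "X = M #> h" using X by (auto simp: RCOSETS_def)
    then have "X #> g = M #> (h \<otimes> g)" using g MG by (simp add: coset_mult_assoc)
    then show ?thesis using h g MG by (simp add: rcosetsI)
  qed
  have comp: "?a m (?a n X) = ?a (m \<otimes> n) X" if "m \<in> M" "n \<in> M" "X \<in> rcosets M" for m n X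
    using that MG cl[of X "inv n"] Xsub[of X]
    by (auto simp: coset_mult_assoc inv_mult_group subset_iff)
  have bij: "?a m \<in> carrier (BijGroup (rcosets M))" if m: "m \<in> M" for m
  proof -
    have "m \<in> carrier G" "inv m \<in> M" using m MG M by (auto simp: subgroup.m_inv_closed)
    have *: "?a m (?a (inv m) X) = X" "?a (inv m) (?a m X) = X" if "X \<in> rcosets M" for X
      using comp[of m "inv m" X] comp[of "inv m" m X] that m \<open>inv m \<in> M\<close> \<open>m \<in> carrier G\<close> Xsub[of X]
      by simp_all
    have "bij_betw (?a m) (rcosets M) (rcosets M)"
      by (rule bij_betw_byWitness[where f' = "?a (inv m)"])
        (use * cl \<open>m \<in> carrier G\<close> in auto)
    then show ?thesis by (simp add: BijGroup_def Bij_def)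
  qed
  have "group_hom ?H (BijGroup (rcosets M)) ?a"
  proof (intro group_hom.intro group_hom_axioms.intro homI)
    show "group ?H" by (rule M.is_group)
    show "group (BijGroup (rcosets M))" by (rule group_BijGroup)
    show "?a m \<in> carrier (BijGroup (rcosets M))" if "m \<in> carrier ?H" for m
      using bij that by simp
    show "?a (m \<otimes>\<^bsub>?H\<^esub> n) = ?a m \<otimes>\<^bsub>BijGroup (rcosets M)\<^esub> ?a n"
      if "m \<in> carrier ?H" "n \<in> carrier ?H" for m n
    proof -
      have mn: "m \<in> M" "n \<in> M" using that by simp_all
      have "?a (m \<otimes> n) = compose (rcosets M) (?a m) (?a n)"
      proof
        fix X
        show "?a (m \<otimes> n) X = compose (rcosets M) (?a m) (?a n) X"
        proof (cases "X \<in> rcosets M")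
          case True
          then show ?thesis by (simp only: compose_eq comp[OF mn True])
        qed (simp add: compose_def)
      qed
      then show ?thesis
        using bij[OF mn(1)] bij[OF mn(2)] by (simp add: BijGroup_def)
    qed
  qed
  then interpret group_action ?H "rcosets M" ?a by (rule group_action.intro)
  have fin: "finite (carrier G)"
    using assms by (metis order_gt_0_iff_finite prime_gt_0_nat zero_less_power)
  have lag: "card (rcosets M) * card M = p ^ k"
    using lagrange[OF M] assms(2) by simp
  then obtain j where j: "card M = p ^ j"
    using \<open>prime p\<close> by (metis divides_primepow_nat dvd_triv_right)
  obtain i where i: "card (rcosets M) = p ^ i"
    using \<open>prime p\<close> lag by (metis divides_primepow_nat dvd_triv_left)
  have "i \<noteq> 0"
  proof
    assume "i = 0"
    then have "card M = card (carrier G)" using i lag assms(2) by (simp add: order_def)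
    then show False using \<open>M \<noteq> carrier G\<close> MG fin by (metis card_subset_eq)
  qed
  have MM: "M \<in> rcosets M" using M subgroup.subgroup_in_rcosets is_group by blast
  have "\<exists>Y\<in>rcosets M. Y \<noteq> M \<and> (\<forall>m\<in>carrier ?H. ?a m Y = Y)"
  proof (rule exists_other_fixed_point[OF \<open>prime p\<close>, of j])
    show "order ?H = p ^ j" using j by (simp add: order_def)
    show "finite (rcosets M)" using fin by (auto simp: RCOSETS_def)
    show "p dvd card (rcosets M)" using i \<open>i \<noteq> 0\<close> by simp
    show "?a m M = M" if "m \<in> carrier ?H" for m
      using that MM M by (auto simp: subgroup.m_inv_closed subgroup.rcos_const)
  qed (rule MM)
  then obtain Y where Y: "Y \<in> rcosets M" "Y \<noteq> M" and fixed: "\<And>m. m \<in> M \<Longrightarrow> Y #> inv m = Y"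
    by auto
  obtain g where g: "g \<in> carrier G" "Y = M #> g" using Y by (auto simp: RCOSETS_def)
  have "g \<notin> M" using Y g M by (auto simp: subgroup.rcos_const)
  moreover have "g \<otimes> m \<otimes> inv g \<in> M" if m: "m \<in> M" for m
  proof -
    have "m \<in> carrier G" "inv m \<in> M" using m MG M by (auto simp: subgroup.m_inv_closed)
    have "M #> (g \<otimes> m) = M #> g"
      using fixed[OF \<open>inv m \<in> M\<close>] g MG \<open>m \<in> carrier G\<close> by (simp add: coset_mult_assoc)
    then have "M #> (g \<otimes> m \<otimes> inv g) = M"
      using g MG \<open>m \<in> carrier G\<close> by (simp flip: coset_mult_assoc) (simp add: coset_mult_assoc)
    then show ?thesis
      using coset_join1[OF _ _ M] g \<open>m \<in> carrier G\<close> MG by simp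
  qed
  ultimately show ?thesis using g by blast
qed

lemma (in group_hom) subgroup_preimage:
  assumes "subgroup K H"
  shows "subgroup {x \<in> carrier G. h x \<in> K} G"
proof (rule G.subgroupI)
  have "\<one> \<in> {x \<in> carrier G. h x \<in> K}"
    using assms by (simp add: subgroup.one_closed)
  then show "{x \<in> carrier G. h x \<in> K} \<noteq> {}" by blast
qed (use assms in \<open>auto simp: subgroup.m_closed subgroup.m_inv_closed\<close>)

lemma (in group) subgroup_centralizer:
  assumes S: "S \<subseteq> carrier G"
  shows "subgroup {x \<in> carrier G. \<forall>y\<in>S. x \<otimes> y = y \<otimes> x} G"
proof (rule subgroupI)
  fix a assume a: "a \<in> {x \<in> carrier G. \<forall>y\<in>S. x \<otimes> y = y \<otimes> x}"
  have "inv a \<otimes> y = y \<otimes> inv a" if "y \<in> S" for y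
  proof -
    have y: "y \<in> carrier G" "a \<in> carrier G" "y \<otimes> a = a \<otimes> y" using a that S by auto
    then have "inv a \<otimes> y \<otimes> a = y"
      by (simp add: m_assoc) (simp flip: m_assoc)
    then show ?thesis using y by (simp add: inv_solve_right)
  qed
  then show "inv a \<in> {x \<in> carrier G. \<forall>y\<in>S. x \<otimes> y = y \<otimes> x}" using a by simp
next
  fix a b assume ab: "a \<in> {x \<in> carrier G. \<forall>y\<in>S. x \<otimes> y = y \<otimes> x}" "b \<in> {x \<in> carrier G. \<forall>y\<in>S. x \<otimes> y = y \<otimes> x}"
  have "a \<otimes> b \<otimes> y = y \<otimes> (a \<otimes> b)" if "y \<in> S" for y
  proof -
    have y: "y \<in> carrier G" "a \<otimes> y = y \<otimes> a" "b \<otimes> y = y \<otimes> b" using ab that S by auto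
    then show ?thesis using ab by (metis (no_types, lifting) m_assoc mem_Collect_eq)
  qed
  then show "a \<otimes> b \<in> {x \<in> carrier G. \<forall>y\<in>S. x \<otimes> y = y \<otimes> x}" using ab by simp
qed (use S in \<open>auto intro!: exI[of _ \<one>]\<close>)

lemma (in normal) rcos_eq_self_iff: "x \<in> carrier G \<Longrightarrow> H #> x = H \<longleftrightarrow> x \<in> H"
  by (meson coset_join1 coset_join2 subgroup_axioms subset)

text \<open>\<open>M'\<close> is a maximal proper subgroup above \<open>M\<close>. Since normalisers
  grow, it is normal, and by maximality its quotient is elementary abelian. Only the two
  consequences for powers and commutators are recorded, in a form that pulls back from finite
  quotients.\<close>

lemma (in group) p_group_maximal_subgroup:
  assumes "prime p" "order G = p ^ k" and "subgroup M G" "M \<noteq> carrier G"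
  obtains M' where "subgroup M' G" "M \<subseteq> M'" "M' \<noteq> carrier G"
    "\<And>x. x \<in> carrier G \<Longrightarrow> x [^] p \<in> M'"
    "\<And>x y. x \<in> carrier G \<Longrightarrow> y \<in> carrier G \<Longrightarrow> x \<otimes> y \<otimes> inv x \<otimes> inv y \<in> M'"
proof -
  have fin: "finite (carrier G)"
    using assms by (metis order_gt_0_iff_finite prime_gt_0_nat zero_less_power)
  let ?S = "{K. subgroup K G \<and> M \<subseteq> K \<and> K \<noteq> carrier G}"
  have "?S \<subseteq> Pow (carrier G)" by (auto dest: subgroup.subset)
  then have "finite ?S" using fin by (metis finite_Pow_iff finite_subset)
  moreover have "M \<in> ?S" using assms by simp
  ultimately obtain M' where M': "M' \<in> ?S" and max: "\<And>K. K \<in> ?S \<Longrightarrow> M' \<subseteq> K \<Longrightarrow> K = M'"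
    using finite_has_maximal[of ?S] by (metis (no_types, lifting) empty_iff)
  have sM': "subgroup M' G" and "M \<subseteq> M'" "M' \<noteq> carrier G" using M' by auto
  have M'G: "M' \<subseteq> carrier G" using sM' by (rule subgroup.subset)
  have maximal: "K = carrier G" if "subgroup K G" "M' \<subseteq> K" "g \<in> K" "g \<notin> M'" for K g
    using max[of K] that \<open>M \<subseteq> M'\<close> by auto
  have finM: "finite M'" using M'G fin finite_subset by blast
  obtain g where g: "g \<in> carrier G" "g \<notin> M'" and gM: "\<And>m. m \<in> M' \<Longrightarrow> g \<otimes> m \<otimes> inv g \<in> M'"
    using p_group_normalizer_grows[OF assms(1,2) sM' \<open>M' \<noteq> carrier G\<close>] by blast
  have conj: "x <# M' #> inv x = (\<lambda>m. x \<otimes> m \<otimes> inv x) ` M'" for x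
    by (auto simp: l_coset_def r_coset_def)
  have "inj_on (\<lambda>m. g \<otimes> m \<otimes> inv g) M'"
    using M'G g by (auto simp: inj_on_def subset_iff)
  then have "(\<lambda>m. g \<otimes> m \<otimes> inv g) ` M' = M'"
    using gM by (intro endo_inj_surj finM) auto
  then have "g \<in> normalizer G M'"
    using g M'G conj[of g] by (simp add: normalizer_def stabilizer_def)
  moreover have "M' \<subseteq> normalizer G M'"
    using subgroup_in_normalizer[OF sM'] normal_imp_subgroup subgroup.subset by fastforce
  ultimately have norm: "normalizer G M' = carrier G"
    using maximal normalizer_imp_subgroup[OF M'G] g by blast
  have nM': "M' \<lhd> G"
  proof (rule normal_invI[OF sM'])
    fix x m assume x: "x \<in> carrier G" and m: "m \<in> M'"
    then have "x \<in> normalizer G M'" using norm by simp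
    then have "(\<lambda>m. x \<otimes> m \<otimes> inv x) ` M' = M'"
      using M'G conj[of x] by (simp add: normalizer_def stabilizer_def)
    then show "x \<otimes> m \<otimes> inv x \<in> M'" using m by blast
  qed
  interpret N: normal M' G by (rule nM')
  let ?Q = "G Mod M'" and ?q = "\<lambda>x. M' #> x"
  interpret Q: group ?Q by (rule N.factorgroup_is_group)
  interpret q: group_hom G ?Q ?q
    by (intro group_hom.intro group_hom_axioms.intro N.r_coset_hom_Mod Q.is_group is_group)
  have q_one: "?q x = \<one>\<^bsub>?Q\<^esub> \<longleftrightarrow> x \<in> M'" if "x \<in> carrier G" for x
    using N.rcos_eq_self_iff[OF that] by simp
  have comm: "?q x \<otimes>\<^bsub>?Q\<^esub> ?q y = ?q y \<otimes>\<^bsub>?Q\<^esub> ?q x" if x: "x \<in> carrier G" and y: "y \<in> carrier G" for x y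
  proof (cases "y \<in> M'")
    case True
    then have "?q y = \<one>\<^bsub>?Q\<^esub>" using q_one y by simp
    then show ?thesis using x by (simp del: one_FactGroup mult_FactGroup)
  next
    case False
    \<comment> \<open>The elements commuting with \<open>y\<close> modulo \<open>M'\<close> form a
      subgroup containing both \<open>M'\<close> and \<open>y\<close>, so by maximality it is
      everything.\<close>
    let ?C = "{x \<in> carrier G. ?q x \<in> {u \<in> carrier ?Q. \<forall>v\<in>{?q y}. u \<otimes>\<^bsub>?Q\<^esub> v = v \<otimes>\<^bsub>?Q\<^esub> u}}"
    have "subgroup ?C G"
      by (rule q.subgroup_preimage[OF Q.subgroup_centralizer]) (use q.hom_closed[OF y] in blast)
    moreover have "M' \<subseteq> ?C"
    proof
      fix m assume m: "m \<in> M'"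
      then have "m \<in> carrier G" "?q m = \<one>\<^bsub>?Q\<^esub>" using M'G q_one by blast+
      then show "m \<in> ?C" using y by (simp del: one_FactGroup mult_FactGroup)
    qed
    moreover have "y \<in> ?C" using y q.hom_closed[OF y] by blast
    ultimately have "?C = carrier G" using maximal False by blast
    then show ?thesis using x by blast
  qed
  interpret Q: comm_group ?Q
    by (rule Q.group_comm_groupI) (use comm in \<open>auto simp: carrier_FactGroup simp del: mult_FactGroup\<close>)
  have "x \<otimes> y \<otimes> inv x \<otimes> inv y \<in> M'" if x: "x \<in> carrier G" and y: "y \<in> carrier G" for x y
  proof -
    have "?q (x \<otimes> y \<otimes> inv x \<otimes> inv y) = ?q x \<otimes>\<^bsub>?Q\<^esub> ?q y \<otimes>\<^bsub>?Q\<^esub> inv\<^bsub>?Q\<^esub> ?q x \<otimes>\<^bsub>?Q\<^esub> inv\<^bsub>?Q\<^esub> ?q y"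
      using x y by (simp del: mult_FactGroup)
    also have "\<dots> = \<one>\<^bsub>?Q\<^esub>"
      using q.hom_closed[OF x] q.hom_closed[OF y] comm[OF x y]
      by (metis Q.inv_closed Q.m_assoc Q.r_inv Q.m_closed Q.r_one)
    finally show ?thesis using q_one[THEN iffD1] x y by (meson inv_closed m_closed)
  qed
  moreover have "x [^] p \<in> M'" if x: "x \<in> carrier G" for x
  proof (rule ccontr)
    assume "x [^] p \<notin> M'"
    \<comment> \<open>As the quotient is abelian, the elements whose p-th power lies in
      \<open>M'\<close> form a subgroup \<open>?P\<close>. If it is proper, it equals
      \<open>M'\<close>, and extracting p-th roots from \<open>x [^] (p ^ k) = \<one>\<close> leads
      down to \<open>x \<in> M'\<close>, a contradiction.\<close>
    let ?P = "{y \<in> carrier G. ?q y \<in> {u \<in> carrier ?Q. u [^]\<^bsub>?Q\<^esub> p = \<one>\<^bsub>?Q\<^esub>}}"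
    have "subgroup {u \<in> carrier ?Q. u [^]\<^bsub>?Q\<^esub> p = \<one>\<^bsub>?Q\<^esub>} ?Q"
      by (intro Q.subgroupI) (auto simp: Q.nat_pow_distrib Q.nat_pow_inv simp del: one_FactGroup mult_FactGroup)
    then have sP: "subgroup ?P G" by (rule q.subgroup_preimage)
    have MP: "M' \<subseteq> ?P"
    proof
      fix m assume m: "m \<in> M'"
      then have "m \<in> carrier G" "?q m = \<one>\<^bsub>?Q\<^esub>" using M'G q_one by blast+
      then show "m \<in> ?P" by (simp del: one_FactGroup mult_FactGroup)
    qed
    have P_iff: "y \<in> ?P \<longleftrightarrow> y [^] p \<in> M'" if "y \<in> carrier G" for y
      using that q_one[of "y [^] p"] q.hom_nat_pow[OF that, of p] q.hom_closed[OF that] by simp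
    have "?P \<noteq> carrier G" using P_iff[OF x] \<open>x [^] p \<notin> M'\<close> x by metis
    then have P: "y \<in> M'" if "y [^] p \<in> M'" "y \<in> carrier G" for y
      using maximal[OF sP MP, of y] that P_iff[of y] by metis
    have "x [^] (p ^ i) \<in> M' \<Longrightarrow> x \<in> M'" for i
    proof (induction i)
      case (Suc i)
      have "(x [^] (p ^ i)) [^] p \<in> M'" using Suc.prems x by (simp add: nat_pow_pow mult.commute)
      then show ?case using P[OF _ nat_pow_closed[OF x]] Suc.IH by blast
    qed (use x in simp)
    moreover have "x [^] (p ^ k) = \<one>" using pow_order_eq_1[OF x] assms(2) by simp
    ultimately have "x \<in> M'" using N.one_closed by metis
    then have "x \<in> ?P" using MP by blast
    then show False using P_iff[OF x] \<open>x [^] p \<notin> M'\<close> by metis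
  qed
  ultimately show thesis
    using that[OF sM' \<open>M \<subseteq> M'\<close> \<open>M' \<noteq> carrier G\<close>] by blast
qed

text \<open>By Cauchy's theorem a prime \<open>q\<close> dividing the order yields an element of
  order \<open>q\<close>, and this order has to divide a power of \<open>p\<close>. The pro-p
  property is thereby reduced to a condition on single elements, which is easy to check in a
  product.\<close>

lemma (in group) order_eq_prime_power:
  assumes "prime p" "finite (carrier G)"
    and pow: "\<And>x. x \<in> carrier G \<Longrightarrow> \<exists>i. x [^] (p ^ i) = \<one>"
  shows "\<exists>k. order G = p ^ k"
proof -
  have "q = p" if q: "prime q" "q dvd order G" for q
  proof -
    obtain m where "order G = q ^ 1 * m" using q by auto
    then obtain S where S: "subgroup S G" "card S = q"
      using sylow_thm[OF q(1) is_group _ assms(2)] by fastforce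
    then have "\<not> S \<subseteq> {\<one>}"
      using card_mono[of "{\<one>}" S] prime_gt_1_nat[OF q(1)] by auto
    then obtain x where x: "x \<in> S" "x \<noteq> \<one>" by blast
    then have xG: "x \<in> carrier G" using S subgroup.mem_carrier by metis
    interpret S: group "G\<lparr>carrier := S\<rparr>" using S subgroup_imp_group by blast
    have "x [^] q = \<one>"
      using S.pow_order_eq_1[of x] x S by (simp add: order_def flip: nat_pow_consistent)
    moreover obtain i where "x [^] (p ^ i) = \<one>" using pow[OF xG] by blast
    ultimately have "ord x dvd q" "ord x dvd p ^ i" using xG pow_eq_id by auto
    moreover have "ord x \<noteq> 1" using x xG ord_eq_1 by simp
    ultimately have "q dvd p ^ i" using q by (metis prime_nat_iff)
    then show ?thesis using q \<open>prime p\<close> by (metis prime_dvd_power primes_dvd_imp_eq)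
  qed
  moreover have "order G \<noteq> 0"
    using assms(2) order_gt_0_iff_finite by simp
  moreover have "\<not> is_unit p" using \<open>prime p\<close> by auto
  ultimately obtain r where r: "order G = p ^ multiplicity p (order G) * r" "\<not> p dvd r"
    and qr: "\<And>q. prime q \<Longrightarrow> q dvd r \<Longrightarrow> q = p"
    by (metis multiplicity_decompose' dvd_triv_right dvd_trans)
  then have "r = 1" by (metis prime_factor_nat)
  then show ?thesis using r(1) by auto
qed

section \<open>Topological groups and their spaces of subgroups\<close>

lemma (in group) subset_set_mult1:
  assumes "K \<subseteq> carrier G" "subgroup N G"
  shows "K \<subseteq> K <#> N"
proof
  fix x assume x: "x \<in> K"
  then have "x = x \<otimes> \<one>" using assms(1) by auto
  then show "x \<in> K <#> N" using x subgroup.one_closed[OF assms(2)] unfolding set_mult_def by blast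
qed

lemma (in group) subset_set_mult2:
  assumes "subgroup K G" "N \<subseteq> carrier G"
  shows "N \<subseteq> K <#> N"
proof
  fix x assume x: "x \<in> N"
  then have "x = \<one> \<otimes> x" using assms(2) by auto
  then show "x \<in> K <#> N" using x subgroup.one_closed[OF assms(1)] unfolding set_mult_def by blast
qed

lemma (in group) subgroup_set_mult_normal:
  assumes "subgroup K G" "N \<lhd> G"
  shows "subgroup (K <#> N) G"
  using mult_norm_subgroup[OF assms(2,1)] commut_normal[OF assms] by simp

lemma (in group) set_mult_absorb:
  assumes "subgroup K G" "subgroup N G" "N \<subseteq> K"
  shows "K <#> N = K"
proof
  show "K <#> N \<subseteq> K" using assms by (auto simp: set_mult_def subgroup.m_closed)
qed (rule subset_set_mult1[OF subgroup.subset[OF assms(1)] assms(2)])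

text \<open>Compactness applied to \<open>U\<close> and the complements of the members of
  \<open>\<C>\<close>. Intersecting with \<open>topspace X\<close> gives the empty family its right
  meaning, since \<open>\<Inter>{}\<close> is the universe.\<close>

lemma compact_space_finite_Inter_subset:
  assumes "compact_space X" "openin X U" "\<And>C. C \<in> \<C> \<Longrightarrow> closedin X C" "topspace X \<inter> \<Inter>\<C> \<subseteq> U"
  obtains \<F> where "finite \<F>" "\<F> \<subseteq> \<C>" "topspace X \<inter> \<Inter>\<F> \<subseteq> U"
proof -
  let ?\<V> = "insert U ((\<lambda>C. topspace X - C) ` \<C>)"
  have "\<forall>V\<in>?\<V>. openin X V" using assms(2,3) by blast
  moreover have "topspace X \<subseteq> \<Union>?\<V>" using assms(4) by blast
  ultimately obtain \<G> where \<G>: "finite \<G>" "\<G> \<subseteq> ?\<V>" "topspace X \<subseteq> \<Union>\<G>"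
    using assms(1) unfolding compact_space_alt by meson
  then have "\<G> - {U} \<subseteq> (\<lambda>C. topspace X - C) ` \<C>" by blast
  then obtain \<F> where \<F>: "\<F> \<subseteq> \<C>" "finite \<F>" "\<G> - {U} = (\<lambda>C. topspace X - C) ` \<F>"
    using \<G>(1) by (meson finite_Diff finite_subset_image)
  have "topspace X \<inter> \<Inter>\<F> \<subseteq> U"
  proof
    fix x assume x: "x \<in> topspace X \<inter> \<Inter>\<F>"
    then obtain V where V: "V \<in> \<G>" "x \<in> V" using \<G>(3) by blast
    have "V = U"
    proof (rule ccontr)
      assume "V \<noteq> U"
      then have "V \<in> (\<lambda>C. topspace X - C) ` \<F>" using V \<F>(3) by blast
      then show False using V x by blast
    qed
    then show "x \<in> U" using V by simp
  qed
  with \<F> that show thesis by blast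
qed

context topological_group
begin

lemma continuous_map_mult_ops:
  assumes "continuous_map X T f" "continuous_map X T g"
  shows "continuous_map X T (\<lambda>x. f x \<otimes> g x)"
  using continuous_map_compose[OF continuous_map_pairedI[OF assms] continuous_mult] by (simp add: o_def)

lemma continuous_map_inv_op:
  assumes "continuous_map X T f"
  shows "continuous_map X T (\<lambda>x. inv (f x))"
  using continuous_map_compose[OF assms continuous_inv] by (simp add: o_def)

lemma continuous_map_const_op: "c \<in> carrier G \<Longrightarrow> continuous_map X T (\<lambda>x. c)"
  by (simp add: topspace_eq_carrier)

lemma continuous_map_pow_op:
  assumes "continuous_map X T f"
  shows "continuous_map X T (\<lambda>x. f x [^] (n::nat))"
  by (induction n) (auto intro: continuous_map_mult_ops assms simp: topspace_eq_carrier)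

lemma continuous_map_left_translation: "c \<in> carrier G \<Longrightarrow> continuous_map T T ((\<otimes>) c)"
  using continuous_map_mult_ops[OF continuous_map_const_op continuous_map_id[unfolded id_def]] by simp

lemmas continuous_map_ops = continuous_map_mult_ops continuous_map_inv_op continuous_map_const_op
  continuous_map_pow_op continuous_map_id[unfolded id_def]

lemma openin_preimage:
  assumes "continuous_map T X f" "openin X U"
  shows "openin T {x \<in> carrier G. f x \<in> U}"
  using openin_continuous_map_preimage[OF assms] by (simp add: topspace_eq_carrier)

lemma closedin_preimage:
  assumes "continuous_map T X f" "closedin X U"
  shows "closedin T {x \<in> carrier G. f x \<in> U}"
  using closedin_continuous_map_preimage[OF assms] by (simp add: topspace_eq_carrier)

lemma openin_carrier: "openin T (carrier G)" and closedin_carrier: "closedin T (carrier G)"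
  using openin_topspace[of T] closedin_topspace[of T] by (simp_all add: topspace_eq_carrier)

lemma openin_subgroup_if_nbhd:
  assumes S: "subgroup S G" and U: "openin T U" "\<one> \<in> U" "U \<subseteq> S"
  shows "openin T S"
proof (subst openin_subopen, intro ballI)
  fix s assume s: "s \<in> S"
  let ?V = "{x \<in> carrier G. inv s \<otimes> x \<in> U}"
  have sG: "s \<in> carrier G" using S s by (rule subgroup.mem_carrier)
  have "openin T ?V"
    using sG by (intro openin_preimage[OF _ U(1)] continuous_map_ops) auto
  moreover have "s \<in> ?V" using sG U by simp
  moreover have "?V \<subseteq> S"
  proof
    fix x assume x: "x \<in> ?V"
    then have "s \<otimes> (inv s \<otimes> x) \<in> S" using S s U by (auto intro: subgroup.m_closed)
    then show "x \<in> S" using x sG by (simp flip: m_assoc)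
  qed
  ultimately show "\<exists>V. openin T V \<and> s \<in> V \<and> V \<subseteq> S" by blast
qed

lemma openin_supergroup:
  assumes "subgroup S G" "subgroup U G" "openin T U" "U \<subseteq> S"
  shows "openin T S"
  using openin_subgroup_if_nbhd[OF assms(1,3)] assms(2,4) subgroup.one_closed by blast

lemma openin_rcoset:
  assumes S: "subgroup S G" "openin T S" and a: "a \<in> carrier G"
  shows "openin T (S #> a)"
proof -
  have "S #> a = {x \<in> carrier G. x \<otimes> inv a \<in> S}"
  proof
    show "S #> a \<subseteq> {x \<in> carrier G. x \<otimes> inv a \<in> S}"
      using a subgroup.mem_carrier[OF S(1)] by (auto simp: r_coset_def m_assoc)
    show "{x \<in> carrier G. x \<otimes> inv a \<in> S} \<subseteq> S #> a"
    proof
      fix x assume x: "x \<in> {x \<in> carrier G. x \<otimes> inv a \<in> S}"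
      then have "x = (x \<otimes> inv a) \<otimes> a" using a by (simp add: m_assoc)
      then show "x \<in> S #> a" using x unfolding r_coset_def by blast
    qed
  qed
  then show ?thesis
    using a by (auto intro!: openin_preimage[OF _ S(2)] continuous_map_ops)
qed

lemma closedin_open_subgroup:
  assumes S: "subgroup S G" "openin T S"
  shows "closedin T S"
proof -
  have "S \<in> rcosets S" using S(1) is_group by (metis subgroup.subgroup_in_rcosets)
  then have "S \<union> \<Union>(rcosets S - {S}) = carrier G"
    using rcosets_part_G[OF S(1)] by blast
  moreover have "S \<inter> \<Union>(rcosets S - {S}) = {}"
    using rcos_disjoint[OF S(1)] \<open>S \<in> rcosets S\<close> by (auto simp: pairwise_def disjnt_def)
  moreover have "openin T (\<Union>(rcosets S - {S}))"
    by (intro openin_Union) (auto simp: RCOSETS_def intro: openin_rcoset[OF S])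
  moreover have "S \<subseteq> carrier G" using S(1) by (rule subgroup.subset)
  ultimately have "carrier G - S = \<Union>(rcosets S - {S})" by blast
  then show ?thesis
    using \<open>openin T (\<Union>(rcosets S - {S}))\<close> \<open>S \<subseteq> carrier G\<close> by (simp add: closedin_def topspace_eq_carrier)
qed

lemma finite_rcosets_open_subgroup:
  assumes "compact_space T" and S: "subgroup S G" "openin T S"
  shows "finite (rcosets S)"
proof -
  have "\<forall>V\<in>rcosets S. openin T V" by (auto simp: RCOSETS_def intro: openin_rcoset[OF S])
  moreover have "topspace T \<subseteq> \<Union>(rcosets S)"
    using rcosets_part_G[OF S(1)] by (simp add: topspace_eq_carrier)
  ultimately obtain \<F> where \<F>: "finite \<F>" "\<F> \<subseteq> rcosets S" "topspace T \<subseteq> \<Union>\<F>"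
    using assms(1) unfolding compact_space_alt by meson
  have "rcosets S \<subseteq> \<F>"
  proof
    fix X assume X: "X \<in> rcosets S"
    then have "X \<noteq> {}" using S(1) is_group by (metis subgroup.rcosets_non_empty)
    then obtain x where x: "x \<in> X" by blast
    then have "x \<in> topspace T"
      using X rcosets_part_G[OF S(1)] by (auto simp: topspace_eq_carrier)
    then obtain Y where "Y \<in> \<F>" "x \<in> Y" using \<F> by blast
    then have "X = Y"
      using rcos_disjoint[OF S(1)] X x \<F>(2) by (fastforce simp: pairwise_def disjnt_def)
    then show "X \<in> \<F>" using \<open>Y \<in> \<F>\<close> by simp
  qed
  then show ?thesis using \<F>(1) finite_subset by blast
qed

text \<open>A subgroup containing \<open>S\<close> is a union of right cosets of \<open>S\<close>,
  of which there are finitely many. This serves both for counting open subgroups and for showing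
  that infinitely many subgroups cannot share an open one.\<close>

lemma finite_supergroups:
  assumes "compact_space T" and S: "subgroup S G" "openin T S"
  shows "finite {K. subgroup K G \<and> S \<subseteq> K}"
proof (rule finite_subset)
  show "finite (Union ` Pow (rcosets S))"
    using finite_rcosets_open_subgroup[OF assms] by simp
  show "{K. subgroup K G \<and> S \<subseteq> K} \<subseteq> Union ` Pow (rcosets S)"
  proof
    fix K assume "K \<in> {K. subgroup K G \<and> S \<subseteq> K}"
    then have K: "subgroup K G" "S \<subseteq> K" by auto
    have "S #> k \<subseteq> K" if "k \<in> K" for k
      using that K by (auto simp: r_coset_def subgroup.m_closed)
    moreover have "k \<in> S #> k" if "k \<in> K" for k
      using that K S rcos_self subgroup.mem_carrier by metis
    ultimately have "K = \<Union>((\<lambda>k. S #> k) ` K)" by blast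
    moreover have "(\<lambda>k. S #> k) ` K \<in> Pow (rcosets S)"
      using K(1) by (auto simp: RCOSETS_def dest: subgroup.mem_carrier)
    ultimately show "K \<in> Union ` Pow (rcosets S)" by blast
  qed
qed

section \<open>Isolated and solitary points of the space of closed subgroups\<close>

lemma isolated_points_subgroup_space_iff:
  "K \<in> isolated_points (subgroup_space G T) \<longleftrightarrow>
     K \<in> closed_subgroups G T \<and>
     (\<exists>N. N \<lhd> G \<and> openin T N \<and> (\<forall>L\<in>closed_subgroups G T. L <#> N = K <#> N \<longrightarrow> L = K))"
  by (auto simp: isolated_points_def topspace_subgroup_space openin_subgroup_space_iff subgroup_nbhd_def)

lemma solitary_iff:
  "solitary G T K \<longleftrightarrow>
     isolated_points (subgroup_space G T) \<noteq> {} \<and> K \<in> closed_subgroups G T \<and>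
     K \<notin> isolated_points (subgroup_space G T) \<and>
     (\<exists>N. N \<lhd> G \<and> openin T N \<and> (\<forall>L\<in>closed_subgroups G T - isolated_points (subgroup_space G T).
        L <#> N = K <#> N \<longrightarrow> L = K))"
proof -
  let ?X = "subgroup_space G T" and ?C = "closed_subgroups G T"
  let ?I = "isolated_points ?X"
  have "openin (without_isolated_points ?X) {K} \<longleftrightarrow>
      (\<exists>N. N \<lhd> G \<and> openin T N \<and> (\<forall>L\<in>?C - ?I. L <#> N = K <#> N \<longrightarrow> L = K))"
    if K: "K \<in> ?C - ?I"
  proof
    assume "openin (without_isolated_points ?X) {K}"
    then obtain U where U: "openin ?X U" "{K} = U \<inter> (?C - ?I)"
      by (auto simp: without_isolated_points_def openin_subtopology topspace_subgroup_space)
    then have "K \<in> U" by blast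
    then obtain N where "N \<lhd> G" "openin T N" "subgroup_nbhd G T K N \<subseteq> U"
      using U(1) unfolding openin_subgroup_space_iff by meson
    then show "\<exists>N. N \<lhd> G \<and> openin T N \<and> (\<forall>L\<in>?C - ?I. L <#> N = K <#> N \<longrightarrow> L = K)"
      using U(2) by (fastforce simp: subgroup_nbhd_def)
  next
    assume "\<exists>N. N \<lhd> G \<and> openin T N \<and> (\<forall>L\<in>?C - ?I. L <#> N = K <#> N \<longrightarrow> L = K)"
    then obtain N where N: "N \<lhd> G" "openin T N" "\<forall>L\<in>?C - ?I. L <#> N = K <#> N \<longrightarrow> L = K"
      by blast
    have "openin ?X (subgroup_nbhd G T K N)"
      unfolding subgroup_space_def by (rule topology_generated_by_Basis) (use N K in blast)
    moreover have "{K} = subgroup_nbhd G T K N \<inter> (?C - ?I)"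
      using N(3) K by (auto simp: subgroup_nbhd_def)
    ultimately show "openin (without_isolated_points ?X) {K}"
      unfolding without_isolated_points_def openin_subtopology topspace_subgroup_space by blast
  qed
  moreover have top: "topspace (without_isolated_points ?X) = ?C - ?I"
    by (auto simp: without_isolated_points_def topspace_subgroup_space)
  have "K \<in> isolated_points (without_isolated_points ?X) \<longleftrightarrow>
      K \<in> ?C - ?I \<and> openin (without_isolated_points ?X) {K}"
    unfolding isolated_points_def[of "without_isolated_points ?X"] top by simp
  ultimately show ?thesis
    unfolding solitary_def perfect_topology_def by (metis (lifting) Diff_iff)
qed

text \<open>A solitary \<open>K\<close> is recovered from a witness \<open>N K\<close> of its
  isolation together with \<open>K <#> N K\<close>: another solitary subgroup with the same two data
  lies in the neighbourhood in which \<open>K\<close> is alone. Both data are open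
  subgroups.\<close>

lemma countable_solitary:
  assumes "countable {U. subgroup U G \<and> openin T U}"
  shows "countable {K. solitary G T K}"
proof -
  let ?I = "isolated_points (subgroup_space G T)"
  let ?\<U> = "{U. subgroup U G \<and> openin T U}"
  have "\<exists>N. N \<lhd> G \<and> openin T N \<and> (\<forall>L\<in>closed_subgroups G T - ?I. L <#> N = K <#> N \<longrightarrow> L = K)"
    if "solitary G T K" for K
    using that unfolding solitary_iff by blast
  then obtain N where N: "\<And>K. solitary G T K \<Longrightarrow> N K \<lhd> G" "\<And>K. solitary G T K \<Longrightarrow> openin T (N K)"
    and iso: "\<And>K L. solitary G T K \<Longrightarrow> L \<in> closed_subgroups G T - ?I \<Longrightarrow> L <#> N K = K <#> N K \<Longrightarrow> L = K"
    by metis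
  let ?f = "\<lambda>K. (K <#> N K, N K)"
  have sol: "K \<in> closed_subgroups G T - ?I" if "solitary G T K" for K
    using that unfolding solitary_iff by blast
  have "inj_on ?f {K. solitary G T K}"
    by (auto simp: inj_on_def dest: iso sol)
  moreover have "?f ` {K. solitary G T K} \<subseteq> ?\<U> \<times> ?\<U>"
  proof clarify
    fix K assume K: "solitary G T K"
    have sK: "subgroup K G" using sol[OF K] by (simp add: closed_subgroups_def)
    have sN: "subgroup (N K) G" using N(1)[OF K] by (rule normal_imp_subgroup)
    have sKN: "subgroup (K <#> N K) G"
      using sK N(1)[OF K] by (rule subgroup_set_mult_normal)
    moreover have "N K \<subseteq> K <#> N K" using subset_set_mult2[OF sK subgroup.subset[OF sN]] .
    ultimately have "openin T (K <#> N K)" using openin_supergroup sN N(2)[OF K] by blast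
    then show "(K <#> N K \<in> ?\<U>) \<and> (N K \<in> ?\<U>)" using sKN sN N(2)[OF K] by blast
  qed
  then have "countable (?f ` {K. solitary G T K})"
    by (rule countable_subset) (intro countable_SIGMA assms)
  ultimately show ?thesis by (rule countable_image_inj_on[rotated])
qed

lemma countable_open_subgroups:
  assumes "compact_space T" "countable \<B>"
    and \<B>: "\<And>B. B \<in> \<B> \<Longrightarrow> subgroup B G \<and> openin T B"
    and base: "\<And>U. subgroup U G \<Longrightarrow> openin T U \<Longrightarrow> \<exists>B\<in>\<B>. B \<subseteq> U"
  shows "countable {U. subgroup U G \<and> openin T U}"
proof (rule countable_subset)
  show "countable (\<Union>B\<in>\<B>. {K. subgroup K G \<and> B \<subseteq> K})"
    using \<B> finite_supergroups[OF assms(1)] by (intro countable_UN assms(2) countable_finite) blast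
  show "{U. subgroup U G \<and> openin T U} \<subseteq> (\<Union>B\<in>\<B>. {K. subgroup K G \<and> B \<subseteq> K})"
    using base by blast
qed

end

section \<open>Profinite groups\<close>

context profinite_group
begin

text \<open>Total disconnectedness makes \<open>{\<one>}\<close> a connected component, and in a
  compact Hausdorff space a component can be separated from a disjoint closed set by a clopen
  set.\<close>

lemma clopen_base:
  assumes U: "openin T U" "\<one> \<in> U"
  obtains C where "openin T C" "closedin T C" "\<one> \<in> C" "C \<subseteq> U"
proof -
  have one: "\<one> \<in> topspace T" by (simp add: topspace_eq_carrier)
  have "separated_between T {\<one>} (topspace T - U)"
  proof (rule separated_between_compact_connected_component)
    show "locally_compact_space T" using compact by (rule compact_imp_locally_compact_space)
    show "Hausdorff_space T" by (rule Hausdorff)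
    show "{\<one>} \<in> connected_components_of T"
      using totally_disconnected[OF one] one unfolding connected_components_of_def by blast
  qed (use U one in \<open>auto simp: compactin_sing\<close>)
  then obtain C V where CV: "openin T C" "openin T V" "C \<union> V = topspace T" "disjnt C V"
      "{\<one>} \<subseteq> C" "topspace T - U \<subseteq> V"
    unfolding separated_between_def by blast
  then have "topspace T - C = V" by (auto simp: disjnt_def)
  then have "closedin T C" using CV openin_subset[OF CV(1)] by (simp add: closedin_def)
  moreover have "C \<subseteq> U" using CV by (auto simp: disjnt_def)
  ultimately show thesis using that CV by blast
qed

text \<open>The subgroup is carved out of a clopen \<open>C\<close>: it consists of the elements for
  which all conjugates, and all conjugates of the inverse, translate \<open>C\<close> into itself.
  Compactness of \<open>carrier G \<times> C\<close> keeps this set open.\<close>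

lemma open_normal_base:
  assumes U: "openin T U" "\<one> \<in> U"
  obtains N where "N \<lhd> G" "openin T N" "N \<subseteq> U"
proof -
  obtain C where C: "openin T C" "closedin T C" "\<one> \<in> C" "C \<subseteq> U"
    using clopen_base[OF U] .
  have CG: "C \<subseteq> carrier G" using openin_subset[OF C(1)] by (simp add: topspace_eq_carrier)
  define M where "M = {x \<in> carrier G. \<forall>g\<in>carrier G. \<forall>c\<in>C. g \<otimes> x \<otimes> inv g \<otimes> c \<in> C}"
  let ?TT = "prod_topology T (prod_topology T T)"
  let ?h = "\<lambda>q. fst (snd q) \<otimes> fst q \<otimes> inv (fst (snd q)) \<otimes> snd (snd q)"
  have cont: "continuous_map ?TT T ?h"
    by (intro continuous_map_mult_ops continuous_map_inv_op
        continuous_map_fst continuous_map_fst_of[OF continuous_map_snd, unfolded o_def]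
        continuous_map_snd_of[OF continuous_map_snd, unfolded o_def])
  have "openin T M"
  proof (subst openin_subopen, intro ballI)
    fix x assume x: "x \<in> M"
    let ?W = "{q \<in> topspace ?TT. ?h q \<in> C}"
    \<comment> \<open>Tube lemma: the condition holds for all \<open>g\<close> and \<open>c\<close>
      at once on a neighbourhood of \<open>x\<close>, because the pairs range over a compact
      set.\<close>
    have "\<exists>U' V. openin T U' \<and> openin (prod_topology T T) V \<and> x \<in> U' \<and> carrier G \<times> C \<subseteq> V \<and> U' \<times> V \<subseteq> ?W"
    proof (rule tube_lemma_right)
      show "openin ?TT ?W" using cont C(1) by (rule openin_continuous_map_preimage)
      have "compactin T (carrier G)" using compact by (simp add: compact_space_def topspace_eq_carrier)
      moreover have "compactin T C" using compact C(2) by (rule closedin_compact_space)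
      ultimately show "compactin (prod_topology T T) (carrier G \<times> C)" by (simp add: compactin_Times)
      show "x \<in> topspace T" using x by (simp add: M_def topspace_eq_carrier)
      show "{x} \<times> (carrier G \<times> C) \<subseteq> ?W"
        using x CG by (auto simp: M_def topspace_eq_carrier)
    qed
    then obtain U' V where UV: "openin T U'" "x \<in> U'" "carrier G \<times> C \<subseteq> V" "U' \<times> V \<subseteq> ?W" by blast
    have "U' \<subseteq> M"
    proof
      fix y assume y: "y \<in> U'"
      have "g \<otimes> y \<otimes> inv g \<otimes> c \<in> C" if "g \<in> carrier G" "c \<in> C" for g c
      proof -
        have "(y, g, c) \<in> ?W" using y that UV(3,4) by blast
        then show ?thesis by simp
      qed
      moreover have "y \<in> carrier G"
        using y openin_subset[OF UV(1)] by (auto simp: topspace_eq_carrier)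
      ultimately show "y \<in> M" by (simp add: M_def)
    qed
    then show "\<exists>V. openin T V \<and> x \<in> V \<and> V \<subseteq> M" using UV by blast
  qed
  \<comment> \<open>\<open>M\<close> is closed under products and conjugation but not visibly under
    inverses. It lies in \<open>C\<close> because \<open>\<one> \<in> C\<close>.\<close>
  define N where "N = {x \<in> carrier G. x \<in> M \<and> inv x \<in> M}"
  have "N = M \<inter> {x \<in> carrier G. inv x \<in> M}" by (auto simp: N_def M_def)
  then have "openin T N"
    using \<open>openin T M\<close> by (auto intro!: openin_preimage continuous_map_ops)
  have M_mult: "x \<otimes> y \<in> M" if "x \<in> M" "y \<in> M" for x y
  proof -
    have xy: "x \<in> carrier G" "y \<in> carrier G" using that by (auto simp: M_def)
    have "g \<otimes> (x \<otimes> y) \<otimes> inv g \<otimes> c \<in> C" if gc: "g \<in> carrier G" "c \<in> C" for g c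
    proof -
      have c: "c \<in> carrier G" using gc CG by blast
      have "g \<otimes> x \<otimes> inv g \<otimes> (g \<otimes> y \<otimes> inv g \<otimes> c) \<in> C"
        using \<open>x \<in> M\<close> \<open>y \<in> M\<close> gc by (simp add: M_def)
      moreover have "g \<otimes> x \<otimes> inv g \<otimes> (g \<otimes> y \<otimes> inv g \<otimes> c) = g \<otimes> (x \<otimes> y) \<otimes> inv g \<otimes> c"
        using gc xy c by (simp add: m_assoc inv_solve_left flip: m_assoc[of "inv g" g])
      ultimately show ?thesis by simp
    qed
    then show ?thesis using xy by (simp add: M_def)
  qed
  have M_conj: "h \<otimes> x \<otimes> inv h \<in> M" if "x \<in> M" "h \<in> carrier G" for x h
  proof -
    have x: "x \<in> carrier G" using that by (auto simp: M_def)
    have "g \<otimes> (h \<otimes> x \<otimes> inv h) \<otimes> inv g \<otimes> c \<in> C" if gc: "g \<in> carrier G" "c \<in> C" for g c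
    proof -
      have c: "c \<in> carrier G" using gc CG by blast
      have "(g \<otimes> h) \<otimes> x \<otimes> inv (g \<otimes> h) \<otimes> c \<in> C"
        using \<open>x \<in> M\<close> gc \<open>h \<in> carrier G\<close> by (simp add: M_def)
      then show ?thesis using gc x c \<open>h \<in> carrier G\<close> by (simp add: m_assoc inv_mult_group)
    qed
    then show ?thesis using x that by (simp add: M_def)
  qed
  have M_one: "\<one> \<in> M" using CG by (auto simp: M_def subset_iff)
  have "subgroup N G"
  proof (rule subgroupI)
    show "N \<noteq> {}" using M_one by (auto simp: N_def)
  qed (auto simp: N_def M_mult inv_mult_group)
  moreover have "h \<otimes> x \<otimes> inv h \<in> N" if "h \<in> carrier G" "x \<in> N" for h x
    using that M_conj[of x h] M_conj[of "inv x" h] by (simp add: N_def inv_mult_group m_assoc)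
  ultimately have "N \<lhd> G" by (rule normal_invI)
  moreover have "N \<subseteq> U"
  proof
    fix x assume "x \<in> N"
    then have x: "x \<in> carrier G" "x \<in> M" by (auto simp: N_def)
    then have "\<one> \<otimes> x \<otimes> inv \<one> \<otimes> \<one> \<in> C" using C(3) unfolding M_def by blast
    then show "x \<in> U" using x C(4) by auto
  qed
  ultimately show thesis using that \<open>openin T N\<close> by blast
qed

lemma coset_avoiding_closed:
  assumes "closedin T K" "x \<in> carrier G" "x \<notin> K"
  obtains N where "N \<lhd> G" "openin T N" "\<And>n. n \<in> N \<Longrightarrow> x \<otimes> n \<notin> K"
proof -
  have "openin T (carrier G - K)" using assms(1) by (simp add: closedin_def topspace_eq_carrier)
  then have "openin T {y \<in> carrier G. x \<otimes> y \<in> carrier G - K}"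
    by (rule openin_preimage[OF continuous_map_left_translation[OF assms(2)]])
  then obtain N where "N \<lhd> G" "openin T N" "N \<subseteq> {y \<in> carrier G. x \<otimes> y \<in> carrier G - K}"
    using open_normal_base[of "{y \<in> carrier G. x \<otimes> y \<in> carrier G - K}"] assms by auto
  then show thesis using that by blast
qed

lemma closedin_singleton: "x \<in> carrier G \<Longrightarrow> closedin T {x}"
  by (simp add: closedin_Hausdorff_singleton Hausdorff topspace_eq_carrier)

lemma open_normal_avoiding:
  assumes "x \<in> carrier G" "x \<noteq> \<one>"
  obtains N where "N \<lhd> G" "openin T N" "x \<notin> N"
proof -
  have "openin T (carrier G - {x})"
    using closedin_singleton[OF assms(1)] by (simp add: closedin_def topspace_eq_carrier)
  then obtain N where "N \<lhd> G" "openin T N" "N \<subseteq> carrier G - {x}"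
    using open_normal_base[of "carrier G - {x}"] assms by auto
  then show thesis using that by blast
qed

text \<open>In a Hausdorff group a finite open neighbourhood of \<open>\<one>\<close> shrinks to
  \<open>{\<one>}\<close>, and compactness leaves only finitely many cosets of the trivial
  subgroup.\<close>

lemma finite_open_imp_finite_carrier:
  assumes "finite U" "openin T U" "\<one> \<in> U"
  shows "finite (carrier G)"
proof -
  have UG: "U \<subseteq> carrier G" using openin_subset[OF assms(2)] by (simp add: topspace_eq_carrier)
  have "openin T (U - (U - {\<one>}))"
    by (rule openin_diff[OF assms(2)])
      (use UG assms(1) in \<open>auto intro!: closedin_Hausdorff_finite[OF Hausdorff] simp: topspace_eq_carrier\<close>)
  moreover have "U - (U - {\<one>}) = {\<one>}" using assms(3) by blast
  ultimately have "finite (rcosets {\<one>})"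
    using finite_rcosets_open_subgroup[OF compact triv_subgroup] by simp
  moreover have "rcosets {\<one>} = (\<lambda>x. {x}) ` carrier G"
    by (auto simp: RCOSETS_def r_coset_def)
  ultimately show ?thesis by (metis finite_image_iff inj_onI singleton_inject)
qed

text \<open>\<open>K\<close> and the open subgroup \<open>K <#> N\<close> have the same product with
  \<open>N\<close>, so the neighbourhood given by \<open>N\<close> can isolate \<open>K\<close> only
  if the two coincide.\<close>

lemma isolated_imp_open:
  assumes "K \<in> isolated_points (subgroup_space G T)"
  shows "openin T K"
proof -
  obtain N where N: "N \<lhd> G" "openin T N"
    and iso: "\<And>L. L \<in> closed_subgroups G T \<Longrightarrow> L <#> N = K <#> N \<Longrightarrow> L = K"
    and K: "K \<in> closed_subgroups G T"
    using assms unfolding isolated_points_subgroup_space_iff by blast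
  have sK: "subgroup K G" using K by (simp add: closed_subgroups_def)
  have sN: "subgroup N G" using N(1) by (rule normal_imp_subgroup)
  have sKN: "subgroup (K <#> N) G"
    using sK N(1) by (rule subgroup_set_mult_normal)
  have "N \<subseteq> K <#> N" using subset_set_mult2[OF sK subgroup.subset[OF sN]] .
  then have o: "openin T (K <#> N)" using openin_supergroup sKN sN N(2) by blast
  then have "K <#> N \<in> closed_subgroups G T"
    using sKN closedin_open_subgroup by (simp add: closed_subgroups_def)
  moreover have "(K <#> N) <#> N = K <#> N"
    using set_mult_assoc[of K N N] sK sN subgroup_mult_id[OF sN] by (simp add: subgroup.subset)
  ultimately have "K <#> N = K" by (rule iso)
  then show ?thesis using o by simp
qed

lemma pro_p_groupI:
  assumes "prime p"
    and pow: "\<And>N x. N \<lhd> G \<Longrightarrow> openin T N \<Longrightarrow> x \<in> carrier G \<Longrightarrow> \<exists>k. x [^] (p ^ k) \<in> N"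
  shows "pro_p_group G T p"
proof unfold_locales
  fix N assume N: "N \<lhd> G" "openin T N"
  interpret N: normal N G by (rule N(1))
  interpret Q: group "G Mod N" by (rule N.factorgroup_is_group)
  have "finite (carrier (G Mod N))"
    using finite_rcosets_open_subgroup[OF compact N.subgroup_axioms N(2)] by (simp add: FactGroup_def)
  moreover have "\<exists>i. X [^]\<^bsub>G Mod N\<^esub> (p ^ i) = \<one>\<^bsub>G Mod N\<^esub>" if X: "X \<in> carrier (G Mod N)" for X
  proof -
    obtain x where x: "x \<in> carrier G" "X = N #> x" using X by (auto simp: carrier_FactGroup)
    obtain k where "x [^] (p ^ k) \<in> N" using pow[OF N x(1)] by blast
    then have "X [^]\<^bsub>G Mod N\<^esub> (p ^ k) = N"
      using x by (simp add: N.FactGroup_pow N.rcos_eq_self_iff)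
    then show ?thesis by auto
  qed
  ultimately show "\<exists>k. order (G Mod N) = p ^ k"
    using Q.order_eq_prime_power[OF \<open>prime p\<close>] by blast
qed

end

section \<open>Finite quotients and the Frattini argument in pro-p groups\<close>

context pro_p_group
begin

lemma pow_mem_open_normal:
  assumes "N \<lhd> G" "openin T N" "x \<in> carrier G"
  shows "\<exists>k. x [^] (p ^ k) \<in> N"
proof -
  interpret N: normal N G by (rule assms(1))
  interpret Q: group "G Mod N" by (rule N.factorgroup_is_group)
  obtain k where k: "order (G Mod N) = p ^ k" using order_quotient[OF assms(1,2)] by blast
  have "N #> x \<in> carrier (G Mod N)" using assms(3) by (auto simp: carrier_FactGroup)
  then have "N #> (x [^] (p ^ k)) = N"
    using Q.pow_order_eq_1[of "N #> x"] k assms(3) by (simp add: N.FactGroup_pow)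
  then show ?thesis using N.rcos_eq_self_iff assms(3) by auto
qed

lemma central_mod_open_normal:
  assumes "prime p" and C: "C \<lhd> G" "openin T C" "C \<noteq> carrier G"
  obtains t where "t \<in> carrier G" "t \<notin> C" "\<And>g. g \<in> carrier G \<Longrightarrow> g \<otimes> t \<otimes> inv g \<otimes> inv t \<in> C"
proof -
  interpret C: normal C G by (rule C(1))
  interpret Q: group "G Mod C" by (rule C.factorgroup_is_group)
  interpret q: group_hom G "G Mod C" "\<lambda>x. C #> x"
    by (intro group_hom.intro group_hom_axioms.intro C.r_coset_hom_Mod Q.is_group is_group)
  obtain k where k: "order (G Mod C) = p ^ k" using order_quotient[OF C(1,2)] by blast
  have "carrier (G Mod C) \<noteq> {\<one>\<^bsub>G Mod C\<^esub>}"
  proof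
    assume "carrier (G Mod C) = {\<one>\<^bsub>G Mod C\<^esub>}"
    then have "C #> x = C" if "x \<in> carrier G" for x
      using q.hom_closed[OF that] by simp
    then have "carrier G \<subseteq> C" using C.rcos_eq_self_iff by blast
    then show False using C(3) C.subset by blast
  qed
  then obtain z where z: "z \<in> carrier (G Mod C)" "z \<noteq> \<one>\<^bsub>G Mod C\<^esub>"
    and comm: "\<And>x. x \<in> carrier (G Mod C) \<Longrightarrow> x \<otimes>\<^bsub>G Mod C\<^esub> z = z \<otimes>\<^bsub>G Mod C\<^esub> x"
    using Q.p_group_center_nontrivial[OF \<open>prime p\<close> k] by blast
  obtain t where t: "t \<in> carrier G" "z = C #> t" using z(1) by (auto simp: carrier_FactGroup)
  have "t \<notin> C" using z(2) t C.rcos_eq_self_iff by auto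
  moreover have "g \<otimes> t \<otimes> inv g \<otimes> inv t \<in> C" if g: "g \<in> carrier G" for g
  proof -
    have "C #> (g \<otimes> t) = C #> (t \<otimes> g)"
      using comm[OF q.hom_closed[OF g]] g t by simp
    then have "g \<otimes> t \<in> C #> (t \<otimes> g)"
      using rcos_self[of "g \<otimes> t" C] g t C.subgroup_axioms by auto
    then obtain c where c: "c \<in> C" "g \<otimes> t = c \<otimes> (t \<otimes> g)" by (auto simp: r_coset_def)
    then have "g \<otimes> t \<otimes> inv g \<otimes> inv t = c"
      using g t C.subset by (auto simp: m_assoc subset_iff)
    then show ?thesis using c by simp
  qed
  ultimately show thesis using that t by blast
qed

text \<open>A closed proper subgroup stays proper in a suitable finite quotient, where a maximal
  subgroup above it is found and then pulled back.\<close>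

lemma open_maximal_subgroup:
  assumes "prime p" and L: "subgroup L G" "openin T L"
    and K: "subgroup K G" "closedin T K" "K \<subseteq> L" "K \<noteq> L"
  obtains M where "subgroup M G" "openin T M" "K \<subseteq> M" "M \<subseteq> L" "M \<noteq> L"
    "\<And>x. x \<in> L \<Longrightarrow> x [^] p \<in> M" "\<And>x y. x \<in> L \<Longrightarrow> y \<in> L \<Longrightarrow> x \<otimes> y \<otimes> inv x \<otimes> inv y \<in> M"
proof -
  have LG: "L \<subseteq> carrier G" using L(1) by (rule subgroup.subset)
  obtain x where x: "x \<in> L" "x \<notin> K" using K by blast
  have xG: "x \<in> carrier G" using x LG by blast
  obtain N1 where N1: "N1 \<lhd> G" "openin T N1" "\<And>n. n \<in> N1 \<Longrightarrow> x \<otimes> n \<notin> K"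
    using coset_avoiding_closed[OF K(2) xG x(2)] by blast
  obtain N2 where N2: "N2 \<lhd> G" "openin T N2" "N2 \<subseteq> L"
    using open_normal_base[OF L(2) subgroup.one_closed[OF L(1)]] by blast
  \<comment> \<open>\<open>N1\<close> keeps \<open>x\<close> outside the image of \<open>K\<close>,
    and \<open>N2\<close> keeps \<open>N\<close> inside \<open>L\<close>.\<close>
  define N where "N = N1 \<inter> N2"
  have N: "N \<lhd> G" "openin T N" "N \<subseteq> L"
    using N1 N2 normal_subgroup_intersect by (auto simp: N_def)
  interpret N: normal N G by (rule N(1))
  let ?Q = "G Mod N" and ?q = "\<lambda>x. N #> x"
  interpret Q: group ?Q by (rule N.factorgroup_is_group)
  interpret q: group_hom G ?Q ?q
    by (intro group_hom.intro group_hom_axioms.intro N.r_coset_hom_Mod Q.is_group is_group)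
  obtain k where k: "order ?Q = p ^ k" using order_quotient[OF N(1,2)] by blast
  have sL: "subgroup (?q ` L) ?Q" and sK: "subgroup (?q ` K) ?Q"
    using q.subgroup_img_is_subgroup L(1) K(1) by blast+
  let ?P = "?Q\<lparr>carrier := ?q ` L\<rparr>"
  interpret P: group ?P using sL by (rule Q.subgroup_imp_group)
  have "card (?q ` L) dvd p ^ k" using Q.lagrange[OF sL] k by (metis dvd_triv_right)
  then obtain j where j: "order ?P = p ^ j"
    using \<open>prime p\<close> by (auto simp: order_def divides_primepow_nat)
  have sKP: "subgroup (?q ` K) ?P"
    using Q.subgroup_incl[OF sK sL] K(3) by blast
  have "?q ` K \<noteq> carrier ?P"
  proof
    assume "?q ` K = carrier ?P"
    then have "?q x \<in> ?q ` K" using x(1) by simp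
    then obtain y where y: "y \<in> K" "?q x = ?q y" by blast
    have yG: "y \<in> carrier G" using y K LG by blast
    have "y \<in> N #> x" using rcos_self[of y N] yG y(2) N.subgroup_axioms by auto
    then obtain n where n: "n \<in> N" "y = n \<otimes> x" by (auto simp: r_coset_def)
    have nG: "n \<in> carrier G" using n N.subset by blast
    \<comment> \<open>\<open>N1\<close> was chosen for products \<open>x \<otimes> n\<close>,
      whereas the right coset supplies \<open>n \<otimes> x\<close>; normality moves the factor to
      the other side.\<close>
    have "inv x \<otimes> n \<otimes> x \<in> N" using N.inv_op_closed1[OF xG n(1)] .
    then have "x \<otimes> (inv x \<otimes> n \<otimes> x) \<notin> K" using N1(3) by (simp add: N_def)
    moreover have "x \<otimes> (inv x \<otimes> n \<otimes> x) = y" using n xG nG by (simp add: m_assoc[symmetric])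
    ultimately show False using y by simp
  qed
  then obtain M' where M': "subgroup M' ?P" "?q ` K \<subseteq> M'" "M' \<noteq> carrier ?P"
    and pw: "\<And>x. x \<in> carrier ?P \<Longrightarrow> x [^]\<^bsub>?P\<^esub> p \<in> M'"
    and cm: "\<And>x y. x \<in> carrier ?P \<Longrightarrow> y \<in> carrier ?P \<Longrightarrow>
        x \<otimes>\<^bsub>?P\<^esub> y \<otimes>\<^bsub>?P\<^esub> inv\<^bsub>?P\<^esub> x \<otimes>\<^bsub>?P\<^esub> inv\<^bsub>?P\<^esub> y \<in> M'"
    using P.p_group_maximal_subgroup[OF \<open>prime p\<close> j sKP] by blast
  have sM': "subgroup M' ?Q" using Q.incl_subgroup[OF sL M'(1)] .
  have M'L: "M' \<subseteq> ?q ` L" using subgroup.subset[OF M'(1)] by simp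
  define M where "M = L \<inter> {x \<in> carrier G. ?q x \<in> M'}"
  have M_iff: "y \<in> M \<longleftrightarrow> ?q y \<in> M'" if "y \<in> L" for y using that LG by (auto simp: M_def)
  have sM: "subgroup M G"
    unfolding M_def by (intro subgroups_Inter_pair L(1) q.subgroup_preimage sM')
  have "N \<subseteq> M"
  proof
    fix n assume n: "n \<in> N"
    then have "?q n = N" using N.rcos_eq_self_iff N.subset by blast
    moreover have "N \<in> M'" using subgroup.one_closed[OF sM'] by simp
    ultimately show "n \<in> M" using n N(3) M_iff by auto
  qed
  then have "openin T M" using openin_supergroup[OF sM N.subgroup_axioms N(2)] by blast
  moreover have "K \<subseteq> M" using M'(2) K(3) M_iff by blast
  moreover have "M \<noteq> L"
  proof
    assume "M = L"
    then have "?q ` L \<subseteq> M'" using M_iff by blast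
    then show False using M'(3) M'L by simp
  qed
  moreover have "y [^] p \<in> M" if y: "y \<in> L" for y
  proof -
    have yG: "y \<in> carrier G" using y LG by blast
    have "?q y [^]\<^bsub>?P\<^esub> p \<in> M'" using pw[of "?q y"] y by simp
    then have "?q (y [^] p) \<in> M'"
      using q.hom_nat_pow[OF yG, of p] by (simp flip: Q.nat_pow_consistent)
    moreover have "y [^] p \<in> L" using y L(1) by (induction p) (auto simp: subgroup.one_closed subgroup.m_closed)
    ultimately show ?thesis using M_iff by blast
  qed
  moreover have "y \<otimes> z \<otimes> inv y \<otimes> inv z \<in> M" if y: "y \<in> L" and z: "z \<in> L" for y z
  proof -
    have yG: "y \<in> carrier G" "z \<in> carrier G" using y z LG by blast+
    have "?q y \<otimes>\<^bsub>?P\<^esub> ?q z \<otimes>\<^bsub>?P\<^esub> inv\<^bsub>?P\<^esub> ?q y \<otimes>\<^bsub>?P\<^esub> inv\<^bsub>?P\<^esub> ?q z \<in> M'"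
      using cm[of "?q y" "?q z"] y z by simp
    then have "?q y \<otimes>\<^bsub>?Q\<^esub> ?q z \<otimes>\<^bsub>?Q\<^esub> inv\<^bsub>?Q\<^esub> ?q y \<otimes>\<^bsub>?Q\<^esub> inv\<^bsub>?Q\<^esub> ?q z \<in> M'"
      using Q.m_inv_consistent[OF sL] y z by (simp del: mult_FactGroup)
    then have "?q (y \<otimes> z \<otimes> inv y \<otimes> inv z) \<in> M'"
      using yG by (simp del: mult_FactGroup)
    moreover have "y \<otimes> z \<otimes> inv y \<otimes> inv z \<in> L"
      using y z L(1) by (simp add: subgroup.m_closed subgroup.m_inv_closed)
    ultimately show ?thesis using M_iff by blast
  qed
  moreover have "M \<subseteq> L" by (auto simp: M_def)
  ultimately show thesis using that[OF sM] by blast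
qed

text \<open>The hypothesis on \<open>N\<close> places it in the Frattini subgroup of
  \<open>L\<close>, which consists of non-generators: a proper closed subgroup \<open>K\<close> of
  \<open>L\<close> lies in a proper open subgroup that contains all p-th powers and commutators,
  hence also \<open>N\<close>, so \<open>K <#> N\<close> stays proper.\<close>

lemma eq_if_set_mult_frattini_eq:
  assumes "prime p" and L: "subgroup L G" "openin T L" and N: "N \<lhd> G"
    and frattini: "\<And>C. subgroup C G \<Longrightarrow> closedin T C \<Longrightarrow> (\<And>x. x \<in> L \<Longrightarrow> x [^] p \<in> C) \<Longrightarrow>
      (\<And>x y. x \<in> L \<Longrightarrow> y \<in> L \<Longrightarrow> x \<otimes> y \<otimes> inv x \<otimes> inv y \<in> C) \<Longrightarrow> N \<subseteq> C"
    and K: "subgroup K G" "closedin T K" "K <#> N = L"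
  shows "K = L"
proof (rule ccontr)
  assume "K \<noteq> L"
  have sN: "subgroup N G" using N by (rule normal_imp_subgroup)
  have "K \<subseteq> L" using subset_set_mult1[OF subgroup.subset[OF K(1)] sN] K(3) by simp
  then obtain M where M: "subgroup M G" "openin T M" "K \<subseteq> M" "M \<subseteq> L" "M \<noteq> L"
    "\<And>x. x \<in> L \<Longrightarrow> x [^] p \<in> M" "\<And>x y. x \<in> L \<Longrightarrow> y \<in> L \<Longrightarrow> x \<otimes> y \<otimes> inv x \<otimes> inv y \<in> M"
    using open_maximal_subgroup[OF assms(1) L K(1,2) _ \<open>K \<noteq> L\<close>] by metis
  have "N \<subseteq> M" using frattini[OF M(1) closedin_open_subgroup[OF M(1,2)] M(6,7)] .
  then have "K <#> N \<subseteq> M" using M(1,3) by (auto simp: set_mult_def subgroup.m_closed subset_iff)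
  then show False using M(4,5) K(3) by blast
qed

end

section \<open>The p-adic integers in coordinates\<close>

text \<open>\<open>c n x\<close> is the residue of \<open>x\<close> modulo \<open>p ^ n\<close>.
  These axioms embed the group continuously into the p-adic integers; compactness makes the image
  closed and \<open>nontrivial\<close> makes it non-zero, so the image is again a copy of the p-adic
  integers.\<close>

locale padic_coordinates = topological_group +
  fixes p :: nat and c :: "nat \<Rightarrow> 'a \<Rightarrow> int"
  assumes prime: "prime p"
    and compact: "compact_space T"
    and coord_range: "x \<in> carrier G \<Longrightarrow> c n x \<in> {0..<int p ^ n}"
    and coord_mult: "x \<in> carrier G \<Longrightarrow> y \<in> carrier G \<Longrightarrow> c n (x \<otimes> y) = (c n x + c n y) mod int p ^ n"
    and coord_Suc: "x \<in> carrier G \<Longrightarrow> c (Suc n) x mod int p ^ n = c n x"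
    and coord_inject: "x \<in> carrier G \<Longrightarrow> y \<in> carrier G \<Longrightarrow> (\<And>n. c n x = c n y) \<Longrightarrow> x = y"
    and openin_coord: "openin T {x \<in> carrier G. c n x = a}"
    and nontrivial: "carrier G \<noteq> {\<one>}"
begin

lemma coord_mod: "x \<in> carrier G \<Longrightarrow> c n x mod int p ^ n = c n x"
  using coord_range by simp

lemma coord_one [simp]: "c n \<one> = 0"
proof -
  have "c n \<one> = (c n \<one> + c n \<one>) mod int p ^ n" using coord_mult[of \<one> \<one> n] by simp
  moreover have "c n \<one> = c n \<one> mod int p ^ n" using coord_mod by simp
  ultimately have "int p ^ n dvd c n \<one>"
    by (metis add_diff_cancel_right' mod_eq_dvd_iff)
  then show ?thesis using coord_range[of \<one> n] by (auto dest: zdvd_imp_le)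
qed

lemma eq_one_iff: "x \<in> carrier G \<Longrightarrow> x = \<one> \<longleftrightarrow> (\<forall>n. c n x = 0)"
  using coord_inject[of x \<one>] by auto

lemma m_comm: "x \<in> carrier G \<Longrightarrow> y \<in> carrier G \<Longrightarrow> x \<otimes> y = y \<otimes> x"
  by (rule coord_inject) (simp_all add: coord_mult add.commute)

sublocale comm_group G
  by (rule group_comm_groupI) (rule m_comm)

lemma coord_pow: "x \<in> carrier G \<Longrightarrow> c n (x [^] k) = (int k * c n x) mod int p ^ n"
  by (induction k) (simp_all add: coord_mult mod_simps distrib_right add.commute)

lemma coord_add: "x \<in> carrier G \<Longrightarrow> c (n + k) x mod int p ^ n = c n x"
proof (induction k)
  case 0
  then show ?case by (simp add: coord_mod)
next
  case (Suc k)
  have "c (n + Suc k) x mod int p ^ n = c (Suc (n + k)) x mod int p ^ (n + k) mod int p ^ n"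
    by (simp add: mod_mod_cancel le_imp_power_dvd)
  then show ?case using Suc coord_Suc by simp
qed

lemma coord_le: "x \<in> carrier G \<Longrightarrow> m \<le> n \<Longrightarrow> c n x mod int p ^ m = c m x"
  using coord_add[of x m "n - m"] by simp

definition level :: "nat \<Rightarrow> 'a set" where
  "level n = {x \<in> carrier G. c n x = 0}"

lemma subgroup_level: "subgroup (level n) G"
proof (rule subgroupI)
  show "level n \<noteq> {}" by (auto simp: level_def intro: exI[of _ \<one>])
  fix x y assume x: "x \<in> level n" and y: "y \<in> level n"
  then show "x \<otimes> y \<in> level n" by (simp add: level_def coord_mult)
  have "c n (inv x) = 0"
    using coord_mult[of x "inv x" n] x coord_mod[of "inv x" n] by (simp add: level_def)
  then show "inv x \<in> level n" using x by (simp add: level_def)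
qed (auto simp: level_def)

lemma openin_level: "openin T (level n)"
  unfolding level_def by (rule openin_coord)

lemma level_antimono: "m \<le> n \<Longrightarrow> level n \<subseteq> level m"
  using coord_le by (fastforce simp: level_def)

lemma closedin_coord: "closedin T {x \<in> carrier G. c n x = a}"
proof -
  have "carrier G - {x \<in> carrier G. c n x = a} = (\<Union>b\<in>-{a}. {x \<in> carrier G. c n x = b})" by auto
  moreover have "openin T (\<Union>b\<in>-{a}. {x \<in> carrier G. c n x = b})"
    by (intro openin_Union) (auto simp: openin_coord)
  ultimately show ?thesis by (simp add: closedin_def topspace_eq_carrier)
qed

text \<open>The levels are closed and meet in \<open>{\<one>}\<close>, so by compactness finitely
  many of them already meet inside \<open>U\<close>; as they are nested, one is enough.\<close>

lemma level_base:
  assumes "openin T U" "\<one> \<in> U"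
  obtains n where "level n \<subseteq> U"
proof -
  have "topspace T \<inter> \<Inter>(range level) \<subseteq> U"
  proof
    fix x assume x: "x \<in> topspace T \<inter> \<Inter>(range level)"
    then have "c n x = 0" for n by (auto simp: level_def)
    then have "x = \<one>" using x by (simp add: eq_one_iff topspace_eq_carrier)
    then show "x \<in> U" using assms(2) by simp
  qed
  moreover have "closedin T C" if "C \<in> range level" for C
    using that closedin_coord by (auto simp: level_def)
  ultimately obtain \<F> where \<F>: "finite \<F>" "\<F> \<subseteq> range level" "topspace T \<inter> \<Inter>\<F> \<subseteq> U"
    using compact_space_finite_Inter_subset[OF compact assms(1), of "range level"] by blast
  then obtain I where I: "finite I" "\<F> = level ` I" by (meson finite_subset_image)
  \<comment> \<open>\<open>insert 0\<close> covers an empty index set.\<close>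
  have "level (Max (insert 0 I)) \<subseteq> level i" if "i \<in> insert 0 I" for i
    using level_antimono that I(1) by (metis Max_ge finite_insert)
  then have "level (Max (insert 0 I)) \<subseteq> topspace T \<inter> \<Inter>\<F>"
    unfolding I(2) topspace_eq_carrier using level_def by fastforce
  then show thesis using that \<F>(3) by blast
qed

lemma profinite_group: "profinite_group G T"
proof unfold_locales
  show "Hausdorff_space T"
    unfolding Hausdorff_space_def
  proof (intro allI impI)
    fix x y assume xy: "x \<in> topspace T \<and> y \<in> topspace T \<and> x \<noteq> y"
    then obtain n where n: "c n x \<noteq> c n y" using coord_inject by (auto simp: topspace_eq_carrier)
    let ?U = "\<lambda>a. {z \<in> carrier G. c n z = a}"
    have "openin T (?U (c n x)) \<and> openin T (?U (c n y)) \<and> x \<in> ?U (c n x) \<and> y \<in> ?U (c n y) \<and>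
        disjnt (?U (c n x)) (?U (c n y))"
      using xy n openin_coord by (auto simp: topspace_eq_carrier disjnt_def)
    then show "\<exists>U V. openin T U \<and> openin T V \<and> x \<in> U \<and> y \<in> V \<and> disjnt U V" by blast
  qed
  show "connected_component_of_set T x = {x}" if x: "x \<in> topspace T" for x
  proof -
    have "y = x" if y: "connected_component_of T x y" for y
    proof (rule coord_inject)
      show "y \<in> carrier G" "x \<in> carrier G"
        using connected_component_in_topspace[OF y] by (auto simp: topspace_eq_carrier)
      fix n
      have "connectedin T (connected_component_of_set T x)" by (rule connectedin_connected_component_of)
      then have "connected_component_of_set T x \<subseteq> {z \<in> carrier G. c n z = c n x} \<or>
          disjnt (connected_component_of_set T x) {z \<in> carrier G. c n z = c n x}"
        by (rule connectedin_clopen_cases[OF _ closedin_coord openin_coord])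
      moreover have "x \<in> connected_component_of_set T x"
        using x by (simp add: connected_component_of_refl)
      ultimately show "c n y = c n x"
        using y x by (auto simp: disjnt_iff topspace_eq_carrier)
    qed
    then show ?thesis using x by (auto simp: connected_component_of_refl)
  qed
qed (rule compact)

sublocale profinite_group G T
  by (rule profinite_group)

lemma pow_in_level: "x \<in> carrier G \<Longrightarrow> x [^] (p ^ n) \<in> level n"
  by (simp add: level_def coord_pow)

lemma pro_p_group: "pro_p_group G T p"
proof (rule pro_p_groupI[OF prime])
  fix N x assume N: "N \<lhd> G" "openin T N" and x: "x \<in> carrier G"
  have "\<one> \<in> N" using N(1) by (simp add: normal_imp_subgroup subgroup.one_closed)
  then obtain n where "level n \<subseteq> N" using level_base N(2) by blast
  then show "\<exists>k. x [^] (p ^ k) \<in> N" using pow_in_level[OF x] by blast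
qed

lemma torsion_free:
  assumes x: "x \<in> carrier G" and k: "x [^] (k::nat) = \<one>" "k \<noteq> 0"
  shows "x = \<one>"
proof -
  have "c n x = 0" for n
  proof -
    have "\<not> is_unit p" using prime by auto
    then obtain u where u: "k = p ^ multiplicity p k * u" "\<not> p dvd u"
      using multiplicity_decompose'[OF k(2)] by blast
    let ?v = "multiplicity p k"
    \<comment> \<open>Cancelling \<open>p ^ ?v\<close> costs \<open>?v\<close> digits, so coordinate
      \<open>n + ?v\<close> is examined in order to control coordinate \<open>n\<close>.\<close>
    have "int p ^ (n + ?v) dvd int k * c (n + ?v) x"
      using coord_pow[OF x, of "n + ?v" k] k(1) by (simp add: mod_eq_0_iff_dvd)
    also have "int k = int p ^ ?v * int u" by (subst u(1)) simp
    finally have "int p ^ ?v * int p ^ n dvd int p ^ ?v * (int u * c (n + ?v) x)"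
      by (simp add: power_add mult_ac)
    then have "int p ^ n dvd int u * c (n + ?v) x"
      using prime by (simp add: prime_gt_0_nat)
    moreover have "coprime (int p ^ n) (int u)"
      using u(2) prime by (simp add: prime_imp_coprime)
    ultimately have "int p ^ n dvd c (n + ?v) x" by (simp add: coprime_dvd_mult_right_iff)
    then show "c n x = 0" using coord_add[OF x, of n ?v] by simp
  qed
  then show ?thesis using eq_one_iff[OF x] by blast
qed

lemma not_openin_one: "\<not> openin T {\<one>}"
proof
  assume "openin T {\<one>}"
  then have fin: "finite (carrier G)" using finite_open_imp_finite_carrier[of "{\<one>}"] by simp
  obtain x where x: "x \<in> carrier G" "x \<noteq> \<one>" using nontrivial one_closed by blast
  have "order G \<noteq> 0" using fin order_gt_0_iff_finite by simp
  then show False using torsion_free[OF x(1) pow_order_eq_1[OF x(1)]] x(2) by blast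
qed

text \<open>If \<open>x \<in> C\<close> has valuation \<open>v\<close>, then modulo arbitrarily
  large powers of \<open>p\<close> each element of \<open>level v\<close> agrees with a power of
  \<open>x\<close>. Closedness of \<open>C\<close> turns this approximation into
  \<open>level v \<subseteq> C\<close>.\<close>

lemma nontrivial_closed_subgroup_open:
  assumes C: "subgroup C G" "closedin T C" "C \<noteq> {\<one>}"
  shows "openin T C"
proof -
  obtain x where x: "x \<in> C" "x \<noteq> \<one>" using C subgroup.one_closed by blast
  have xG: "x \<in> carrier G" using C(1) x(1) by (rule subgroup.mem_carrier)
  obtain n where n: "c n x \<noteq> 0" and least: "\<And>m. m < n \<Longrightarrow> c m x = 0"
    using x(2) eq_one_iff[OF xG] exists_least_iff[of "\<lambda>n. c n x \<noteq> 0"] by auto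
  \<comment> \<open>Coordinate 0 takes values in \<open>{0..<1}\<close>, so the first non-zero
    coordinate \<open>n\<close> has a predecessor \<open>v\<close>, the valuation of
    \<open>x\<close>.\<close>
  have "n \<noteq> 0" using coord_range[OF xG, of 0] n by (intro notI) simp
  then obtain v where v: "n = Suc v" using not0_implies_Suc by blast
  have "level v \<subseteq> C"
  proof
    fix y assume y: "y \<in> level v"
    then have yG: "y \<in> carrier G" by (simp add: level_def)
    show "y \<in> C"
    proof (rule ccontr)
      assume "y \<notin> C"
      then obtain N where N: "N \<lhd> G" "openin T N" "\<And>z. z \<in> N \<Longrightarrow> y \<otimes> z \<notin> C"
        using coset_avoiding_closed[OF C(2) yG] by blast
      have "\<one> \<in> N" using N(1) by (simp add: normal_imp_subgroup subgroup.one_closed)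
      then obtain m' where "level m' \<subseteq> N" using level_base N(2) by blast
      \<comment> \<open>With \<open>n \<le> m\<close>, coordinate \<open>m\<close> shows the exact
        valuation of \<open>x\<close>, so that \<open>u\<close> below is prime to
        \<open>p\<close>.\<close>
      define m where "m = max m' n"
      have m: "level m \<subseteq> N" "n \<le> m" "v \<le> m"
        using level_antimono[of m' m] \<open>level m' \<subseteq> N\<close> v by (auto simp: m_def)
      let ?P = "int p ^ m"
      have "int p ^ v dvd c m x" using coord_le[OF xG m(3)] least[of v] v by auto
      then obtain u where u: "c m x = int p ^ v * u" by blast
      have "int p ^ v dvd c m y" using coord_le[OF yG m(3)] y by (auto simp: level_def)
      then obtain w where w: "c m y = int p ^ v * w" by blast
      have "\<not> int p dvd u"
      proof
        assume "int p dvd u"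
        then have "int p ^ n dvd c m x" by (auto simp: u v)
        then show False using coord_le[OF xG m(2)] n by simp
      qed
      then have "coprime (int p) u" using prime by (simp add: prime_imp_coprime)
      then have "coprime ?P u" by simp
      then have "gcd u ?P = 1" by (metis coprime_imp_gcd_eq_1 gcd.commute)
      \<comment> \<open>\<open>a\<close> inverts \<open>u\<close> modulo \<open>p ^ m\<close>, so an
        exponent \<open>k\<close> congruent to \<open>a * w\<close> takes \<open>p ^ v * u\<close>
        to \<open>p ^ v * w\<close>.\<close>
      then obtain a b where ab: "a * u + b * ?P = 1" using bezout_int[of u ?P] by auto
      define k where "k = nat ((a * w) mod ?P)"
      have k: "int k = (a * w) mod ?P" using prime by (simp add: k_def prime_gt_0_nat)
      have "c m (x [^] k) = ((a * w) * (int p ^ v * u)) mod ?P"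
        by (simp add: coord_pow[OF xG] k u mod_mult_left_eq)
      also have "(a * w) * (int p ^ v * u) = int p ^ v * w * (a * u)" by (simp add: mult_ac)
      also have "\<dots> = int p ^ v * w * (1 - b * ?P)"
      proof -
        have "a * u = 1 - b * ?P" using ab by linarith
        then show ?thesis by (simp only:)
      qed
      also have "\<dots> = int p ^ v * w + (- (int p ^ v * w * b)) * ?P" by (simp add: algebra_simps)
      also have "\<dots> mod ?P = c m y"
        by (simp only: mod_mult_self1 w[symmetric] coord_mod[OF yG])
      finally have k_eq: "c m (x [^] k) = c m y" .
      let ?z = "inv y \<otimes> x [^] k"
      have "c m ?z = 0"
        using coord_mult[of "inv y" "x [^] k" m] coord_mult[of "inv y" y m] yG xG k_eq by simp
      then have "?z \<in> N" using m(1) xG yG by (auto simp: level_def)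
      moreover have "y \<otimes> ?z = x [^] k" using xG yG by (simp flip: m_assoc)
      moreover have "x [^] k \<in> C"
        using x(1) C(1) by (induction k) (auto simp: subgroup.one_closed subgroup.m_closed)
      ultimately show False using N(3) by metis
    qed
  qed
  then show ?thesis using openin_supergroup[OF C(1) subgroup_level openin_level] by blast
qed

end

text \<open>The coordinates are the components of the image under a chosen isomorphism. Compactness
  is transported from the compatible sequences, a closed subset of a product of finite discrete
  spaces.\<close>

lemma padic_coordinates_exist:
  fixes Z :: "('b, 'm) monoid_scheme"
  assumes "prime p" "topological_group Z T"
    and "topologically_isomorphic Z T (padic_int_group p) (padic_int_topology p)"
  shows "\<exists>c. padic_coordinates Z T p c"
proof -
  interpret topological_group Z T by fact
  let ?P = "padic_int_group p" and ?I = "\<lambda>n. integer_mod_group (p ^ n)"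
  let ?X = "product_topology (\<lambda>n. discrete_topology (carrier (?I n))) UNIV"
  obtain f where f: "f \<in> iso Z ?P" and hom: "homeomorphic_map T (padic_int_topology p) f"
    using assms(3) unfolding topologically_isomorphic_def by blast
  have p0: "p \<noteq> 0" using assms(1) by auto
  have carr: "carrier (?I n) = {0..<int p ^ n}" for n
    using p0 by (simp add: carrier_integer_mod_group)
  have carrP: "x \<in> carrier ?P \<longleftrightarrow> (\<forall>n. x n \<in> {0..<int p ^ n} \<and> x (Suc n) mod int p ^ n = x n)" for x
    by (auto simp: padic_int_group_def Let_def carr PiE_iff)
  have multP: "(x \<otimes>\<^bsub>?P\<^esub> y) n = (x n + y n) mod int p ^ n" for x y n
    by (simp add: padic_int_group_def Let_def)
  have fP: "f x \<in> carrier ?P" if "x \<in> carrier Z" for x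
    using f that by (auto simp: iso_def hom_def)
  have "topspace (padic_int_topology p) = carrier ?P"
  proof -
    have "carrier ?P \<subseteq> topspace ?X" by (auto simp: carrP carr PiE_iff)
    then show ?thesis by (auto simp: padic_int_topology_def)
  qed
  have coord_open: "openin ?X {x \<in> topspace ?X. x n = a}" for n a
    using openin_continuous_map_preimage[OF continuous_map_product_projection, of n UNIV "\<lambda>n. discrete_topology (carrier (?I n))" "{a} \<inter> carrier (?I n)"]
    by (auto simp: PiE_iff elim!: back_subst[of "openin ?X"])
  have "closedin ?X (carrier ?P)"
  proof -
    have "carrier ?P = topspace ?X \<inter> (\<Inter>n. {x \<in> topspace ?X. x (Suc n) mod int p ^ n = x n})"
      by (auto simp: carrP carr PiE_iff)
    moreover have "closedin ?X {x \<in> topspace ?X. x (Suc n) mod int p ^ n = x n}" for n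
    proof -
      \<comment> \<open>The complement is a union, over the incompatible pairs of values, of open
        sets prescribing two coordinates.\<close>
      have "topspace ?X - {x \<in> topspace ?X. x (Suc n) mod int p ^ n = x n} =
          (\<Union>(a, b)\<in>{(a, b). a mod int p ^ n \<noteq> b}. {x \<in> topspace ?X. x (Suc n) = a} \<inter> {x \<in> topspace ?X. x n = b})"
        by auto
      moreover have "openin ?X \<dots>"
        by (intro openin_Union) (auto simp del: topspace_product_topology intro!: openin_Int coord_open)
      ultimately have "openin ?X (topspace ?X - {x \<in> topspace ?X. x (Suc n) mod int p ^ n = x n})"
        by (simp only:)
      then show ?thesis unfolding closedin_def by blast
    qed
    ultimately show ?thesis
      by (simp only:) (intro closedin_Int closedin_topspace closedin_INT UNIV_not_empty)
  qed
  moreover have "compact_space ?X"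
    by (simp add: compact_space_product_topology compact_space_discrete_topology carr)
  ultimately have "compact_space (padic_int_topology p)"
    unfolding padic_int_topology_def by (metis closedin_compact_space compact_space_subtopology)
  then have comp: "compact_space T"
    using hom homeomorphic_compact_space homeomorphic_map_imp_homeomorphic_space by blast
  have cont: "continuous_map T (padic_int_topology p) f"
    using hom by (rule homeomorphic_imp_continuous_map)
  have "padic_coordinates Z T p (\<lambda>n x. f x n)"
  proof (intro padic_coordinates.intro padic_coordinates_axioms.intro)
    fix x y n a
    show "f x n \<in> {0..<int p ^ n}" "f x (Suc n) mod int p ^ n = f x n" if "x \<in> carrier Z"
      using fP[OF that] carrP by blast+
    show "f (x \<otimes>\<^bsub>Z\<^esub> y) n = (f x n + f y n) mod int p ^ n" if "x \<in> carrier Z" "y \<in> carrier Z"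
      using that f by (simp add: iso_def hom_def multP)
    show "x = y" if "x \<in> carrier Z" "y \<in> carrier Z" "\<And>n. f x n = f y n"
    proof -
      have "f x = f y" using that(3) by blast
      then show ?thesis using that f by (auto simp: iso_def bij_betw_def inj_on_def)
    qed
    have "openin (padic_int_topology p) {z \<in> carrier ?P. z n = a}"
    proof -
      have "{z \<in> carrier ?P. z n = a} = carrier ?P \<inter> {z \<in> topspace ?X. z n = a}"
        by (auto simp: carrP carr PiE_iff)
      then show ?thesis unfolding padic_int_topology_def using coord_open by (simp add: openin_subtopology_Int2)
    qed
    then have "openin T {x \<in> carrier Z. f x \<in> {z \<in> carrier ?P. z n = a}}"
      by (rule openin_preimage[OF cont])
    moreover have "{x \<in> carrier Z. f x \<in> {z \<in> carrier ?P. z n = a}} = {x \<in> carrier Z. f x n = a}"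
      using fP by blast
    ultimately show "openin T {x \<in> carrier Z. f x n = a}" by simp
    show "carrier Z \<noteq> {\<one>\<^bsub>Z\<^esub>}"
    proof
      assume "carrier Z = {\<one>\<^bsub>Z\<^esub>}"
      then have one: "carrier ?P = {f \<one>\<^bsub>Z\<^esub>}" using f by (auto simp: iso_def bij_betw_def)
      \<comment> \<open>The reductions of the integers 0 and 1 are two different points, as they
        differ modulo \<open>p\<close>.\<close>
      have "int p ^ n > 0" "int p ^ n dvd int p ^ Suc n" for n using p0 by auto
      then have "(\<lambda>n. a mod int p ^ n) \<in> carrier ?P" for a
        by (simp add: carrP mod_mod_cancel del: power_Suc)
      then have "(\<lambda>n. 0 mod int p ^ n) = (\<lambda>n. 1 mod int p ^ n)" using one by (metis singletonD)
      then have "0 mod int p ^ 1 = 1 mod int p ^ 1" by (rule fun_cong)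
      then show False using prime_gt_1_nat[OF assms(1)] by simp
    qed
  qed (fact assms comp)+
  then show ?thesis by blast
qed

section \<open>Non-abelian just-infinite pro-p groups\<close>

text \<open>Commutativity makes the product of the finite subgroup found so far and the finite
  cyclic group generated by \<open>x\<close> a subgroup, and it is again finite.\<close>

lemma (in comm_group) finite_subgroup_containing_torsion:
  assumes "finite S" "S \<subseteq> carrier G" "\<And>y. y \<in> S \<Longrightarrow> \<exists>n::nat. n \<noteq> 0 \<and> y [^] n = \<one>"
  shows "\<exists>F. subgroup F G \<and> finite F \<and> S \<subseteq> F"
  using assms
proof (induction S rule: finite_induct)
  case empty
  then show ?case using triv_subgroup by blast
next
  case (insert x S)
  then obtain F where F: "subgroup F G" "finite F" "S \<subseteq> F" by blast
  have x: "x \<in> carrier G" using insert.prems by simp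
  let ?C = "generate G {x}"
  have sC: "subgroup ?C G" using generate_is_subgroup[of "{x}"] x by simp
  have "finite (carrier (subgroup_generated G {x}))"
    using insert.prems(2)[of x] finite_cyclic_subgroup[OF x] by simp
  then have fC: "finite ?C" using x by (simp add: carrier_subgroup_generated)
  have "F <#> ?C = (\<lambda>(a, b). a \<otimes> b) ` (F \<times> ?C)" by (auto simp: set_mult_def)
  then have "finite (F <#> ?C)" using F(2) fC by simp
  moreover have "insert x S \<subseteq> F <#> ?C"
  proof
    fix y assume y: "y \<in> insert x S"
    then have yG: "y \<in> carrier G" using insert.prems by auto
    have "y = y \<otimes> \<one>" "y = \<one> \<otimes> y" using yG by simp_all
    moreover have "\<one> \<in> F" "\<one> \<in> ?C" "x \<in> ?C"
      using F(1) sC by (auto simp: subgroup.one_closed generate.incl)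
    moreover have "y = x \<or> y \<in> F" using y F(3) by blast
    ultimately show "y \<in> F <#> ?C" unfolding set_mult_def by blast
  qed
  ultimately show ?case using mult_subgroups[OF F(1) sC] by blast
qed

section \<open>Closed subgroups generated by a set\<close>

context topological_group
begin

text \<open>An intersection of closed subgroups makes minimality immediate, without passing through
  the closure of an abstractly generated subgroup.\<close>

definition closed_generate :: "'a set \<Rightarrow> 'a set" where
  "closed_generate S = \<Inter>{C. subgroup C G \<and> closedin T C \<and> S \<subseteq> C}"

lemma closed_generate_le: "subgroup C G \<Longrightarrow> closedin T C \<Longrightarrow> S \<subseteq> C \<Longrightarrow> closed_generate S \<subseteq> C"
  by (auto simp: closed_generate_def)

lemma closed_generate_incl: "S \<subseteq> closed_generate S"
  by (auto simp: closed_generate_def)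

lemma
  assumes "S \<subseteq> carrier G"
  shows subgroup_closed_generate: "subgroup (closed_generate S) G"
    and closedin_closed_generate: "closedin T (closed_generate S)"
proof -
  have ne: "carrier G \<in> {C. subgroup C G \<and> closedin T C \<and> S \<subseteq> C}"
    using assms subgroup_self closedin_carrier by simp
  show "subgroup (closed_generate S) G"
    unfolding closed_generate_def by (rule subgroups_Inter) (use ne in auto)
  show "closedin T (closed_generate S)"
    unfolding closed_generate_def by (rule closedin_Inter) (use ne in auto)
qed

text \<open>The elements that \<open>g\<close> conjugates into the closed subgroup generated by
  \<open>S\<close> form a closed subgroup containing \<open>S\<close>, hence contain that whole
  subgroup.\<close>

lemma normal_closed_generate:
  assumes S: "S \<subseteq> carrier G" and conj: "\<And>g s. g \<in> carrier G \<Longrightarrow> s \<in> S \<Longrightarrow> g \<otimes> s \<otimes> inv g \<in> S"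
  shows "closed_generate S \<lhd> G"
proof (rule normal_invI[OF subgroup_closed_generate[OF S]])
  fix g h assume g: "g \<in> carrier G" and h: "h \<in> closed_generate S"
  let ?R = "closed_generate S" and ?D = "{x \<in> carrier G. g \<otimes> x \<otimes> inv g \<in> closed_generate S}"
  have sR: "subgroup ?R G" using subgroup_closed_generate[OF S] .
  have "closedin T ?D"
    using continuous_map_mult_ops[OF continuous_map_left_translation[OF g] continuous_map_const_op[of "inv g"]] g
      closedin_preimage[OF _ closedin_closed_generate[OF S]] by simp
  moreover have "subgroup ?D G"
  proof (rule subgroupI)
    show "?D \<noteq> {}" using g subgroup.one_closed[OF sR] by (auto intro!: exI[of _ \<one>])
    fix x y assume x: "x \<in> ?D" and y: "y \<in> ?D"
    have "(g \<otimes> x \<otimes> inv g) \<otimes> (g \<otimes> y \<otimes> inv g) \<in> ?R" using x y sR by (auto intro: subgroup.m_closed)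
    moreover have "(g \<otimes> x \<otimes> inv g) \<otimes> (g \<otimes> y \<otimes> inv g) = g \<otimes> (x \<otimes> y) \<otimes> inv g"
      using x y g by (simp add: m_assoc) (simp flip: m_assoc)
    ultimately show "x \<otimes> y \<in> ?D" using x y by simp
    have "inv (g \<otimes> x \<otimes> inv g) \<in> ?R" using x sR by (auto intro: subgroup.m_inv_closed)
    then show "inv x \<in> ?D" using x g by (simp add: inv_mult_group m_assoc)
  qed auto
  moreover have "S \<subseteq> ?D"
    using S conj[OF g] closed_generate_incl[of S] by auto
  ultimately have "?R \<subseteq> ?D" by (intro closed_generate_le)
  then show "g \<otimes> h \<otimes> inv g \<in> ?R" using h by blast
qed

end

lemma (in group) conj_commutator:
  assumes "g \<in> carrier G" "x \<in> carrier G" "y \<in> carrier G"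
  shows "g \<otimes> (x \<otimes> y \<otimes> inv x \<otimes> inv y) \<otimes> inv g =
    (g \<otimes> x \<otimes> inv g) \<otimes> (g \<otimes> y \<otimes> inv g) \<otimes> inv (g \<otimes> x \<otimes> inv g) \<otimes> inv (g \<otimes> y \<otimes> inv g)"
  using assms by (simp add: m_assoc inv_mult_group inv_solve_left flip: m_assoc[of "inv g" g])

lemma (in group) conj_pow:
  assumes "g \<in> carrier G" "x \<in> carrier G"
  shows "g \<otimes> x [^] (n::nat) \<otimes> inv g = (g \<otimes> x \<otimes> inv g) [^] n"
proof (induction n)
  case (Suc n)
  have "g \<otimes> x [^] Suc n \<otimes> inv g = (g \<otimes> x [^] n \<otimes> inv g) \<otimes> (g \<otimes> x \<otimes> inv g)"
    using assms by (simp add: m_assoc inv_solve_left flip: m_assoc[of "inv g" g])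
  then show ?case using Suc by simp
qed (use assms in simp)

lemma (in group) commutator_eq_one_iff:
  assumes "x \<in> carrier G" "y \<in> carrier G"
  shows "x \<otimes> y \<otimes> inv x \<otimes> inv y = \<one> \<longleftrightarrow> x \<otimes> y = y \<otimes> x"
proof -
  have "x \<otimes> y \<otimes> inv x \<otimes> inv y = (x \<otimes> y) \<otimes> inv (y \<otimes> x)"
    using assms by (simp add: m_assoc inv_mult_group)
  then show ?thesis using assms by (metis inv_closed inv_equality inv_inv m_closed r_inv)
qed

section \<open>Torsion, centre, Frattini subgroups and countability in \<open>H\<close>\<close>

locale nonabelian_just_infinite_pro_p_group = pro_p_group +
  assumes prime: "prime p"
    and infinite_carrier: "infinite (carrier G)"
    and closed_normal_open: "N \<lhd> G \<Longrightarrow> closedin T N \<Longrightarrow> N \<noteq> {\<one>} \<Longrightarrow> openin T N"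
    and nonabelian: "\<not> comm_group G"
begin

lemma not_openin_finite: "finite U \<Longrightarrow> openin T U \<Longrightarrow> \<one> \<notin> U"
  using finite_open_imp_finite_carrier infinite_carrier by blast

text \<open>A finite intersection of open subgroups is an open neighbourhood of
  \<open>\<one>\<close>, which is infinite here. Families of open subgroups are thus counted through
  their intersection.\<close>

lemma infinite_if_finite_Inter:
  assumes "\<And>V. V \<in> \<V> \<Longrightarrow> subgroup V G \<and> openin T V" and "finite (carrier G \<inter> \<Inter>\<V>)"
  shows "infinite \<V>"
proof
  assume "finite \<V>"
  then have "openin T (\<Inter>(insert (carrier G) \<V>))"
    using assms(1) openin_carrier by (intro openin_Inter) auto
  moreover have "\<one> \<in> \<Inter>(insert (carrier G) \<V>)"
    using assms(1) subgroup.one_closed by fastforce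
  ultimately show False using assms(2) not_openin_finite[of "\<Inter>(insert (carrier G) \<V>)"] by simp
qed

lemma infinite_open_normal: "infinite {U. U \<lhd> G \<and> openin T U}"
proof (rule infinite_if_finite_Inter)
  have "carrier G \<inter> \<Inter>{U. U \<lhd> G \<and> openin T U} \<subseteq> {\<one>}" using open_normal_avoiding by blast
  then show "finite (carrier G \<inter> \<Inter>{U. U \<lhd> G \<and> openin T U})" using finite_subset by blast
qed (simp add: normal_imp_subgroup)

lemma pow_mem_open_subgroup:
  assumes "subgroup U G" "openin T U" "x \<in> carrier G"
  obtains n :: nat where "n \<noteq> 0" "x [^] n \<in> U"
proof -
  obtain N where N: "N \<lhd> G" "openin T N" "N \<subseteq> U"
    using open_normal_base[OF assms(2) subgroup.one_closed[OF assms(1)]] .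
  then obtain k where "x [^] (p ^ k) \<in> U" using pow_mem_open_normal assms(3) by blast
  moreover have "p ^ k \<noteq> 0" using prime by auto
  ultimately show thesis using that by blast
qed

text \<open>A torsion element of \<open>A\<close> has finitely many conjugates, since its
  conjugation orbit factors through the finite set of cosets of \<open>A\<close>. In the abelian
  group \<open>A\<close> they generate a finite subgroup, which is normal and closed but too small
  to be open.\<close>

lemma open_normal_abelian_torsion_free:
  assumes A: "A \<lhd> G" "openin T A" and comm: "\<And>a b. a \<in> A \<Longrightarrow> b \<in> A \<Longrightarrow> a \<otimes> b = b \<otimes> a"
    and x: "x \<in> A" "x [^] (n::nat) = \<one>" "n \<noteq> 0"
  shows "x = \<one>"
proof (rule ccontr)
  assume "x \<noteq> \<one>"
  interpret A: normal A G by (rule A(1))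
  have AG: "A \<subseteq> carrier G" by (rule A.subset)
  then have xG: "x \<in> carrier G" using x by blast
  let ?H = "G\<lparr>carrier := A\<rparr>"
  have "group ?H" using A.subgroup_axioms by (rule subgroup_imp_group)
  then interpret AA: comm_group ?H
    by (rule group.group_comm_groupI) (use comm in simp)
  let ?S = "(\<lambda>g. g \<otimes> x \<otimes> inv g) ` carrier G"
  have SA: "?S \<subseteq> A" using A.inv_op_closed2 x(1) by auto
  \<comment> \<open>All elements of one coset of \<open>A\<close> conjugate \<open>x\<close> to the
    same element because \<open>A\<close> is abelian, so one representative per coset is
    enough.\<close>
  have "?S \<subseteq> (\<lambda>X. (SOME g. g \<in> X) \<otimes> x \<otimes> inv (SOME g. g \<in> X)) ` (rcosets A)"
  proof
    fix y assume "y \<in> ?S"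
    then obtain g where g: "g \<in> carrier G" "y = g \<otimes> x \<otimes> inv g" by blast
    let ?g = "SOME h. h \<in> A #> g"
    have "?g \<in> A #> g" using rcos_self[OF g(1) A.subgroup_axioms] by (rule someI)
    then obtain a where a: "a \<in> A" "?g = a \<otimes> g" by (auto simp: r_coset_def)
    have aG: "a \<in> carrier G" using a AG by blast
    have "y \<in> A" using \<open>y \<in> ?S\<close> SA by blast
    then have yG: "y \<in> carrier G" using AG by blast
    have "?g \<otimes> x \<otimes> inv ?g = a \<otimes> y \<otimes> inv a"
      using g a(2) aG xG by (simp add: m_assoc inv_mult_group)
    also have "\<dots> = y"
      unfolding comm[OF a(1) \<open>y \<in> A\<close>] using aG yG by (simp add: m_assoc)
    finally have "y = ?g \<otimes> x \<otimes> inv ?g" by (rule sym)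
    then show "y \<in> (\<lambda>X. (SOME g. g \<in> X) \<otimes> x \<otimes> inv (SOME g. g \<in> X)) ` (rcosets A)"
      using rcosetsI[OF AG g(1)] by (rule image_eqI)
  qed
  then have fS: "finite ?S"
    using finite_rcosets_open_subgroup[OF compact A.subgroup_axioms A(2)] finite_surj by blast
  have "\<exists>F. subgroup F ?H \<and> finite F \<and> ?S \<subseteq> F"
  proof (rule AA.finite_subgroup_containing_torsion[OF fS])
    show "?S \<subseteq> carrier ?H" using SA by simp
    fix y assume "y \<in> ?S"
    then obtain g where g: "g \<in> carrier G" "y = g \<otimes> x \<otimes> inv g" by blast
    have "y [^] n = \<one>" using g conj_pow[OF g(1) xG, of n] x(2) by simp
    then show "\<exists>n::nat. n \<noteq> 0 \<and> y [^]\<^bsub>?H\<^esub> n = \<one>\<^bsub>?H\<^esub>"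
      using x(3) by (auto simp flip: nat_pow_consistent)
  qed
  then obtain F where F: "subgroup F ?H" "finite F" "?S \<subseteq> F" by blast
  have "subgroup F G" using incl_subgroup[OF A.subgroup_axioms F(1)] .
  \<comment> \<open>\<open>F\<close> need not be normal; it only bounds the subgroup generated by
    all conjugates, which is.\<close>
  then have "generate G ?S \<subseteq> F" using generate_subgroup_incl[OF F(3)] by simp
  then have fin: "finite (generate G ?S)" using F(2) finite_subset by blast
  have nrm: "generate G ?S \<lhd> G"
  proof (rule normal_generateI)
    show "?S \<subseteq> carrier G" using SA AG by blast
    fix h g assume "h \<in> ?S" and g: "g \<in> carrier G"
    then obtain k where k: "k \<in> carrier G" "h = k \<otimes> x \<otimes> inv k" by blast
    then have "g \<otimes> h \<otimes> inv g = (g \<otimes> k) \<otimes> x \<otimes> inv (g \<otimes> k)"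
      using g xG by (simp add: m_assoc inv_mult_group)
    then show "g \<otimes> h \<otimes> inv g \<in> ?S" using g k(1) by blast
  qed
  have sub: "subgroup (generate G ?S) G" using nrm by (rule normal_imp_subgroup)
  have "closedin T (generate G ?S)"
    by (rule closedin_Hausdorff_finite[OF Hausdorff _ fin])
      (use subgroup.subset[OF sub] in \<open>simp add: topspace_eq_carrier\<close>)
  moreover have "x \<in> generate G ?S"
  proof (rule generate.incl)
    have "x = \<one> \<otimes> x \<otimes> inv \<one>" using xG by simp
    then show "x \<in> ?S" by blast
  qed
  then have "generate G ?S \<noteq> {\<one>}" using \<open>x \<noteq> \<one>\<close> by blast
  ultimately have "openin T (generate G ?S)" using closed_normal_open nrm by blast
  then show False using not_openin_finite[OF fin] subgroup.one_closed[OF sub] by blast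
qed

lemma open_subgroup_nontrivial: "openin T U \<Longrightarrow> U \<noteq> {\<one>}"
  using not_openin_finite[of "{\<one>}"] by auto

text \<open>If \<open>A\<close> were central, the centre would be torsion-free of finite index; but an element that
  is central modulo the centre has commutators that are torsion elements of the centre.\<close>

lemma open_normal_not_central:
  assumes A: "A \<lhd> G" "openin T A"
  obtains a g where "a \<in> A" "g \<in> carrier G" "a \<otimes> g \<noteq> g \<otimes> a"
proof (rule ccontr)
  assume "\<not> thesis"
  then have central: "\<And>a g. a \<in> A \<Longrightarrow> g \<in> carrier G \<Longrightarrow> a \<otimes> g = g \<otimes> a" using that by blast
  define Z where "Z = {x \<in> carrier G. \<forall>y\<in>carrier G. x \<otimes> y = y \<otimes> x}"
  have sZ: "subgroup Z G" unfolding Z_def by (rule subgroup_centralizer) simp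
  have sA: "subgroup A G" using A(1) by (rule normal_imp_subgroup)
  have "A \<subseteq> Z" using central subgroup.mem_carrier[OF sA] by (auto simp: Z_def)
  then have oZ: "openin T Z" using openin_supergroup[OF sZ sA A(2)] by blast
  have ZG: "x \<in> carrier G" and commZ: "y \<in> carrier G \<Longrightarrow> x \<otimes> y = y \<otimes> x" if "x \<in> Z" for x y
    using that unfolding Z_def by blast+
  have nZ: "Z \<lhd> G"
  proof (rule normal_invI[OF sZ])
    fix x h assume "x \<in> carrier G" "h \<in> Z"
    then have "x \<otimes> h \<otimes> inv x = h"
      using commZ[of h x] ZG[of h] by (simp add: inv_solve_right')
    then show "x \<otimes> h \<otimes> inv x \<in> Z" using \<open>h \<in> Z\<close> by simp
  qed
  have "Z \<noteq> carrier G"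
  proof
    assume "Z = carrier G"
    then have "comm_group G" by (intro group_comm_groupI commZ) simp_all
    then show False using nonabelian by simp
  qed
  then obtain t where t: "t \<in> carrier G" "t \<notin> Z"
    and tZ: "\<And>g. g \<in> carrier G \<Longrightarrow> g \<otimes> t \<otimes> inv g \<otimes> inv t \<in> Z"
    using central_mod_open_normal[OF prime nZ oZ] by blast
  obtain n :: nat where n: "n \<noteq> 0" "t [^] n \<in> Z" using pow_mem_open_subgroup[OF sZ oZ t(1)] .
  have "t \<otimes> g = g \<otimes> t" if g: "g \<in> carrier G" for g
  proof -
    define c where "c = g \<otimes> t \<otimes> inv g \<otimes> inv t"
    have c: "c \<in> Z" "c \<in> carrier G" using tZ[OF g] g t by (auto simp: c_def)
    have ct: "g \<otimes> t \<otimes> inv g = c \<otimes> t" using g t by (simp add: c_def m_assoc)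
    have "c \<otimes> t = t \<otimes> c" using c(1) t(1) by (rule commZ)
    \<comment> \<open>\<open>c \<otimes> t\<close> is a conjugate of \<open>t\<close>. Its n-th
      power is \<open>c [^] n \<otimes> t [^] n\<close> because \<open>c\<close> is central, and
      \<open>t [^] n\<close> because that power is central; hence
      \<open>c [^] n = \<one>\<close>.\<close>
    then have "(c \<otimes> t) [^] n = c [^] n \<otimes> t [^] n"
      using pow_mult_distrib c(2) t(1) by blast
    moreover have "(c \<otimes> t) [^] n = g \<otimes> t [^] n \<otimes> inv g"
      using conj_pow[OF g t(1), of n] ct by simp
    moreover have "g \<otimes> t [^] n \<otimes> inv g = t [^] n"
    proof -
      have "t [^] n \<otimes> g = g \<otimes> t [^] n" using n(2) g by (rule commZ)
      then show ?thesis using g t(1) by (simp add: inv_solve_right')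
    qed
    ultimately have "c [^] n = \<one>" using c(2) t(1) by (simp add: eq_commute[of "t [^] n"])
    then have "c = \<one>"
      using open_normal_abelian_torsion_free[OF nZ oZ commZ[OF _ ZG] c(1) _ n(1)] by blast
    then show ?thesis using ct g t(1) by (simp add: inv_solve_right')
  qed
  then show False using t unfolding Z_def by blast
qed

text \<open>\<open>R\<close> is the closed subgroup generated by the p-th powers and commutators of
  \<open>U\<close>; normality of \<open>U\<close> makes it normal in \<open>G\<close>. Were it
  trivial, \<open>U\<close> would be elementary abelian, against torsion-freeness. The last clause
  is minimality, in the form that allows comparison with Frattini subgroups of larger
  groups.\<close>

lemma frattini_open:
  assumes U: "U \<lhd> G" "openin T U"
  obtains R where "R \<lhd> G" "openin T R"
    "\<And>C. subgroup C G \<Longrightarrow> closedin T C \<Longrightarrow> (\<And>x. x \<in> U \<Longrightarrow> x [^] p \<in> C) \<Longrightarrow>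
      (\<And>x y. x \<in> U \<Longrightarrow> y \<in> U \<Longrightarrow> x \<otimes> y \<otimes> inv x \<otimes> inv y \<in> C) \<Longrightarrow> R \<subseteq> C"
proof -
  interpret U: normal U G by (rule U(1))
  define S where "S = (\<lambda>x. x [^] p) ` U \<union> (\<lambda>(x, y). x \<otimes> y \<otimes> inv x \<otimes> inv y) ` (U \<times> U)"
  have SG: "S \<subseteq> carrier G" using U.subset by (auto simp: S_def subset_iff)
  have nR: "closed_generate S \<lhd> G"
  proof (rule normal_closed_generate[OF SG])
    fix g s assume g: "g \<in> carrier G" and "s \<in> S"
    then consider x where "x \<in> U" "s = x [^] p" | x y where "x \<in> U" "y \<in> U" "s = x \<otimes> y \<otimes> inv x \<otimes> inv y"
      by (auto simp: S_def)
    then show "g \<otimes> s \<otimes> inv g \<in> S"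
    proof cases
      case 1
      then have "g \<otimes> s \<otimes> inv g = (g \<otimes> x \<otimes> inv g) [^] p"
        using conj_pow g U.subset by blast
      moreover have "g \<otimes> x \<otimes> inv g \<in> U" using U.inv_op_closed2[OF g] 1(1) .
      ultimately show ?thesis by (simp add: S_def)
    next
      case 2
      then have "g \<otimes> s \<otimes> inv g = (\<lambda>(x, y). x \<otimes> y \<otimes> inv x \<otimes> inv y) (g \<otimes> x \<otimes> inv g, g \<otimes> y \<otimes> inv g)"
        using conj_commutator[OF g, of x y] U.subset by auto
      moreover have "(g \<otimes> x \<otimes> inv g, g \<otimes> y \<otimes> inv g) \<in> U \<times> U"
        using U.inv_op_closed2[OF g] 2(1,2) by simp
      ultimately show ?thesis unfolding S_def by blast
    qed
  qed
  have "closed_generate S \<noteq> {\<one>}"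
  proof
    assume "closed_generate S = {\<one>}"
    then have S1: "S \<subseteq> {\<one>}" using closed_generate_incl[of S] by simp
    have pw: "x [^] p = \<one>" if "x \<in> U" for x
      using S1 that by (auto simp: S_def)
    have "x \<otimes> y \<otimes> inv x \<otimes> inv y = \<one>" if "x \<in> U" "y \<in> U" for x y
      using S1 that by (force simp: S_def)
    then have "x \<otimes> y = y \<otimes> x" if "x \<in> U" "y \<in> U" for x y
      using that commutator_eq_one_iff U.subset by blast
    moreover have "p \<noteq> 0" using prime by auto
    ultimately have "x = \<one>" if "x \<in> U" for x
      using open_normal_abelian_torsion_free[OF U _ that pw[OF that]] by blast
    then have "U = {\<one>}" using U.one_closed by blast
    then show False using open_subgroup_nontrivial[OF U(2)] by simp
  qed
  then have "openin T (closed_generate S)"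
    using closed_normal_open[OF nR] closedin_closed_generate[OF SG] by blast
  moreover have "closed_generate S \<subseteq> C"
    if "subgroup C G" "closedin T C" "\<And>x. x \<in> U \<Longrightarrow> x [^] p \<in> C"
      "\<And>x y. x \<in> U \<Longrightarrow> y \<in> U \<Longrightarrow> x \<otimes> y \<otimes> inv x \<otimes> inv y \<in> C" for C
    using that by (intro closed_generate_le) (auto simp: S_def)
  ultimately show thesis using that nR by blast
qed

text \<open>Once a countable family \<open>\<C>\<close> of open normal subgroups meets in
  \<open>{\<one>}\<close>, compactness puts a finite intersection of its members inside any given
  open subgroup. There are countably many such intersections, each with finitely many
  supergroups.\<close>

lemma countable_open_subgroups_just_infinite: "countable {U. subgroup U G \<and> openin T U}"
proof -
  obtain \<C> where \<C>: "\<C> \<subseteq> {U. U \<lhd> G \<and> openin T U}" "countable \<C>" "infinite \<C>"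
    using infinite_countable_subset'[OF infinite_open_normal] by blast
  have sub: "subgroup U G" "openin T U" "closedin T U" if "U \<in> \<C>" for U
    using that \<C>(1) normal_imp_subgroup closedin_open_subgroup by blast+
  define M where "M = carrier G \<inter> \<Inter>\<C>"
  have "\<C> \<noteq> {}" using \<C>(3) by auto
  then have M_eq: "M = \<Inter>\<C>" using sub(1) subgroup.subset by (fastforce simp: M_def)
  have sM: "subgroup M G" unfolding M_eq by (rule subgroups_Inter) (use sub \<open>\<C> \<noteq> {}\<close> in auto)
  have "x \<otimes> m \<otimes> inv x \<in> M" if "x \<in> carrier G" "m \<in> M" for x m
    unfolding M_eq
  proof (rule InterI)
    fix U assume "U \<in> \<C>"
    then have "U \<lhd> G" "m \<in> U" using \<C>(1) that(2) by (auto simp: M_eq)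
    then show "x \<otimes> m \<otimes> inv x \<in> U" using that(1) by (simp add: normal.inv_op_closed2)
  qed
  then have nM: "M \<lhd> G" by (rule normal_invI[OF sM])
  have cM: "closedin T M" unfolding M_eq by (rule closedin_Inter) (use sub \<open>\<C> \<noteq> {}\<close> in auto)
  \<comment> \<open>An open \<open>M\<close> would have finitely many supergroups, but every member
    of the infinite family \<open>\<C>\<close> is one.\<close>
  have "\<not> openin T M"
  proof
    assume "openin T M"
    then have "finite {K. subgroup K G \<and> M \<subseteq> K}" using finite_supergroups[OF compact sM] by blast
    moreover have "\<C> \<subseteq> {K. subgroup K G \<and> M \<subseteq> K}" using sub(1) by (auto simp: M_eq)
    ultimately show False using \<C>(3) finite_subset by blast
  qed
  then have M1: "M = {\<one>}" using closed_normal_open nM cM by blast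
  let ?\<B> = "(\<lambda>\<F>. carrier G \<inter> \<Inter>\<F>) ` {\<F>. finite \<F> \<and> \<F> \<subseteq> \<C>}"
  show ?thesis
  proof (rule countable_open_subgroups[OF compact, of ?\<B>])
    show "countable ?\<B>" using countable_Collect_finite_subset[OF \<C>(2)] by (rule countable_image)
    show "subgroup B G \<and> openin T B" if "B \<in> ?\<B>" for B
    proof -
      obtain \<F> where \<F>: "finite \<F>" "\<F> \<subseteq> \<C>" "B = carrier G \<inter> \<Inter>\<F>" using \<open>B \<in> ?\<B>\<close> by blast
      then have B: "B = \<Inter>(insert (carrier G) \<F>)" by simp
      have "subgroup B G" unfolding B by (rule subgroups_Inter) (use sub \<F>(2) subgroup_self in auto)
      moreover have "openin T B"
        unfolding B by (rule openin_Inter) (use sub \<F>(1,2) openin_carrier in auto)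
      ultimately show ?thesis by blast
    qed
    show "\<exists>B\<in>?\<B>. B \<subseteq> U" if U: "subgroup U G" "openin T U" for U
    proof -
      have "topspace T \<inter> \<Inter>\<C> \<subseteq> U"
        using M1 subgroup.one_closed[OF U(1)] by (auto simp: M_def topspace_eq_carrier)
      then obtain \<F> where "finite \<F>" "\<F> \<subseteq> \<C>" "topspace T \<inter> \<Inter>\<F> \<subseteq> U"
        using compact_space_finite_Inter_subset[OF compact U(2)] sub(3) by metis
      then show ?thesis by (auto simp: topspace_eq_carrier)
    qed
  qed
qed

end

section \<open>Closed commutator subgroups and finite abelianisations\<close>

context topological_group
begin

text \<open>In a profinite group and for open \<open>V\<close>, openness of this closed derived
  subgroup says that the topological abelianisation of \<open>V\<close> is finite.\<close>

definition commutator_closure :: "'a set \<Rightarrow> 'a set" where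
  "commutator_closure V = closed_generate ((\<lambda>(x, y). x \<otimes> y \<otimes> inv x \<otimes> inv y) ` (V \<times> V))"

lemma commutators_subset:
  assumes "subgroup V G"
  shows "(\<lambda>(x, y). x \<otimes> y \<otimes> inv x \<otimes> inv y) ` (V \<times> V) \<subseteq> V"
  using assms by (auto simp: subgroup.m_closed subgroup.m_inv_closed)

lemma commutator_mem_commutator_closure:
  "x \<in> V \<Longrightarrow> y \<in> V \<Longrightarrow> x \<otimes> y \<otimes> inv x \<otimes> inv y \<in> commutator_closure V"
  unfolding commutator_closure_def by (rule subsetD[OF closed_generate_incl]) force

lemma commutator_closure_le:
  assumes "subgroup C G" "closedin T C" "\<And>x y. x \<in> V \<Longrightarrow> y \<in> V \<Longrightarrow> x \<otimes> y \<otimes> inv x \<otimes> inv y \<in> C"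
  shows "commutator_closure V \<subseteq> C"
  unfolding commutator_closure_def by (rule closed_generate_le) (use assms in auto)

lemma
  assumes "subgroup V G"
  shows subgroup_commutator_closure: "subgroup (commutator_closure V) G"
    and closedin_commutator_closure: "closedin T (commutator_closure V)"
  using commutators_subset[OF assms] subgroup.subset[OF assms]
    subgroup_closed_generate closedin_closed_generate
  unfolding commutator_closure_def by (meson order_trans)+

lemma normal_commutator_closure:
  assumes "V \<lhd> G"
  shows "commutator_closure V \<lhd> G"
proof -
  interpret V: normal V G by (rule assms)
  show ?thesis
    unfolding commutator_closure_def
  proof (rule normal_closed_generate)
    show "(\<lambda>(x, y). x \<otimes> y \<otimes> inv x \<otimes> inv y) ` (V \<times> V) \<subseteq> carrier G"
      using commutators_subset[OF V.subgroup_axioms] V.subset by (rule order_trans)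
    fix g s assume g: "g \<in> carrier G" and "s \<in> (\<lambda>(x, y). x \<otimes> y \<otimes> inv x \<otimes> inv y) ` (V \<times> V)"
    then obtain x y where xy: "x \<in> V" "y \<in> V" "s = x \<otimes> y \<otimes> inv x \<otimes> inv y" by auto
    then have "g \<otimes> s \<otimes> inv g = (\<lambda>(x, y). x \<otimes> y \<otimes> inv x \<otimes> inv y) (g \<otimes> x \<otimes> inv g, g \<otimes> y \<otimes> inv g)"
      using conj_commutator[OF g, of x y] V.subset by auto
    moreover have "(g \<otimes> x \<otimes> inv g, g \<otimes> y \<otimes> inv g) \<in> V \<times> V"
      using V.inv_op_closed2[OF g] xy(1,2) by simp
    ultimately show "g \<otimes> s \<otimes> inv g \<in> (\<lambda>(x, y). x \<otimes> y \<otimes> inv x \<otimes> inv y) ` (V \<times> V)" by blast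
  qed
qed

end

text \<open>Commutation with \<open>t\<close> is an endomorphism of the abelian group
  \<open>A\<close>, namely t - 1 in module notation. So its values form a subgroup and it commutes
  with taking powers.\<close>

lemma (in group) commutator_mult_abelian_normal:
  assumes A: "A \<lhd> G" and comm: "\<And>a b. a \<in> A \<Longrightarrow> b \<in> A \<Longrightarrow> a \<otimes> b = b \<otimes> a"
    and t: "t \<in> carrier G" and ab: "a \<in> A" "b \<in> A"
  shows "t \<otimes> (a \<otimes> b) \<otimes> inv t \<otimes> inv (a \<otimes> b) = (t \<otimes> a \<otimes> inv t \<otimes> inv a) \<otimes> (t \<otimes> b \<otimes> inv t \<otimes> inv b)"
proof -
  interpret A: normal A G by (rule A)
  have c: "a \<in> carrier G" "b \<in> carrier G" using ab A.subset by auto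
  define u v where "u = t \<otimes> a \<otimes> inv t" and "v = t \<otimes> b \<otimes> inv t"
  have uv: "u \<in> A" "v \<in> A" using A.inv_op_closed2[OF t] ab by (auto simp: u_def v_def)
  then have uvc: "u \<in> carrier G" "v \<in> carrier G" using A.subset by auto
  have "t \<otimes> (a \<otimes> b) \<otimes> inv t = u \<otimes> v"
    using c t by (simp add: u_def v_def m_assoc inv_solve_left flip: m_assoc[of "inv t" t])
  then have "t \<otimes> (a \<otimes> b) \<otimes> inv t \<otimes> inv (a \<otimes> b) = u \<otimes> (v \<otimes> inv b) \<otimes> inv a"
    using c uvc by (simp add: inv_mult_group m_assoc)
  also have "\<dots> = u \<otimes> (inv a \<otimes> (v \<otimes> inv b))"
    using comm[of "v \<otimes> inv b" "inv a"] uv ab c uvc by (simp add: m_assoc)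
  also have "\<dots> = (u \<otimes> inv a) \<otimes> (v \<otimes> inv b)" using c uvc by (simp add: m_assoc)
  finally show ?thesis by (simp add: u_def v_def)
qed

context nonabelian_just_infinite_pro_p_group
begin

text \<open>The conjugation action on \<open>A\<close> of an element that is central modulo the centraliser of \<open>A\<close>
  has no non-trivial fixed points, because the fixed points form a closed normal subgroup and
  \<open>A\<close> is torsion-free.\<close>

lemma exists_fixed_point_free_element:
  assumes A: "A \<lhd> G" "openin T A" and comm: "\<And>a b. a \<in> A \<Longrightarrow> b \<in> A \<Longrightarrow> a \<otimes> b = b \<otimes> a"
  obtains t where "t \<in> carrier G"
    "\<And>g a. g \<in> carrier G \<Longrightarrow> a \<in> A \<Longrightarrow>
      (g \<otimes> t \<otimes> inv g) \<otimes> a \<otimes> inv (g \<otimes> t \<otimes> inv g) = t \<otimes> a \<otimes> inv t"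
    "\<And>a. a \<in> A \<Longrightarrow> t \<otimes> a = a \<otimes> t \<Longrightarrow> a = \<one>"
proof -
  interpret A: normal A G by (rule A(1))
  define C where "C = {x \<in> carrier G. \<forall>a\<in>A. x \<otimes> a = a \<otimes> x}"
  have C_carrier: "x \<in> carrier G" and C_comm: "a \<in> A \<Longrightarrow> x \<otimes> a = a \<otimes> x" if "x \<in> C" for x a
    using that unfolding C_def by blast+
  have sC: "subgroup C G" unfolding C_def by (rule subgroup_centralizer[OF A.subset])
  have "A \<subseteq> C" using comm A.subset unfolding C_def by blast
  then have oC: "openin T C" using openin_supergroup[OF sC A.subgroup_axioms A(2)] by blast
  have nC: "C \<lhd> G"
  proof (rule normal_invI[OF sC])
    fix g x assume g: "g \<in> carrier G" and x: "x \<in> C"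
    have "(g \<otimes> x \<otimes> inv g) \<otimes> a = a \<otimes> (g \<otimes> x \<otimes> inv g)" if a: "a \<in> A" for a
    proof -
      have aG: "a \<in> carrier G" using a A.subset by blast
      have "x \<otimes> (inv g \<otimes> a \<otimes> g) = (inv g \<otimes> a \<otimes> g) \<otimes> x"
        using C_comm[OF x] A.inv_op_closed1[OF g a] by blast
      then have "g \<otimes> (x \<otimes> (inv g \<otimes> a \<otimes> g)) \<otimes> inv g = g \<otimes> ((inv g \<otimes> a \<otimes> g) \<otimes> x) \<otimes> inv g" by simp
      then show ?thesis
        using g aG C_carrier[OF x] by (simp add: m_assoc) (simp flip: m_assoc)
    qed
    then show "g \<otimes> x \<otimes> inv g \<in> C" using g C_carrier[OF x] by (simp add: C_def)
  qed
  have "C \<noteq> carrier G"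
    using open_normal_not_central[OF A] C_comm by metis
  then obtain t where t: "t \<in> carrier G" "t \<notin> C"
    and tC: "\<And>g. g \<in> carrier G \<Longrightarrow> g \<otimes> t \<otimes> inv g \<otimes> inv t \<in> C"
    using central_mod_open_normal[OF prime nC oC] by metis
  \<comment> \<open>\<open>g \<otimes> t \<otimes> inv g\<close> differs from \<open>t\<close> by an
    element of \<open>C\<close>, and \<open>C\<close> acts trivially on \<open>A\<close>.\<close>
  have act: "(g \<otimes> t \<otimes> inv g) \<otimes> a \<otimes> inv (g \<otimes> t \<otimes> inv g) = t \<otimes> a \<otimes> inv t"
    if g: "g \<in> carrier G" and a: "a \<in> A" for g a
  proof -
    define c where "c = g \<otimes> t \<otimes> inv g \<otimes> inv t"
    have c: "c \<in> C" "c \<in> carrier G" using tC[OF g] g t(1) by (auto simp: c_def)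
    have gt: "g \<otimes> t \<otimes> inv g = c \<otimes> t" using g t(1) by (simp add: c_def m_assoc)
    define b where "b = t \<otimes> a \<otimes> inv t"
    have b: "b \<in> A" using A.inv_op_closed2[OF t(1) a] by (simp add: b_def)
    have cG: "a \<in> carrier G" "b \<in> carrier G" using a b A.subset by blast+
    have "(c \<otimes> t) \<otimes> a \<otimes> inv (c \<otimes> t) = c \<otimes> b \<otimes> inv c"
      using c(2) t(1) cG by (simp add: b_def m_assoc inv_mult_group)
    also have "\<dots> = b" using C_comm[OF c(1) b] c(2) cG by (simp add: inv_solve_right')
    finally show ?thesis by (simp add: gt b_def)
  qed
  define F where "F = A \<inter> {a \<in> carrier G. \<forall>y\<in>{t}. a \<otimes> y = y \<otimes> a}"
  have F_iff: "a \<in> F \<longleftrightarrow> a \<in> A \<and> t \<otimes> a = a \<otimes> t" for a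
    using A.subset by (auto simp: F_def)
  have sF: "subgroup F G"
    unfolding F_def by (intro subgroups_Inter_pair A.subgroup_axioms subgroup_centralizer) (use t in simp)
  have nF: "F \<lhd> G"
  proof (rule normal_invI[OF sF])
    fix g a assume g: "g \<in> carrier G" and a: "a \<in> F"
    then have aA: "a \<in> A" and ta: "t \<otimes> a = a \<otimes> t" by (auto simp: F_iff)
    have aG: "a \<in> carrier G" using aA A.subset by blast
    have ig: "inv g \<in> carrier G" using g by simp
    have "(inv g \<otimes> t \<otimes> g) \<otimes> a \<otimes> inv (inv g \<otimes> t \<otimes> g) = t \<otimes> a \<otimes> inv t"
      using act[OF ig aA] g by simp
    also have "\<dots> = a" using ta t(1) aG by (simp add: inv_solve_right')
    finally have "(inv g \<otimes> t \<otimes> g) \<otimes> a = a \<otimes> (inv g \<otimes> t \<otimes> g)"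
      using g t(1) aG by (simp add: inv_solve_right')
    then have "g \<otimes> ((inv g \<otimes> t \<otimes> g) \<otimes> a) \<otimes> inv g = g \<otimes> (a \<otimes> (inv g \<otimes> t \<otimes> g)) \<otimes> inv g" by simp
    moreover have "g \<otimes> (inv g \<otimes> x) = x" if "x \<in> carrier G" for x
      using g that by (simp flip: m_assoc)
    ultimately have "t \<otimes> (g \<otimes> a \<otimes> inv g) = (g \<otimes> a \<otimes> inv g) \<otimes> t"
      using g t(1) aG by (simp add: m_assoc)
    then show "g \<otimes> a \<otimes> inv g \<in> F" using A.inv_op_closed2[OF g aA] by (simp add: F_iff)
  qed
  have "closedin T F"
  proof -
    have "closedin T {a \<in> carrier G. t \<otimes> a \<otimes> inv t \<otimes> inv a \<in> {\<one>}}"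
      using continuous_map_mult_ops[OF continuous_map_mult_ops[OF continuous_map_left_translation[OF t(1)]
        continuous_map_const_op[OF inv_closed[OF t(1)]]] continuous_inv]
      by (rule closedin_preimage[OF _ closedin_singleton]) simp
    moreover have "F = A \<inter> {a \<in> carrier G. t \<otimes> a \<otimes> inv t \<otimes> inv a \<in> {\<one>}}"
      using commutator_eq_one_iff[OF t(1)] A.subset F_iff by blast
    ultimately show ?thesis
      using closedin_Int closedin_open_subgroup[OF A.subgroup_axioms A(2)] by metis
  qed
  have "F = {\<one>}"
  proof (rule ccontr)
    assume "F \<noteq> {\<one>}"
    then have oF: "openin T F" using closed_normal_open nF \<open>closedin T F\<close> by blast
    \<comment> \<open>With \<open>F\<close> open, some power of \<open>a\<close> is fixed by
      \<open>t\<close>, so a power of the commutator of \<open>t\<close> and \<open>a\<close> is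
      trivial. Torsion-freeness of \<open>A\<close> then makes \<open>t\<close> centralise
      \<open>a\<close>, against the choice of \<open>t\<close> outside \<open>C\<close>.\<close>
    have "t \<otimes> a = a \<otimes> t" if a: "a \<in> A" for a
    proof -
      have aG: "a \<in> carrier G" using a A.subset by blast
      obtain n :: nat where n: "n \<noteq> 0" "a [^] n \<in> F" using pow_mem_open_subgroup[OF sF oF aG] .
      let ?k = "\<lambda>a. t \<otimes> a \<otimes> inv t \<otimes> inv a"
      have k: "?k a \<in> A" if "a \<in> A" for a
        using A.inv_op_closed2[OF t(1) that] that by simp
      have pow: "a [^] m \<in> A \<and> ?k (a [^] m) = ?k a [^] m" for m :: nat
      proof (induction m)
        case 0
        then show ?case using t(1) by simp
      next
        case (Suc m)
        then show ?case
          using commutator_mult_abelian_normal[OF A(1) comm t(1) _ a, of "a [^] m"] a by simp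
      qed
      have "?k (a [^] n) = \<one>"
        using n(2) commutator_eq_one_iff[OF t(1), of "a [^] n"] aG by (simp add: F_iff)
      then have "?k a [^] n = \<one>" using pow[of n] by simp
      then have "?k a = \<one>" using open_normal_abelian_torsion_free[OF A comm k[OF a] _ n(1)] by blast
      then show ?thesis using commutator_eq_one_iff[OF t(1) aG] by simp
    qed
    then show False using t unfolding C_def by blast
  qed
  then have "\<And>a. a \<in> A \<Longrightarrow> t \<otimes> a = a \<otimes> t \<Longrightarrow> a = \<one>" using F_iff by blast
  then show thesis using that[OF t(1) act] by blast
qed

text \<open>The commutators of \<open>t\<close> with \<open>B\<close> are enough: they form the
  image of a homomorphism on \<open>B\<close>, which is normal since conjugates of \<open>t\<close>
  act on \<open>A\<close> like \<open>t\<close>, closed by compactness, and non-trivial since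
  \<open>t\<close> has no fixed points; so they form an open subgroup.\<close>

lemma infinite_open_commutator_closure_virtually_abelian:
  assumes A: "A \<lhd> G" "openin T A" and comm: "\<And>a b. a \<in> A \<Longrightarrow> b \<in> A \<Longrightarrow> a \<otimes> b = b \<otimes> a"
  shows "infinite {V. subgroup V G \<and> openin T V \<and> openin T (commutator_closure V)}"
proof -
  interpret A: normal A G by (rule A(1))
  obtain t where t: "t \<in> carrier G"
    and act: "\<And>g a. g \<in> carrier G \<Longrightarrow> a \<in> A \<Longrightarrow>
      (g \<otimes> t \<otimes> inv g) \<otimes> a \<otimes> inv (g \<otimes> t \<otimes> inv g) = t \<otimes> a \<otimes> inv t"
    and fpf: "\<And>a. a \<in> A \<Longrightarrow> t \<otimes> a = a \<otimes> t \<Longrightarrow> a = \<one>"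
    using exists_fixed_point_free_element[OF A comm] by blast
  obtain n :: nat where n: "n \<noteq> 0" "t [^] n \<in> A" using pow_mem_open_subgroup[OF A.subgroup_axioms A(2) t] .
  \<comment> \<open>\<open>t\<close> fixes its own power in \<open>A\<close>, so this power is
    trivial.\<close>
  have "t \<otimes> t [^] n = t [^] n \<otimes> t" using t by (metis nat_pow_Suc nat_pow_Suc2)
  then have tn: "t [^] n = \<one>" using fpf n(2) by blast
  let ?S = "generate G {t}"
  have sS: "subgroup ?S G" using generate_is_subgroup[of "{t}"] t by simp
  have "finite (carrier (subgroup_generated G {t}))"
    using finite_cyclic_subgroup[OF t] tn n(1) by blast
  then have fS: "finite ?S" using t by (simp add: carrier_subgroup_generated)
  then have cS: "closedin T ?S"
    using closedin_Hausdorff_finite[OF Hausdorff] subgroup.subset[OF sS] by (simp add: topspace_eq_carrier)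
  let ?V = "\<lambda>B. ?S <#> B" and ?\<B> = "{B. B \<lhd> G \<and> openin T B \<and> B \<subseteq> A}"
  let ?k = "\<lambda>b. t \<otimes> b \<otimes> inv t \<otimes> inv b"
  have V: "subgroup (?V B) G \<and> openin T (?V B) \<and> openin T (commutator_closure (?V B))" if "B \<in> ?\<B>" for B
  proof -
    have B: "B \<lhd> G" "openin T B" "B \<subseteq> A" using that by auto
    interpret B: normal B G by (rule B(1))
    have sV: "subgroup (?V B) G"
      using sS B(1) by (rule subgroup_set_mult_normal)
    have BV: "B \<subseteq> ?V B" using subset_set_mult2[OF sS B.subset] .
    have tV: "t \<in> ?V B"
      using subset_set_mult1[OF subgroup.subset[OF sS] B.subgroup_axioms] generate.incl[of t "{t}" G] by blast
    have oV: "openin T (?V B)" using openin_supergroup[OF sV B.subgroup_axioms B(2) BV] .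
    have kmult: "?k (a \<otimes> b) = ?k a \<otimes> ?k b" if "a \<in> B" "b \<in> B" for a b
      using commutator_mult_abelian_normal[OF A(1) comm t, of a b] that B(3) by blast
    have kA: "?k b \<in> carrier G" if "b \<in> B" for b using that t B.subset by (auto simp: subset_iff)
    have sR: "subgroup (?k ` B) G"
    proof (rule subgroupI)
      show "?k ` B \<subseteq> carrier G" using kA by blast
      show "?k ` B \<noteq> {}" using B.one_closed by blast
      fix x assume "x \<in> ?k ` B"
      then obtain a where a: "a \<in> B" "x = ?k a" by blast
      have "?k (inv a) \<otimes> ?k a = ?k (inv a \<otimes> a)" using kmult[of "inv a" a] a(1) by simp
      also have "\<dots> = \<one>" using a(1) t B.subset by (auto simp: subset_iff)
      finally have "inv x = ?k (inv a)"
        using a kA[of "inv a"] kA[of a] by (simp add: inv_equality)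
      then show "inv x \<in> ?k ` B" using a(1) B.m_inv_closed by blast
      fix y assume "y \<in> ?k ` B"
      then obtain b where b: "b \<in> B" "y = ?k b" by blast
      have "x \<otimes> y = ?k (a \<otimes> b)" using kmult[of a b] a b by simp
      then show "x \<otimes> y \<in> ?k ` B" using a(1) b(1) B.m_closed by blast
    qed
    have nR: "?k ` B \<lhd> G"
    proof (rule normal_invI[OF sR])
      fix g x assume g: "g \<in> carrier G" and "x \<in> ?k ` B"
      then obtain b where b: "b \<in> B" "x = ?k b" by blast
      have b': "g \<otimes> b \<otimes> inv g \<in> B" using B.inv_op_closed2[OF g b(1)] .
      then have bG: "b \<in> carrier G" "g \<otimes> b \<otimes> inv g \<in> A" using b(1) B.subset B(3) by blast+
      \<comment> \<open>Conjugation by \<open>g\<close> moves both \<open>t\<close> and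
        \<open>b\<close>; on \<open>A\<close> the conjugate of \<open>t\<close> may be replaced by
        \<open>t\<close> again.\<close>
      have "g \<otimes> x \<otimes> inv g = ?k (g \<otimes> b \<otimes> inv g)"
        using conj_commutator[OF g t bG(1)] act[OF g bG(2)] b(2) by simp
      then show "g \<otimes> x \<otimes> inv g \<in> ?k ` B" using b' by blast
    qed
    have "closedin T (?k ` B)"
    proof -
      have "compactin T B"
        using compact closedin_open_subgroup[OF B.subgroup_axioms B(2)] by (rule closedin_compact_space)
      then have "compactin T (?k ` B)"
        using continuous_map_mult_ops[OF continuous_map_mult_ops[OF continuous_map_left_translation[OF t]
          continuous_map_const_op[OF inv_closed[OF t]]] continuous_inv]
        by (rule image_compactin)
      then show ?thesis using Hausdorff compactin_imp_closedin by blast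
    qed
    moreover have "?k ` B \<noteq> {\<one>}"
    proof
      assume R1: "?k ` B = {\<one>}"
      have "b = \<one>" if "b \<in> B" for b
      proof -
        have "?k b = \<one>" using R1 that by blast
        then show ?thesis using commutator_eq_one_iff[OF t, of b] fpf[of b] that B(3) B.subset by blast
      qed
      then have "B = {\<one>}" using B.one_closed by blast
      then show False using open_subgroup_nontrivial[OF B(2)] by simp
    qed
    ultimately have oR: "openin T (?k ` B)" using closed_normal_open[OF nR] by blast
    have "?k ` B \<subseteq> commutator_closure (?V B)"
      using commutator_mem_commutator_closure tV BV by blast
    then have "openin T (commutator_closure (?V B))"
      using openin_supergroup[OF subgroup_commutator_closure[OF sV] sR oR] by blast
    then show ?thesis using sV oV by blast
  qed
  \<comment> \<open>Different \<open>B\<close> might give the same \<open>?V B\<close>, so these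
    groups are counted through their intersection, which lies in the finite group
    \<open>?S\<close>.\<close>
  have "infinite (?V ` ?\<B>)"
  proof (rule infinite_if_finite_Inter)
    show "subgroup W G \<and> openin T W" if "W \<in> ?V ` ?\<B>" for W using that V by blast
    have "carrier G \<inter> \<Inter>(?V ` ?\<B>) \<subseteq> ?S"
    proof
      fix x assume x: "x \<in> carrier G \<inter> \<Inter>(?V ` ?\<B>)"
      show "x \<in> ?S"
      proof (rule ccontr)
        assume "x \<notin> ?S"
        then obtain N where N: "N \<lhd> G" "openin T N" "\<And>m. m \<in> N \<Longrightarrow> x \<otimes> m \<notin> ?S"
          using coset_avoiding_closed[OF cS, of x] x by blast
        have "N \<inter> A \<in> ?\<B>" using N A normal_subgroup_intersect by blast
        then have "x \<in> ?V (N \<inter> A)" using x by blast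
        then obtain s b where sb: "s \<in> ?S" "b \<in> N" "x = s \<otimes> b" unfolding set_mult_def by blast
        have "s \<in> carrier G" "b \<in> carrier G" "inv b \<in> N"
          using sb subgroup.mem_carrier[OF sS] N(1) normal_imp_subgroup subgroup.mem_carrier
            subgroup.m_inv_closed by metis+
        then show False using N(3)[of "inv b"] sb by (simp add: m_assoc)
      qed
    qed
    then show "finite (carrier G \<inter> \<Inter>(?V ` ?\<B>))" using fS finite_subset by blast
  qed
  moreover have "?V ` ?\<B> \<subseteq> {V. subgroup V G \<and> openin T V \<and> openin T (commutator_closure V)}"
    using V by blast
  ultimately show ?thesis using finite_subset by blast
qed

lemma infinite_open_commutator_closure:
  "infinite {V. subgroup V G \<and> openin T V \<and> openin T (commutator_closure V)}"
proof (cases "\<exists>A. A \<lhd> G \<and> openin T A \<and> (\<forall>a\<in>A. \<forall>b\<in>A. a \<otimes> b = b \<otimes> a)")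
  case True
  then show ?thesis using infinite_open_commutator_closure_virtually_abelian by metis
next
  case False
  have "{U. U \<lhd> G \<and> openin T U} \<subseteq> {V. subgroup V G \<and> openin T V \<and> openin T (commutator_closure V)}"
  proof clarify
    fix U assume U: "U \<lhd> G" "openin T U"
    interpret U: normal U G by (rule U(1))
    obtain x y where xy: "x \<in> U" "y \<in> U" "x \<otimes> y \<noteq> y \<otimes> x" using False U by blast
    then have "x \<otimes> y \<otimes> inv x \<otimes> inv y \<noteq> \<one>" using commutator_eq_one_iff U.subset by blast
    then have "commutator_closure U \<noteq> {\<one>}" using commutator_mem_commutator_closure[OF xy(1,2)] by auto
    then have "openin T (commutator_closure U)"
      using closed_normal_open[OF normal_commutator_closure[OF U(1)]]
        closedin_commutator_closure[OF U.subgroup_axioms] by blast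
    then show "subgroup U G \<and> openin T U \<and> openin T (commutator_closure U)"
      using U.subgroup_axioms U(2) by blast
  qed
  then show ?thesis using infinite_open_normal finite_subset by blast
qed

end

section \<open>The direct product with the p-adic integers\<close>

locale topological_group_pair = H: topological_group H T\<^sub>H + Z: topological_group Z T\<^sub>Z
  for H :: "('a, 'm) monoid_scheme" and T\<^sub>H and Z :: "('b, 'n) monoid_scheme" and T\<^sub>Z
begin

abbreviation "G \<equiv> H \<times>\<times> Z"
abbreviation "T \<equiv> prod_topology T\<^sub>H T\<^sub>Z"

sublocale G: topological_group G T
proof (intro topological_group.intro topological_group_axioms.intro)
  show "group G" by (intro DirProd_group H.is_group Z.is_group)
  show "topspace T = carrier G" by (simp add: H.topspace_eq_carrier Z.topspace_eq_carrier)
  have fst1: "continuous_map (prod_topology T T) T\<^sub>H (\<lambda>q. fst (fst q))"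
    and fst2: "continuous_map (prod_topology T T) T\<^sub>H (\<lambda>q. fst (snd q))"
    and snd1: "continuous_map (prod_topology T T) T\<^sub>Z (\<lambda>q. snd (fst q))"
    and snd2: "continuous_map (prod_topology T T) T\<^sub>Z (\<lambda>q. snd (snd q))"
    using continuous_map_fst_of[OF continuous_map_fst] continuous_map_fst_of[OF continuous_map_snd]
      continuous_map_snd_of[OF continuous_map_fst] continuous_map_snd_of[OF continuous_map_snd]
    by (simp_all add: o_def)
  have "continuous_map (prod_topology T T) T
      (\<lambda>q. (fst (fst q) \<otimes>\<^bsub>H\<^esub> fst (snd q), snd (fst q) \<otimes>\<^bsub>Z\<^esub> snd (snd q)))"
    by (intro continuous_map_pairedI H.continuous_map_mult_ops Z.continuous_map_mult_ops fst1 fst2 snd1 snd2)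
  then show "continuous_map (prod_topology T T) T (\<lambda>(x, y). x \<otimes>\<^bsub>G\<^esub> y)"
    by (simp add: case_prod_unfold mult_DirProd')
  have "continuous_map T T (\<lambda>q. (inv\<^bsub>H\<^esub> (fst q), inv\<^bsub>Z\<^esub> (snd q)))"
    by (intro continuous_map_pairedI H.continuous_map_inv_op Z.continuous_map_inv_op
        continuous_map_fst continuous_map_snd)
  then show "continuous_map T T (\<lambda>x. inv\<^bsub>G\<^esub> x)"
    by (rule continuous_map_eq)
      (auto simp: H.topspace_eq_carrier Z.topspace_eq_carrier H.is_group Z.is_group)
qed

lemma pow_DirProd: "(h, z) [^]\<^bsub>G\<^esub> (n::nat) = (h [^]\<^bsub>H\<^esub> n, z [^]\<^bsub>Z\<^esub> n)"
  by (induction n) simp_all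

text \<open>Intersections with the factors are used instead of projections because, for a subgroup
  \<open>C\<close>, the product of its slices lies inside \<open>C\<close>; lower bounds for
  \<open>C\<close> can then be proved in each factor separately.\<close>

definition slice1 :: "('a \<times> 'b) set \<Rightarrow> 'a set" where
  "slice1 C = {h \<in> carrier H. (h, \<one>\<^bsub>Z\<^esub>) \<in> C}"

definition slice2 :: "('a \<times> 'b) set \<Rightarrow> 'b set" where
  "slice2 C = {z \<in> carrier Z. (\<one>\<^bsub>H\<^esub>, z) \<in> C}"

lemma hom_inclusion1: "group_hom H G (\<lambda>h. (h, \<one>\<^bsub>Z\<^esub>))"
  and hom_inclusion2: "group_hom Z G (\<lambda>z. (\<one>\<^bsub>H\<^esub>, z))"
  by (intro group_hom.intro group_hom_axioms.intro H.is_group Z.is_group G.is_group homI; simp)+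

lemma subgroup_slice1: "subgroup C G \<Longrightarrow> subgroup (slice1 C) H"
  and subgroup_slice2: "subgroup C G \<Longrightarrow> subgroup (slice2 C) Z"
  unfolding slice1_def slice2_def
  by (fact group_hom.subgroup_preimage[OF hom_inclusion1] group_hom.subgroup_preimage[OF hom_inclusion2])+

lemma continuous_inclusion1: "continuous_map T\<^sub>H T (\<lambda>h. (h, \<one>\<^bsub>Z\<^esub>))"
  and continuous_inclusion2: "continuous_map T\<^sub>Z T (\<lambda>z. (\<one>\<^bsub>H\<^esub>, z))"
  by (rule continuous_map_pairedI[OF continuous_map_id[unfolded id_def] Z.continuous_map_const_op[OF Z.one_closed]]
      continuous_map_pairedI[OF H.continuous_map_const_op[OF H.one_closed] continuous_map_id[unfolded id_def]])+

lemma openin_slice1: "openin T C \<Longrightarrow> openin T\<^sub>H (slice1 C)"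
  and closedin_slice1: "closedin T C \<Longrightarrow> closedin T\<^sub>H (slice1 C)"
  unfolding slice1_def
  by (rule H.openin_preimage[OF continuous_inclusion1] H.closedin_preimage[OF continuous_inclusion1]; assumption)+

lemma openin_slice2: "openin T C \<Longrightarrow> openin T\<^sub>Z (slice2 C)"
  and closedin_slice2: "closedin T C \<Longrightarrow> closedin T\<^sub>Z (slice2 C)"
  unfolding slice2_def
  by (rule Z.openin_preimage[OF continuous_inclusion2] Z.closedin_preimage[OF continuous_inclusion2]; assumption)+

lemma slice_Times_subset:
  assumes "subgroup C G"
  shows "slice1 C \<times> slice2 C \<subseteq> C"
proof clarify
  fix h z assume "h \<in> slice1 C" "z \<in> slice2 C"
  then have "(h, \<one>\<^bsub>Z\<^esub>) \<otimes>\<^bsub>G\<^esub> (\<one>\<^bsub>H\<^esub>, z) \<in> C" "h \<in> carrier H" "z \<in> carrier Z"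
    using subgroup.m_closed[OF assms, of "(h, \<one>\<^bsub>Z\<^esub>)" "(\<one>\<^bsub>H\<^esub>, z)"]
    by (auto simp: slice1_def slice2_def)
  then show "(h, z) \<in> C" by simp
qed

lemma subgroup_Times: "subgroup A H \<Longrightarrow> subgroup B Z \<Longrightarrow> subgroup (A \<times> B) G"
  by (intro DirProd_subgroups H.is_group Z.is_group)

lemma normal_Times:
  assumes "A \<lhd> H" "B \<lhd> Z"
  shows "A \<times> B \<lhd> G"
proof (rule G.normal_invI[OF subgroup_Times[OF assms[THEN normal_imp_subgroup]]])
  fix x h assume "x \<in> carrier G" "h \<in> A \<times> B"
  then show "x \<otimes>\<^bsub>G\<^esub> h \<otimes>\<^bsub>G\<^esub> inv\<^bsub>G\<^esub> x \<in> A \<times> B"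
    using normal.inv_op_closed2[OF assms(1)] normal.inv_op_closed2[OF assms(2)]
    by (auto simp: H.is_group Z.is_group)
qed

lemma normal_slice1:
  assumes "N \<lhd> G"
  shows "slice1 N \<lhd> H"
proof (rule H.normal_invI[OF subgroup_slice1[OF normal_imp_subgroup[OF assms]]])
  fix x h assume x: "x \<in> carrier H" and h: "h \<in> slice1 N"
  then have hH: "h \<in> carrier H" "(h, \<one>\<^bsub>Z\<^esub>) \<in> N" by (auto simp: slice1_def)
  have "(x, \<one>\<^bsub>Z\<^esub>) \<otimes>\<^bsub>G\<^esub> (h, \<one>\<^bsub>Z\<^esub>) \<otimes>\<^bsub>G\<^esub> inv\<^bsub>G\<^esub> (x, \<one>\<^bsub>Z\<^esub>) \<in> N"
    using normal.inv_op_closed2[OF assms _ hH(2), of "(x, \<one>\<^bsub>Z\<^esub>)"] x by simp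
  then show "x \<otimes>\<^bsub>H\<^esub> h \<otimes>\<^bsub>H\<^esub> inv\<^bsub>H\<^esub> x \<in> slice1 N"
    using x hH(1) by (simp add: slice1_def H.is_group Z.is_group)
qed

lemma normal_slice2:
  assumes "N \<lhd> G"
  shows "slice2 N \<lhd> Z"
proof (rule Z.normal_invI[OF subgroup_slice2[OF normal_imp_subgroup[OF assms]]])
  fix x z assume x: "x \<in> carrier Z" and z: "z \<in> slice2 N"
  then have zZ: "z \<in> carrier Z" "(\<one>\<^bsub>H\<^esub>, z) \<in> N" by (auto simp: slice2_def)
  have "(\<one>\<^bsub>H\<^esub>, x) \<otimes>\<^bsub>G\<^esub> (\<one>\<^bsub>H\<^esub>, z) \<otimes>\<^bsub>G\<^esub> inv\<^bsub>G\<^esub> (\<one>\<^bsub>H\<^esub>, x) \<in> N"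
    using normal.inv_op_closed2[OF assms _ zZ(2), of "(\<one>\<^bsub>H\<^esub>, x)"] x by simp
  then show "x \<otimes>\<^bsub>Z\<^esub> z \<otimes>\<^bsub>Z\<^esub> inv\<^bsub>Z\<^esub> x \<in> slice2 N"
    using x zZ(1) by (simp add: slice2_def H.is_group Z.is_group)
qed

end

lemma pro_p_group_DirProd:
  fixes H :: "('a, 'm) monoid_scheme" and Z :: "('b, 'n) monoid_scheme"
  assumes "prime p" "pro_p_group H T\<^sub>H p" "pro_p_group Z T\<^sub>Z p"
  shows "pro_p_group (H \<times>\<times> Z) (prod_topology T\<^sub>H T\<^sub>Z) p"
proof -
  interpret H: pro_p_group H T\<^sub>H p by fact
  interpret Z: pro_p_group Z T\<^sub>Z p by fact
  interpret topological_group_pair H T\<^sub>H Z T\<^sub>Z by unfold_locales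
  have "profinite_group G T"
  proof (intro profinite_group.intro profinite_group_axioms.intro)
    show "topological_group G T" by (rule G.topological_group_axioms)
    show "compact_space T" by (simp add: compact_space_prod_topology H.compact Z.compact)
    show "Hausdorff_space T" by (simp add: Hausdorff_space_prod_topology H.Hausdorff Z.Hausdorff)
    show "connected_component_of_set T x = {x}" if x: "x \<in> topspace T" for x
    proof -
      have "y = x" if y: "connected_component_of T x y" for y
      proof -
        have "connected_component_of T\<^sub>H (fst x) (fst y)" "connected_component_of T\<^sub>Z (snd x) (snd y)"
          using y connected_component_of_continuous_image continuous_map_fst continuous_map_snd by metis+
        moreover have "fst x \<in> topspace T\<^sub>H" "snd x \<in> topspace T\<^sub>Z" using x by auto
        ultimately show ?thesis
          using H.totally_disconnected[of "fst x"] Z.totally_disconnected[of "snd x"]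
          by (intro prod_eqI) auto
      qed
      then show ?thesis using x connected_component_of_refl by fastforce
    qed
  qed
  then interpret G: profinite_group G T .
  show ?thesis
  proof (rule G.pro_p_groupI[OF \<open>prime p\<close>])
    fix N x assume N: "N \<lhd> G" "openin T N" and x: "x \<in> carrier G"
    obtain h z where hz: "x = (h, z)" "h \<in> carrier H" "z \<in> carrier Z" using x by auto
    obtain i where i: "h [^]\<^bsub>H\<^esub> (p ^ i) \<in> slice1 N"
      using H.pow_mem_open_normal[OF normal_slice1[OF N(1)] openin_slice1[OF N(2)] hz(2)] by blast
    obtain j where j: "z [^]\<^bsub>Z\<^esub> (p ^ j) \<in> slice2 N"
      using Z.pow_mem_open_normal[OF normal_slice2[OF N(1)] openin_slice2[OF N(2)] hz(3)] by blast
    have sN: "subgroup N G" using N(1) by (rule normal_imp_subgroup)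
    have pow: "y [^]\<^bsub>K\<^esub> m \<in> S" if "subgroup S K" "y \<in> S" "group K" for K :: "('c, 'k) monoid_scheme" and S y and m :: nat
      using that by (induction m) (auto simp: subgroup.one_closed subgroup.m_closed)
    \<comment> \<open>Raising to further p-power exponents brings both components to the common
      exponent \<open>p ^ (i + j)\<close>.\<close>
    have "(h [^]\<^bsub>H\<^esub> (p ^ i)) [^]\<^bsub>H\<^esub> (p ^ j) \<in> slice1 N"
      "(z [^]\<^bsub>Z\<^esub> (p ^ j)) [^]\<^bsub>Z\<^esub> (p ^ i) \<in> slice2 N"
      using pow[OF subgroup_slice1[OF sN] i H.is_group] pow[OF subgroup_slice2[OF sN] j Z.is_group] by blast+
    then have "(h [^]\<^bsub>H\<^esub> (p ^ (i + j)), z [^]\<^bsub>Z\<^esub> (p ^ (i + j))) \<in> slice1 N \<times> slice2 N"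
      using hz by (simp add: H.nat_pow_pow Z.nat_pow_pow power_add mult.commute)
    then have "x [^]\<^bsub>G\<^esub> (p ^ (i + j)) \<in> N"
      using slice_Times_subset[OF sN] by (auto simp: hz(1) pow_DirProd)
    then show "\<exists>k. x [^]\<^bsub>G\<^esub> (p ^ k) \<in> N" by blast
  qed
qed

section \<open>Frattini subgroups and solitary subgroups of the product\<close>

locale just_infinite_times_padic =
  H: nonabelian_just_infinite_pro_p_group H T\<^sub>H p + Z: padic_coordinates Z T\<^sub>Z p c
  for H :: "('a, 'm) monoid_scheme" and T\<^sub>H and Z :: "('b, 'n) monoid_scheme" and T\<^sub>Z and p c
begin

sublocale topological_group_pair H T\<^sub>H Z T\<^sub>Z
  by unfold_locales

sublocale G: pro_p_group G T p
  by (intro pro_p_group_DirProd H.prime H.pro_p_group_axioms Z.pro_p_group)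

text \<open>\<open>N = R \<times> P\<close> lies in the Frattini subgroup of \<open>L\<close>. The
  factor \<open>R\<close> comes from an open normal subgroup of \<open>H\<close> inside
  \<open>slice1 L\<close>; in \<open>Z\<close> commutators vanish, so \<open>P\<close> consists of
  the p-th powers of \<open>slice2 L\<close>.\<close>

lemma exists_frattini_normal:
  assumes L: "subgroup L G" "openin T L"
  obtains N where "N \<lhd> G" "openin T N" "N \<subseteq> L"
    "\<And>K. subgroup K G \<Longrightarrow> closedin T K \<Longrightarrow> K <#>\<^bsub>G\<^esub> N = L \<Longrightarrow> K = L"
proof -
  have sL: "subgroup (slice1 L) H" "openin T\<^sub>H (slice1 L)" "subgroup (slice2 L) Z" "openin T\<^sub>Z (slice2 L)"
    using L by (auto intro: subgroup_slice1 subgroup_slice2 openin_slice1 openin_slice2)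
  obtain U where U: "U \<lhd> H" "openin T\<^sub>H U" "U \<subseteq> slice1 L"
    using H.open_normal_base[OF sL(2) subgroup.one_closed[OF sL(1)]] .
  obtain R where R: "R \<lhd> H" "openin T\<^sub>H R"
    and Rle: "\<And>C. subgroup C H \<Longrightarrow> closedin T\<^sub>H C \<Longrightarrow> (\<And>x. x \<in> U \<Longrightarrow> x [^]\<^bsub>H\<^esub> p \<in> C) \<Longrightarrow>
      (\<And>x y. x \<in> U \<Longrightarrow> y \<in> U \<Longrightarrow> x \<otimes>\<^bsub>H\<^esub> y \<otimes>\<^bsub>H\<^esub> inv\<^bsub>H\<^esub> x \<otimes>\<^bsub>H\<^esub> inv\<^bsub>H\<^esub> y \<in> C) \<Longrightarrow> R \<subseteq> C"
    using H.frattini_open[OF U(1,2)] by metis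
  let ?pw = "\<lambda>z. z [^]\<^bsub>Z\<^esub> p"
  define P where "P = ?pw ` slice2 L"
  have s2: "z \<in> carrier Z" if "z \<in> slice2 L" for z using that by (simp add: slice2_def)
  have "?pw \<in> hom Z Z" by (rule homI) (simp_all add: Z.nat_pow_distrib)
  then have "group_hom Z Z ?pw"
    by (intro group_hom.intro group_hom_axioms.intro Z.is_group)
  then have sP: "subgroup P Z" unfolding P_def using group_hom.subgroup_img_is_subgroup sL(3) by blast
  have "compactin T\<^sub>Z (slice2 L)"
    using Z.compact Z.closedin_open_subgroup[OF sL(3,4)] by (rule closedin_compact_space)
  then have "compactin T\<^sub>Z P"
    unfolding P_def using Z.continuous_map_pow_op[OF continuous_map_id[unfolded id_def]] by (rule image_compactin)
  then have cP: "closedin T\<^sub>Z P" using Z.Hausdorff compactin_imp_closedin by blast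
  \<comment> \<open>Torsion-freeness of \<open>Z\<close> makes the closed subgroup \<open>P\<close>
    non-trivial, hence open.\<close>
  have "P \<noteq> {\<one>\<^bsub>Z\<^esub>}"
  proof
    assume "P = {\<one>\<^bsub>Z\<^esub>}"
    then have "z = \<one>\<^bsub>Z\<^esub>" if "z \<in> slice2 L" for z
      using Z.torsion_free[OF s2[OF that], of p] that H.prime unfolding P_def by (metis image_eqI not_prime_0 singletonD)
    then have "slice2 L = {\<one>\<^bsub>Z\<^esub>}" using subgroup.one_closed[OF sL(3)] by blast
    then show False using sL(4) Z.not_openin_one by simp
  qed
  then have oP: "openin T\<^sub>Z P" using Z.nontrivial_closed_subgroup_open sP cP by blast
  have nP: "P \<lhd> Z" using sP by (rule Z.subgroup_imp_normal)
  have le: "R \<times> P \<subseteq> C" if C: "subgroup C G" "closedin T C" "\<And>x. x \<in> L \<Longrightarrow> x [^]\<^bsub>G\<^esub> p \<in> C"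
    "\<And>x y. x \<in> L \<Longrightarrow> y \<in> L \<Longrightarrow> x \<otimes>\<^bsub>G\<^esub> y \<otimes>\<^bsub>G\<^esub> inv\<^bsub>G\<^esub> x \<otimes>\<^bsub>G\<^esub> inv\<^bsub>G\<^esub> y \<in> C" for C
  proof -
    have UL: "(x, \<one>\<^bsub>Z\<^esub>) \<in> L" "x \<in> carrier H" if "x \<in> U" for x
      using that U(3) by (auto simp: slice1_def)
    have "R \<subseteq> slice1 C"
    proof (rule Rle)
      show "subgroup (slice1 C) H" "closedin T\<^sub>H (slice1 C)"
        using C(1,2) by (auto intro: subgroup_slice1 closedin_slice1)
      show "x [^]\<^bsub>H\<^esub> p \<in> slice1 C" if "x \<in> U" for x
        using C(3)[OF UL(1)[OF that]] UL(2)[OF that] by (simp add: slice1_def pow_DirProd)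
      show "x \<otimes>\<^bsub>H\<^esub> y \<otimes>\<^bsub>H\<^esub> inv\<^bsub>H\<^esub> x \<otimes>\<^bsub>H\<^esub> inv\<^bsub>H\<^esub> y \<in> slice1 C" if "x \<in> U" "y \<in> U" for x y
        using C(4)[OF UL(1)[OF that(1)] UL(1)[OF that(2)]] UL(2)[OF that(1)] UL(2)[OF that(2)]
        by (simp add: slice1_def H.is_group Z.is_group)
    qed
    moreover have "P \<subseteq> slice2 C"
    proof
      fix w assume "w \<in> P"
      then obtain z where z: "z \<in> slice2 L" "w = z [^]\<^bsub>Z\<^esub> p" by (auto simp: P_def)
      then show "w \<in> slice2 C"
        using C(3)[of "(\<one>\<^bsub>H\<^esub>, z)"] by (simp add: slice2_def pow_DirProd)
    qed
    ultimately show ?thesis using slice_Times_subset[OF C(1)] by blast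
  qed
  have nN: "R \<times> P \<lhd> G" using R(1) nP by (rule normal_Times)
  have pow_L: "x [^]\<^bsub>G\<^esub> p \<in> L" if "x \<in> L" for x
    using that L(1) by (induction p) (auto simp: subgroup.one_closed subgroup.m_closed simp del: one_DirProd)
  show thesis
  proof (rule that[OF nN])
    show "openin T (R \<times> P)" using R(2) oP by (simp add: openin_prod_Times_iff)
    \<comment> \<open>\<open>L\<close> itself is a closed subgroup containing its p-th powers and
      commutators.\<close>
    show "R \<times> P \<subseteq> L"
      by (rule le) (use L G.closedin_open_subgroup pow_L in \<open>auto simp: subgroup.m_closed subgroup.m_inv_closed\<close>)
    show "K = L" if "subgroup K G" "closedin T K" "K <#>\<^bsub>G\<^esub> (R \<times> P) = L" for K
      using G.eq_if_set_mult_frattini_eq[OF H.prime L nN le that] by blast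
  qed
qed

lemma open_subgroup_isolated:
  assumes L: "subgroup L G" "openin T L"
  shows "L \<in> isolated_points (subgroup_space G T)"
proof -
  obtain N where N: "N \<lhd> G" "openin T N" "N \<subseteq> L"
    and frattini: "\<And>K. subgroup K G \<Longrightarrow> closedin T K \<Longrightarrow> K <#>\<^bsub>G\<^esub> N = L \<Longrightarrow> K = L"
    using exists_frattini_normal[OF L] by metis
  have "L <#>\<^bsub>G\<^esub> N = L" using G.set_mult_absorb[OF L(1) normal_imp_subgroup[OF N(1)] N(3)] .
  then show ?thesis
    unfolding G.isolated_points_subgroup_space_iff
    using N(1,2) frattini L G.closedin_open_subgroup[OF L]
    by (intro conjI exI[of _ N]) (simp_all add: closed_subgroups_def)
qed

lemma countable_open_subgroups_prod: "countable {U. subgroup U G \<and> openin T U}"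
proof (rule G.countable_open_subgroups[OF G.compact])
  let ?\<B> = "(\<lambda>(U, n). U \<times> Z.level n) ` ({U. subgroup U H \<and> openin T\<^sub>H U} \<times> UNIV)"
  show "countable ?\<B>"
    using H.countable_open_subgroups_just_infinite by (intro countable_image countable_SIGMA) auto
  show "subgroup B G \<and> openin T B" if "B \<in> ?\<B>" for B
    using that subgroup_Times[OF _ Z.subgroup_level] Z.openin_level by (auto simp: openin_prod_Times_iff)
  show "\<exists>B\<in>?\<B>. B \<subseteq> U" if U: "subgroup U G" "openin T U" for U
  proof -
    obtain n where "Z.level n \<subseteq> slice2 U"
      using Z.level_base[OF openin_slice2[OF U(2)] subgroup.one_closed[OF subgroup_slice2[OF U(1)]]] .
    then have "slice1 U \<times> Z.level n \<subseteq> U" using slice_Times_subset[OF U(1)] by blast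
    moreover have "slice1 U \<times> Z.level n \<in> ?\<B>"
      using subgroup_slice1[OF U(1)] openin_slice1[OF U(2)] by force
    ultimately show ?thesis by (rule bexI)
  qed
qed

text \<open>The isolating \<open>N\<close> belongs to the open subgroup \<open>?L0\<close>, not to
  \<open>?K\<close>. If \<open>L\<close> agrees with \<open>?K\<close> modulo \<open>N\<close>, then
  multiplication by the second factor \<open>?E\<close> makes \<open>L <#> ?E\<close> agree with
  \<open>?L0\<close> modulo \<open>N\<close>, and the Frattini property removes \<open>N\<close>:
  \<open>L\<close> projects exactly onto \<open>V\<close>.\<close>

lemma solitary_Times_one:
  assumes V: "subgroup V H" "openin T\<^sub>H V" and D: "openin T\<^sub>H (H.commutator_closure V)"
  shows "solitary G T (V \<times> {\<one>\<^bsub>Z\<^esub>})"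
proof -
  let ?K = "V \<times> {\<one>\<^bsub>Z\<^esub>}" and ?E = "{\<one>\<^bsub>H\<^esub>} \<times> carrier Z" and ?L0 = "V \<times> carrier Z"
  let ?I = "isolated_points (subgroup_space G T)"
  have VH: "V \<subseteq> carrier H" using V(1) by (rule subgroup.subset)
  have sK: "subgroup ?K G" using V(1) Z.triv_subgroup by (rule subgroup_Times)
  have "closedin T ?K"
    using H.closedin_open_subgroup[OF V] Z.closedin_singleton[OF Z.one_closed]
    by (simp add: closedin_prod_Times_iff)
  then have K: "?K \<in> closed_subgroups G T" using sK by (simp add: closed_subgroups_def)
  have "\<not> openin T ?K"
  proof
    assume "openin T ?K"
    then have "openin T\<^sub>Z (slice2 ?K)" by (rule openin_slice2)
    moreover have "slice2 ?K = {\<one>\<^bsub>Z\<^esub>}" using subgroup.one_closed[OF V(1)] by (auto simp: slice2_def)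
    ultimately show False using Z.not_openin_one by simp
  qed
  then have K_not: "?K \<notin> ?I" using G.isolated_imp_open by blast
  have sL0: "subgroup ?L0 G" using V(1) Z.subgroup_self by (rule subgroup_Times)
  have oL0: "openin T ?L0" using V(2) Z.openin_carrier by (simp add: openin_prod_Times_iff)
  obtain N where N: "N \<lhd> G" "openin T N" "N \<subseteq> ?L0"
    and frattini: "\<And>M. subgroup M G \<Longrightarrow> closedin T M \<Longrightarrow> M <#>\<^bsub>G\<^esub> N = ?L0 \<Longrightarrow> M = ?L0"
    using exists_frattini_normal[OF sL0 oL0] by metis
  have sN: "subgroup N G" using N(1) by (rule normal_imp_subgroup)
  have nE: "?E \<lhd> G" using H.one_is_normal Z.normal_self by (rule normal_Times)
  have sE: "subgroup ?E G" using nE by (rule normal_imp_subgroup)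
  have KE: "?K <#>\<^bsub>G\<^esub> ?E = ?L0"
  proof
    show "?K <#>\<^bsub>G\<^esub> ?E \<subseteq> ?L0" using VH by (auto simp: set_mult_def)
    show "?L0 \<subseteq> ?K <#>\<^bsub>G\<^esub> ?E"
    proof clarify
      fix v z assume vz: "v \<in> V" "z \<in> carrier Z"
      then have "(v, z) = (v, \<one>\<^bsub>Z\<^esub>) \<otimes>\<^bsub>G\<^esub> (\<one>\<^bsub>H\<^esub>, z)" using VH by auto
      then show "(v, z) \<in> ?K <#>\<^bsub>G\<^esub> ?E" using vz unfolding set_mult_def by blast
    qed
  qed
  have "L = ?K" if L: "L \<in> closed_subgroups G T - ?I" and LN: "L <#>\<^bsub>G\<^esub> N = ?K <#>\<^bsub>G\<^esub> N" for L
  proof -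
    have sL: "subgroup L G" and cL: "closedin T L" using L by (auto simp: closed_subgroups_def)
    have noL: "\<not> openin T L" using L open_subgroup_isolated[OF sL] by blast
    note sub = sL[THEN subgroup.subset] sK[THEN subgroup.subset] sN[THEN subgroup.subset] sE[THEN subgroup.subset]
    have EN: "?E <#>\<^bsub>G\<^esub> N = N <#>\<^bsub>G\<^esub> ?E" using G.commut_normal[OF sE N(1)] .
    have "(L <#>\<^bsub>G\<^esub> ?E) <#>\<^bsub>G\<^esub> N = (L <#>\<^bsub>G\<^esub> N) <#>\<^bsub>G\<^esub> ?E"
      using G.set_mult_assoc[OF sub(1,4,3)] G.set_mult_assoc[OF sub(1,3,4)] EN by simp
    also have "\<dots> = (?K <#>\<^bsub>G\<^esub> ?E) <#>\<^bsub>G\<^esub> N"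
      using G.set_mult_assoc[OF sub(2,4,3)] G.set_mult_assoc[OF sub(2,3,4)] EN LN by simp
    also have "\<dots> = ?L0" using KE G.set_mult_absorb[OF sL0 sN N(3)] by simp
    finally have LEN: "(L <#>\<^bsub>G\<^esub> ?E) <#>\<^bsub>G\<^esub> N = ?L0" .
    have sLE: "subgroup (L <#>\<^bsub>G\<^esub> ?E) G"
      using sL nE by (rule G.subgroup_set_mult_normal)
    \<comment> \<open>The Frattini property speaks of closed subgroups only; this product is a
      continuous image of a compact set.\<close>
    have "closedin T (L <#>\<^bsub>G\<^esub> ?E)"
    proof -
      have "closedin T ?E"
        using H.closedin_singleton[OF H.one_closed] Z.closedin_carrier by (simp add: closedin_prod_Times_iff)
      then have "compactin T ?E" "compactin T L"
        using cL G.compact closedin_compact_space by blast+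
      then have "compactin (prod_topology T T) (L \<times> ?E)" by (subst compactin_Times) blast
      then have "compactin T ((\<lambda>(x, y). x \<otimes>\<^bsub>G\<^esub> y) ` (L \<times> ?E))"
        using G.continuous_mult by (rule image_compactin)
      moreover have "(\<lambda>(x, y). x \<otimes>\<^bsub>G\<^esub> y) ` (L \<times> ?E) = L <#>\<^bsub>G\<^esub> ?E" by (force simp: set_mult_def)
      ultimately show ?thesis using G.Hausdorff compactin_imp_closedin by metis
    qed
    then have LE: "L <#>\<^bsub>G\<^esub> ?E = ?L0" using frattini sLE LEN by blast
    have L_sub: "v \<in> V" "a \<in> carrier Z" if "(v, a) \<in> L" for v a
    proof -
      have "(v, a) \<in> L <#>\<^bsub>G\<^esub> ?E" using G.subset_set_mult1[OF sub(1) sE] that by (rule subsetD)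
      then show "v \<in> V" "a \<in> carrier Z" using LE by auto
    qed
    have L_proj: "\<exists>a. (v, a) \<in> L" if v: "v \<in> V" for v
    proof -
      have "(v, \<one>\<^bsub>Z\<^esub>) \<in> L <#>\<^bsub>G\<^esub> ?E" using LE v by simp
      then obtain w a z where "(w, a) \<in> L" and "(v, \<one>\<^bsub>Z\<^esub>) = (w, a) \<otimes>\<^bsub>G\<^esub> (\<one>\<^bsub>H\<^esub>, z)"
        unfolding set_mult_def by auto
      moreover have "w \<in> carrier H" using L_sub(1)[OF \<open>(w, a) \<in> L\<close>] VH by blast
      ultimately have "v = w" by simp
      then show ?thesis using \<open>(w, a) \<in> L\<close> by blast
    qed
    have s1: "subgroup (slice1 L) H" "closedin T\<^sub>H (slice1 L)"
      and s2: "subgroup (slice2 L) Z" "closedin T\<^sub>Z (slice2 L)"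
      using sL cL by (auto intro: subgroup_slice1 subgroup_slice2 closedin_slice1 closedin_slice2)
    \<comment> \<open>As \<open>Z\<close> is abelian, commutators of elements of \<open>L\<close>
      have trivial second component, so \<open>slice1 L\<close> contains the commutators of the
      projection \<open>V\<close>.\<close>
    have "H.commutator_closure V \<subseteq> slice1 L"
    proof (rule H.commutator_closure_le[OF s1])
      fix x y assume xy: "x \<in> V" "y \<in> V"
      then obtain a b where ab: "(x, a) \<in> L" "(y, b) \<in> L" using L_proj by blast
      have c: "x \<in> carrier H" "y \<in> carrier H" "a \<in> carrier Z" "b \<in> carrier Z"
        using xy VH L_sub ab by blast+
      have "(x, a) \<otimes>\<^bsub>G\<^esub> (y, b) \<otimes>\<^bsub>G\<^esub> inv\<^bsub>G\<^esub> (x, a) \<otimes>\<^bsub>G\<^esub> inv\<^bsub>G\<^esub> (y, b) \<in> L"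
        by (intro subgroup.m_closed[OF sL] subgroup.m_inv_closed[OF sL] ab)
      moreover have "a \<otimes>\<^bsub>Z\<^esub> b \<otimes>\<^bsub>Z\<^esub> inv\<^bsub>Z\<^esub> a \<otimes>\<^bsub>Z\<^esub> inv\<^bsub>Z\<^esub> b = \<one>\<^bsub>Z\<^esub>"
        using Z.commutator_eq_one_iff[OF c(3,4)] Z.m_comm[OF c(3,4)] by simp
      ultimately show "x \<otimes>\<^bsub>H\<^esub> y \<otimes>\<^bsub>H\<^esub> inv\<^bsub>H\<^esub> x \<otimes>\<^bsub>H\<^esub> inv\<^bsub>H\<^esub> y \<in> slice1 L"
        using c by (simp add: slice1_def H.is_group Z.is_group)
    qed
    then have o1: "openin T\<^sub>H (slice1 L)"
      using H.openin_supergroup[OF s1(1) H.subgroup_commutator_closure[OF V(1)] D] by blast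
    \<comment> \<open>A non-trivial \<open>slice2 L\<close> would be open in \<open>Z\<close>, and
      \<open>L\<close> would be open because it contains the product of its two open slices.\<close>
    have "slice2 L = {\<one>\<^bsub>Z\<^esub>}"
    proof (rule ccontr)
      assume "slice2 L \<noteq> {\<one>\<^bsub>Z\<^esub>}"
      then have "openin T\<^sub>Z (slice2 L)" using Z.nontrivial_closed_subgroup_open s2 by blast
      then have "openin T (slice1 L \<times> slice2 L)" using o1 by (simp add: openin_prod_Times_iff)
      then have "openin T L"
        using G.openin_supergroup[OF sL subgroup_Times[OF s1(1) s2(1)]] slice_Times_subset[OF sL] by blast
      then show False using noL by simp
    qed
    then have s2_one: "z = \<one>\<^bsub>Z\<^esub>" if "z \<in> slice2 L" for z using that by blast
    have a1: "a = \<one>\<^bsub>Z\<^esub>" if va: "(v, a) \<in> L" for v a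
    proof -
      have c: "v \<in> carrier H" "a \<in> carrier Z" using L_sub[OF va] VH by auto
      obtain n :: nat where n: "n \<noteq> 0" "v [^]\<^bsub>H\<^esub> n \<in> slice1 L"
        using H.pow_mem_open_subgroup[OF s1(1) o1 c(1)] .
      \<comment> \<open>\<open>L\<close> contains the n-th power of \<open>(v, a)\<close> and also
        the pair of \<open>v [^] n\<close> and \<open>\<one>\<close>; their quotient puts
        \<open>a [^] n\<close> into the trivial \<open>slice2 L\<close>, and \<open>Z\<close> is
        torsion-free.\<close>
      have "(v, a) [^]\<^bsub>G\<^esub> n \<in> L"
        using va sL by (induction n) (auto simp: subgroup.one_closed subgroup.m_closed simp del: one_DirProd)
      then have "(v [^]\<^bsub>H\<^esub> n, a [^]\<^bsub>Z\<^esub> n) \<in> L" by (simp add: pow_DirProd)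
      moreover have "(v [^]\<^bsub>H\<^esub> n, \<one>\<^bsub>Z\<^esub>) \<in> L" using n(2) by (simp add: slice1_def)
      ultimately have "inv\<^bsub>G\<^esub> (v [^]\<^bsub>H\<^esub> n, \<one>\<^bsub>Z\<^esub>) \<otimes>\<^bsub>G\<^esub> (v [^]\<^bsub>H\<^esub> n, a [^]\<^bsub>Z\<^esub> n) \<in> L"
        by (intro subgroup.m_closed[OF sL] subgroup.m_inv_closed[OF sL])
      then have "a [^]\<^bsub>Z\<^esub> n \<in> slice2 L" using c by (simp add: slice2_def H.is_group Z.is_group)
      then show ?thesis using Z.torsion_free[OF c(2) s2_one n(1)] by blast
    qed
    show "L = ?K"
    proof
      show "L \<subseteq> ?K" using a1 L_sub(1) by auto
      show "?K \<subseteq> L" using a1 L_proj by fastforce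
    qed
  qed
  \<comment> \<open>The definition of \<open>solitary\<close> also demands that the space of closed
    subgroups is not perfect.\<close>
  moreover have "carrier G \<in> ?I"
    using open_subgroup_isolated[OF G.subgroup_self G.openin_carrier] .
  ultimately show ?thesis
    unfolding G.solitary_iff using K K_not N(1,2) by blast
qed

lemma infinite_solitary: "infinite {K. solitary G T K}"
proof -
  let ?\<V> = "{V. subgroup V H \<and> openin T\<^sub>H V \<and> openin T\<^sub>H (H.commutator_closure V)}"
  have "inj_on (\<lambda>V. V \<times> {\<one>\<^bsub>Z\<^esub>}) ?\<V>" by (auto simp: inj_on_def)
  then have "infinite ((\<lambda>V. V \<times> {\<one>\<^bsub>Z\<^esub>}) ` ?\<V>)"
    using H.infinite_open_commutator_closure finite_image_iff by blast
  moreover have "(\<lambda>V. V \<times> {\<one>\<^bsub>Z\<^esub>}) ` ?\<V> \<subseteq> {K. solitary G T K}"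
    using solitary_Times_one by blast
  ultimately show ?thesis using finite_subset by blast
qed

end

theorem corollary4p10:
  fixes p :: nat
    and H :: "'a monoid" and T\<^sub>H :: "'a topology"
    and Z :: "'b monoid" and T\<^sub>Z :: "'b topology"
  assumes "prime p"
    and "pro_p_group H T\<^sub>H p"
    and "just_infinite H T\<^sub>H"
    and "\<not> comm_group H"
    and "topological_group Z T\<^sub>Z"
    and "topologically_isomorphic Z T\<^sub>Z (padic_int_group p) (padic_int_topology p)"
  shows "infinite {K. solitary (H \<times>\<times> Z) (prod_topology T\<^sub>H T\<^sub>Z) K} \<and>
         countable {K. solitary (H \<times>\<times> Z) (prod_topology T\<^sub>H T\<^sub>Z) K}"
proof -
  obtain c where c: "padic_coordinates Z T\<^sub>Z p c"
    using padic_coordinates_exist[OF assms(1,5,6)] by blast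
  have "nonabelian_just_infinite_pro_p_group H T\<^sub>H p"
    using assms(1,3,4)
    by (intro nonabelian_just_infinite_pro_p_group.intro nonabelian_just_infinite_pro_p_group_axioms.intro assms(2))
      (auto simp: just_infinite_def)
  then interpret just_infinite_times_padic H T\<^sub>H Z T\<^sub>Z p c
    using c by (rule just_infinite_times_padic.intro)
  show ?thesis
    using infinite_solitary G.countable_solitary[OF countable_open_subgroups_prod] by blast
qed

end
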